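(* There is an algorithm that, for any Boolean concept class $\mathcal C$ of functions $\{\pm1\}^n\to\{\pm1\}$, any parameters $\varepsilon>0$, $\sigma\in(0,1/2)$, $\delta\in(0,1)$, and any distribution $\mathcal D$ on $\{\pm1\}^n\times\{\pm1\}$ whose marginal on $\{\pm1\}^n$ is uniform, given i.i.d. samples from $\mathcal D$, has running time and sample complexity $$\mathrm{poly}\!\left(n^{\log(1/\varepsilon)/\sigma},\,\log(1/\delta)\right)$$ and, with probability at least $1-\delta$, outputs a hypothesis $h:\{\pm1\}^n\to\{\pm1\}$ with $$\mathrm{err}_{\mathcal D}(h)\le \mathrm{opt}_{\mathcal C,\sigma}+\varepsilon .$$
   Context: $\mathrm{err}_{\mathcal D}(h)=\Pr_{(X,Y)\sim\mathcal D}[h(X)\neq Y]$. The smoothed benchmark is $$\mathrm{opt}_{\mathcal C,\sigma}=\inf_{f\in\mathcal C}\ \mathbb E_{Z\sim B(\sigma)^n}\Bigl[\Pr_{(X,Y)\sim\mathcal D}[f(X\odot Z)\neq Y]\Bigr],$$ where $Z\sim B(\sigma)^n$ means that each coordinate of $Z\in\{\pm1\}^n$ is independently $-1$ with probability $\sigma$ (and $+1$ otherwise), and $\odot$ denotes the coordinatewise (Hadamard) product. The hypothesis $h$ need not belong to $\mathcal C$ (improper learning). $\mathrm{poly}(a,b)$ denotes a quantity bounded by a fixed polynomial in $a,b$, the same for all $n,\mathcal C,\varepsilon,\sigma,\delta,\mathcal D$.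
   Formalization: The formal theorem assumes n ≥ 2 (for n = 1 the bound n^{log(1/ε)/σ} equals 1, so the sample size could not depend on ε, and the claim is false) and that the class C is nonempty, so that opt is a real number. *)

theory Defs
  imports "HOL-Probability.Probability" "HOL-Computational_Algebra.Polynomial"
begin

section \<open>Learning under the uniform marginal, and the smoothed benchmark\<close>

text \<open>Points of the cube are functions that are \<open>undefined\<close> from index \<open>n\<close> on.\<close>

type_synonym point = "nat \<Rightarrow> int"
type_synonym example = "point \<times> int"

definition cube :: "nat \<Rightarrow> point set" where
  "cube n = {..<n} \<rightarrow>\<^sub>E {- 1, 1}"

definition hadamard :: "nat \<Rightarrow> point \<Rightarrow> point \<Rightarrow> point" where
  "hadamard n x z = (\<lambda>i\<in>{..<n}. x i * z i)"

definition noise :: "nat \<Rightarrow> real \<Rightarrow> point pmf" where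
  "noise n \<sigma> = Pi_pmf {..<n} undefined (\<lambda>_. map_pmf (\<lambda>b. if b then - 1 else 1) (bernoulli_pmf \<sigma>))"

definition err :: "example pmf \<Rightarrow> (point \<Rightarrow> int) \<Rightarrow> real" where
  "err D h = measure_pmf.prob D {(x, y). h x \<noteq> y}"

definition smoothed_opt :: "nat \<Rightarrow> real \<Rightarrow> example pmf \<Rightarrow> (point \<Rightarrow> int) set \<Rightarrow> real" where
  "smoothed_opt n \<sigma> D \<C> =
     (INF f\<in>\<C>. measure_pmf.expectation (noise n \<sigma>)
        (\<lambda>z. measure_pmf.prob D {(x, y). f (hadamard n x z) \<noteq> y}))"

definition uniform_marginal :: "nat \<Rightarrow> example pmf \<Rightarrow> bool" where
  "uniform_marginal n D \<longleftrightarrow>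
     set_pmf D \<subseteq> cube n \<times> {- 1, 1} \<and> map_pmf fst D = pmf_of_set (cube n)"


section \<open>Machine model\<close>

text \<open>
  Algorithms are programs of a random access machine over the integers, in structured form.
  Every instruction and every evaluation of a guard costs one step. The only arithmetic
  operations are addition and subtraction, so that in \<open>t\<close> steps the bit length of a number grows
  by \<open>O(t)\<close> and the step count is polynomially related to Turing machine time; unit-cost
  multiplication would not have this property.

  The real parameters \<open>\<epsilon>\<close>, \<open>\<sigma>\<close>, \<open>\<delta>\<close> are never stored in memory. A program can access them only
  by comparing them with a rational number whose numerator and denominator it has computed.

  Examples are supplied as an input list whose head is the current example. A program reads
  single coordinates and the label of the current example, and moves on to the next one. It is
  stuck when it reads past the end of the list or at a coordinate outside \<open>{..<n}\<close>, hence a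
  terminating run on a list of length \<open>m\<close> uses at most \<open>m\<close> examples.
\<close>

datatype param = Eps | Sig | Del

fun params :: "real \<Rightarrow> real \<Rightarrow> real \<Rightarrow> param \<Rightarrow> real" where
  "params \<epsilon> \<sigma> \<delta> Eps = \<epsilon>"
| "params \<epsilon> \<sigma> \<delta> Sig = \<sigma>"
| "params \<epsilon> \<sigma> \<delta> Del = \<delta>"

type_synonym addr = int

datatype com =
    SET addr int
  | ADD addr addr addr
  | SUB addr addr addr
  | LOAD addr addr
  | STORE addr addr
  | TEST addr param addr addr
  | COORD addr addr
  | LABEL addr
  | NEXT
  | SEQ com com  (infixr ";;" 60)
  | IFPOS addr com com
  | WHILEPOS addr com

type_synonym memory = "addr \<Rightarrow> int"
type_synonym state = "memory \<times> example list"

text \<open>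
  \<open>exec n v c s t s'\<close>: started in \<open>s\<close>, the program \<open>c\<close> halts in \<open>s'\<close> after exactly \<open>t\<close> steps.
  Destinations come first, except that \<open>STORE a b\<close> writes the content of \<open>b\<close> to the cell whose
  address is in \<open>a\<close>.
\<close>

inductive exec :: "nat \<Rightarrow> (param \<Rightarrow> real) \<Rightarrow> com \<Rightarrow> state \<Rightarrow> nat \<Rightarrow> state \<Rightarrow> bool"
  for n :: nat and v :: "param \<Rightarrow> real" where
  Set: "exec n v (SET r k) (M, I) 1 (M(r := k), I)"
| Add: "exec n v (ADD r a b) (M, I) 1 (M(r := M a + M b), I)"
| Sub: "exec n v (SUB r a b) (M, I) 1 (M(r := M a - M b), I)"
| Load: "exec n v (LOAD r a) (M, I) 1 (M(r := M (M a)), I)"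
| Store: "exec n v (STORE a b) (M, I) 1 (M(M a := M b), I)"
| Test: "exec n v (TEST r p a b) (M, I) 1
           (M(r := (if real_of_int (M a) \<le> v p * real_of_int (M b) then 1 else 0)), I)"
| Coord: "0 \<le> M a \<Longrightarrow> M a < int n \<Longrightarrow>
           exec n v (COORD r a) (M, (x, y) # I) 1 (M(r := x (nat (M a))), (x, y) # I)"
| Label: "exec n v (LABEL r) (M, (x, y) # I) 1 (M(r := y), (x, y) # I)"
| Next: "exec n v NEXT (M, e # I) 1 (M, I)"
| Seq: "exec n v c1 s1 t1 s2 \<Longrightarrow> exec n v c2 s2 t2 s3 \<Longrightarrow> exec n v (c1 ;; c2) s1 (t1 + t2) s3"
| IfTrue: "M a > 0 \<Longrightarrow> exec n v c1 (M, I) t s \<Longrightarrow> exec n v (IFPOS a c1 c2) (M, I) (t + 1) s"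
| IfFalse: "\<not> M a > 0 \<Longrightarrow> exec n v c2 (M, I) t s \<Longrightarrow> exec n v (IFPOS a c1 c2) (M, I) (t + 1) s"
| WhileFalse: "\<not> M a > 0 \<Longrightarrow> exec n v (WHILEPOS a c) (M, I) 1 (M, I)"
| WhileTrue: "M a > 0 \<Longrightarrow> exec n v c (M, I) t1 s1 \<Longrightarrow> exec n v (WHILEPOS a c) s1 t2 s2 \<Longrightarrow>
           exec n v (WHILEPOS a c) (M, I) (t1 + t2 + 1) s2"

lemma exec_deterministic:
  assumes "exec n v c s t s'" and "exec n v c s u s''"
  shows "t = u \<and> s' = s''"
  using assms
proof (induction arbitrary: u s'' rule: exec.induct)
  case (Seq c1 s1 t1 s2 c2 t2 s3)
  from Seq.prems obtain u1 u2 r where "exec n v c1 s1 u1 r" "exec n v c2 r u2 s''" "u = u1 + u2"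
    by cases
  with Seq.IH(1)[of u1 r] Seq.IH(2)[of u2 s''] show ?case by simp
next
  case (IfTrue M a c1 I t s c2)
  from IfTrue.prems IfTrue.hyps(1) obtain u' where "exec n v c1 (M, I) u' s''" "u = u' + 1"
    by cases simp_all
  with IfTrue.IH[of u' s''] show ?case by simp
next
  case (IfFalse M a c2 I t s c1)
  from IfFalse.prems IfFalse.hyps(1) obtain u' where "exec n v c2 (M, I) u' s''" "u = u' + 1"
    by cases simp_all
  with IfFalse.IH[of u' s''] show ?case by simp
next
  case (WhileFalse M a c I)
  from WhileFalse.prems WhileFalse.hyps show ?case by cases simp_all
next
  case (WhileTrue M a c I t1 s1 t2 s2)
  from WhileTrue.prems WhileTrue.hyps(1) obtain u1 u2 r
    where "exec n v c (M, I) u1 r" "exec n v (WHILEPOS a c) r u2 s''" "u = u1 + u2 + 1"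
    by cases simp_all
  with WhileTrue.IH(1)[of u1 r] WhileTrue.IH(2)[of u2 s''] show ?case by simp
qed (erule exec.cases; simp)+

text \<open>
  A learner is a pair of programs. The first one is run on the samples, and its final memory
  content is the representation of the hypothesis. The second one evaluates the hypothesis: started
  from that memory on a point \<open>x\<close>, it leaves \<open>h x\<close> in cell \<open>0\<close>. The label of the example
  containing \<open>x\<close> is a dummy, so the evaluation sees neither the samples nor any label of \<open>x\<close>.
  Both programs obey the time bound; without a bound on the evaluation, the work of the learner
  could be postponed to it.
\<close>

type_synonym learner = "com \<times> com"

definition init_memory :: "nat \<Rightarrow> memory" where
  "init_memory n = (\<lambda>_. 0)(0 := int n)"

definition outputs ::
  "learner \<Rightarrow> nat \<Rightarrow> (param \<Rightarrow> real) \<Rightarrow> real \<Rightarrow> example list \<Rightarrow> (point \<Rightarrow> int) \<Rightarrow> bool" where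
  "outputs A n v T S h \<longleftrightarrow>
     (\<exists>t M I. exec n v (fst A) (init_memory n, S) t (M, I) \<and> real t \<le> T \<and>
        (\<forall>x\<in>cube n. \<exists>t' M' I'.
           exec n v (snd A) (M, [(x, 1)]) t' (M', I') \<and> real t' \<le> T \<and> M' 0 = h x))"

definition poly2 :: "real poly poly \<Rightarrow> real \<Rightarrow> real \<Rightarrow> real" where
  "poly2 P a b = poly (poly P [:b:]) a"

end

theory Submission
  imports Defs
begin

text \<open>
  Write \<open>T f(x)\<close> for the expectation of \<open>f(x \<odot> Z)\<close>. For a label \<open>y = \<plusminus>1\<close> one has
  \<open>\<bar>y - T f(x)\<bar> = 2 Pr(f(x \<odot> Z) \<noteq> y)\<close>, so the benchmark is half the \<open>L\<^sub>1\<close> distance of the labels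
  from \<open>T f\<close>. The Fourier coefficients of \<open>T f\<close> at level \<open>k\<close> are damped by \<open>(1 - 2\<sigma>)\<^sup>k\<close>; hence \<open>T f\<close> is
  within \<open>(1 - 2\<sigma>)\<^sup>d\<close>, in \<open>L\<^sub>2\<close> and so in \<open>L\<^sub>1\<close>, of a polynomial of degree \<open>d = O(log(1/\<epsilon>)/\<sigma>)\<close> whose
  coefficient vector has norm at most 1.

  Such a polynomial is found by full-batch subgradient descent on the empirical \<open>L\<^sub>1\<close> loss. Up to a
  common scale all iterates are integer vectors, and since the features are \<open>\<plusminus>1\<close>, addition and
  subtraction suffice; no linear program has to be solved. An iterate is turned into a classifier by
  a threshold: averaged over the thresholds in \<open>[-1, 1)\<close>, the error on an example is at most half
  its \<open>L\<^sub>1\<close> loss. The learner keeps the pair of iterate and threshold with the fewest errors on the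
  sample. As iterates have bounded integer entries, only finitely many hypotheses can occur, and
  Hoeffding's inequality with a union bound transfers the empirical bounds to the distribution.
\<close>

section \<open>Symbolic execution with step counts\<close>

text \<open>Without multiplication nothing can be rescaled cheaply, so the step size is not shrunk;
  the labels are blown up to \<open>K y\<close> with \<open>K = m N q\<close>, every step adds
  integer sign vectors, and thresholds become the \<open>2 K\<close> integers of
  \<open>[-K, K)\<close>. All sizes are governed by one number \<open>Z = N q r\<close>, where
  \<open>N\<close> counts the features, \<open>1/q\<close> is the accuracy and \<open>2^-r\<close>
  the failure probability. The sample size \<open>m = 64 Z^4\<close> has to solve a circular
  requirement: \<open>m\<close> enters the range of the iterates and thresholds, hence the number of
  hypotheses in the union bound. It enters that number polynomially, with an exponent linear in
  \<open>N\<close>, so the number stays below an exponential in \<open>Z^2\<close>, while the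
  exponent in Hoeffding's inequality is at least \<open>m / (2 Z^2)\<close>. For \<epsilon> < 3/4
  the allowance is \<open>2/q \<le> \<epsilon>\<close>. It is spent as \<open>1/(2q)\<close> each on
  the sampling error of the comparator, on optimisation and on generalisation, and
  \<open>1/(4q)\<close> each on truncating the Fourier expansion and on choosing a concept close to
  the infimum. The concept class occurs only in this analysis and never in the program.\<close>

text \<open>
  Memory layout. Negative addresses are registers, and address \<open>8 k + w\<close> is entry \<open>k\<close> of array \<open>w\<close>, so
  that arrays are disjoint and a pointer is advanced by adding 8. The arrays are: 1 the current
  iterate, 2 the best iterate so far, 3 the features of the point to be classified, 4 the features of
  the samples, row by row, 5 the labels, 7 the predictions of the current iterate.

  The registers that survive from one part of a program to another are \<open>-2\<close>: \<open>n\<close>; \<open>-3\<close>: the precision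
  \<open>q\<close>; \<open>-4\<close>: \<open>log\<^sub>2 q\<close>; \<open>-6\<close>: the degree \<open>d\<close>; \<open>-7\<close>: the confidence parameter \<open>r\<close>; \<open>-8\<close>: the number
  \<open>N\<close> of features; \<open>-9\<close>: the number \<open>T\<close> of iterations; \<open>-10\<close>: the sample size \<open>m\<close>; \<open>-11\<close>: the scale
  \<open>K\<close>; \<open>-43\<close>: the threshold being tried; \<open>-47\<close> and \<open>-48\<close>: the error count and the threshold of the
  best hypothesis so far. Register \<open>-1\<close> is scratch.
\<close>

definition arr :: "nat \<Rightarrow> nat \<Rightarrow> addr" where
  "arr w k = 8 * int k + int w"

lemma arr_eq_iff [simp]: "w < 8 \<Longrightarrow> w' < 8 \<Longrightarrow> arr w k = arr w' k' \<longleftrightarrow> w = w' \<and> k = k'"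
proof
  assume w: "w < 8" "w' < 8" and "arr w k = arr w' k'"
  then have e: "8 * k + w = 8 * k' + w'" by (simp add: arr_def)
  have "(8 * k + w) mod 8 = w" "(8 * k' + w') mod 8 = w'" using w by simp_all
  with e show "w = w' \<and> k = k'" by simp
qed simp

lemma arr_nonneg: "0 \<le> arr w k"
  by (simp_all add: arr_def)

lemma arr_neq_neg [simp]: "arr w k \<noteq> - numeral x" "arr w k \<noteq> - 1" "- numeral x \<noteq> arr w k" "- 1 \<noteq> arr w k"
  using arr_nonneg[of w k] by auto

lemma arr_neq_0 [simp]: "w \<noteq> 0 \<Longrightarrow> arr w k \<noteq> 0" "w \<noteq> 0 \<Longrightarrow> 0 \<noteq> arr w k"
  by (auto simp: arr_def)

lemma arr_Suc: "arr w k + 8 = arr w (Suc k)" "8 + arr w k = arr w (Suc k)"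
  by (simp_all add: arr_def)

context
  fixes n :: nat and v :: "param \<Rightarrow> real"
begin

text \<open>A weakest precondition for terminating runs. The postcondition also sees the step count,
  so correctness and time are proved in one pass. The rules for single instructions are
  equivalences, which lets the simplifier execute straight-line code.\<close>

definition run :: "com \<Rightarrow> memory \<Rightarrow> example list \<Rightarrow> (nat \<Rightarrow> memory \<Rightarrow> example list \<Rightarrow> bool) \<Rightarrow> bool" where
  "run c M I Q \<longleftrightarrow> (\<exists>t M' I'. exec n v c (M, I) t (M', I') \<and> Q t M' I')"

inductive_cases exec_SET: "exec n v (SET r k) s t s'"
inductive_cases exec_ADD: "exec n v (ADD r a b) s t s'"
inductive_cases exec_SUB: "exec n v (SUB r a b) s t s'"
inductive_cases exec_LOAD: "exec n v (LOAD r a) s t s'"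
inductive_cases exec_STORE: "exec n v (STORE a b) s t s'"
inductive_cases exec_TEST: "exec n v (TEST r p a b) s t s'"
inductive_cases exec_COORD: "exec n v (COORD r a) s t s'"
inductive_cases exec_LABEL: "exec n v (LABEL r) s t s'"
inductive_cases exec_NEXT: "exec n v NEXT s t s'"
inductive_cases exec_SEQ: "exec n v (c1 ;; c2) s t s'"
inductive_cases exec_IFPOS: "exec n v (IFPOS a c1 c2) s t s'"

lemma run_SET [simp]: "run (SET r k) M I Q \<longleftrightarrow> Q 1 (M(r := k)) I"
  unfolding run_def by (auto elim!: exec_SET intro: exec.Set[simplified])
lemma run_ADD [simp]: "run (ADD r a b) M I Q \<longleftrightarrow> Q 1 (M(r := M a + M b)) I"
  unfolding run_def by (auto elim!: exec_ADD intro: exec.Add[simplified])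
lemma run_SUB [simp]: "run (SUB r a b) M I Q \<longleftrightarrow> Q 1 (M(r := M a - M b)) I"
  unfolding run_def by (auto elim!: exec_SUB intro: exec.Sub[simplified])
lemma run_LOAD [simp]: "run (LOAD r a) M I Q \<longleftrightarrow> Q 1 (M(r := M (M a))) I"
  unfolding run_def by (auto elim!: exec_LOAD intro: exec.Load[simplified])
lemma run_STORE [simp]: "run (STORE a b) M I Q \<longleftrightarrow> Q 1 (M(M a := M b)) I"
  unfolding run_def by (auto elim!: exec_STORE intro: exec.Store[simplified])
lemma run_TEST [simp]: "run (TEST r p a b) M I Q \<longleftrightarrow>
    Q 1 (M(r := (if real_of_int (M a) \<le> v p * real_of_int (M b) then 1 else 0))) I"
  (is "_ \<longleftrightarrow> Q 1 ?M I")
proof -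
  have "exec n v (TEST r p a b) (M, I) t (M', I') \<longleftrightarrow> t = 1 \<and> M' = ?M \<and> I' = I" for t M' I'
    by (rule iffI, erule exec_TEST, simp) (elim conjE, hypsubst, rule exec.Test)
  then show ?thesis unfolding run_def by simp
qed
lemma run_COORD [simp]: "0 \<le> M a \<Longrightarrow> M a < int n \<Longrightarrow>
    run (COORD r a) M ((x, y) # I) Q \<longleftrightarrow> Q 1 (M(r := x (nat (M a)))) ((x, y) # I)"
  unfolding run_def by (auto elim!: exec_COORD intro: exec.Coord[simplified])
lemma run_LABEL [simp]: "run (LABEL r) M ((x, y) # I) Q \<longleftrightarrow> Q 1 (M(r := y)) ((x, y) # I)"
  unfolding run_def by (auto elim!: exec_LABEL intro: exec.Label[simplified])
lemma run_NEXT [simp]: "run NEXT M (e # I) Q \<longleftrightarrow> Q 1 M I"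
  unfolding run_def by (auto elim!: exec_NEXT intro: exec.Next[simplified])

lemma run_SEQ [simp]:
  "run (c1 ;; c2) M I Q \<longleftrightarrow> run c1 M I (\<lambda>t1 M1 I1. run c2 M1 I1 (\<lambda>t2. Q (t1 + t2)))"
proof
  assume "run (c1 ;; c2) M I Q"
  then show "run c1 M I (\<lambda>t1 M1 I1. run c2 M1 I1 (\<lambda>t2. Q (t1 + t2)))"
    unfolding run_def by (elim exE conjE exec_SEQ) (metis prod.collapse)
next
  assume "run c1 M I (\<lambda>t1 M1 I1. run c2 M1 I1 (\<lambda>t2. Q (t1 + t2)))"
  then show "run (c1 ;; c2) M I Q"
    unfolding run_def by (meson exec.Seq)
qed

lemma run_IFPOS [simp]:
  "run (IFPOS a c1 c2) M I Q \<longleftrightarrow>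
     (if M a > 0 then run c1 M I (\<lambda>t. Q (t + 1)) else run c2 M I (\<lambda>t. Q (t + 1)))"
  unfolding run_def
  by (auto elim!: exec_IFPOS intro: exec.IfTrue[where t = t for t, simplified] exec.IfFalse[where t = t for t, simplified])

lemma run_mono: "run c M I Q \<Longrightarrow> (\<And>t M' I'. Q t M' I' \<Longrightarrow> Q' t M' I') \<Longrightarrow> run c M I Q'"
  unfolding run_def by blast

lemma run_WHILE_false: "\<not> M a > 0 \<Longrightarrow> Q 1 M I \<Longrightarrow> run (WHILEPOS a c) M I Q"
  unfolding run_def using exec.WhileFalse by blast

lemma run_WHILE_true:
  assumes "M a > 0" "run c M I (\<lambda>t1 M1 I1. run (WHILEPOS a c) M1 I1 (\<lambda>t2. Q (t1 + t2 + 1)))"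
  shows "run (WHILEPOS a c) M I Q"
  using assms unfolding run_def by (meson exec.WhileTrue)

lemma run_WHILE:
  assumes step: "\<And>k M I. k < L \<Longrightarrow> Inv k M I \<Longrightarrow>
       M a > 0 \<and> run c M I (\<lambda>t M' I'. t \<le> T \<and> Inv (Suc k) M' I')"
    and stop: "\<And>M I. Inv L M I \<Longrightarrow> \<not> M a > 0"
    and Q: "\<And>t M I. t \<le> (T + 1) * L + 1 \<Longrightarrow> Inv L M I \<Longrightarrow> Q t M I"
    and start: "Inv 0 M I"
  shows "run (WHILEPOS a c) M I Q"
proof -
  \<comment> \<open>The induction is on the number \<open>j\<close> of rounds still to come. Each
    round costs \<open>T\<close> plus one guard; the last \<open>+ 1\<close> is the guard that ends
    the loop.\<close>
  have "run (WHILEPOS a c) M I (\<lambda>t M' I'. t \<le> (T + 1) * j + 1 \<and> Inv L M' I')"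
    if "Inv (L - j) M I" "j \<le> L" for j M I
    using that
  proof (induction j arbitrary: M I)
    case 0
    then show ?case using stop by (intro run_WHILE_false) auto
  next
    case (Suc j)
    note st = step[of "L - Suc j" M I]
    have pos: "M a > 0" and b: "run c M I (\<lambda>t M' I'. t \<le> T \<and> Inv (Suc (L - Suc j)) M' I')"
      using st Suc.prems by auto
    have e: "Suc (L - Suc j) = L - j" using Suc.prems by simp
    show ?case
    proof (rule run_WHILE_true, rule pos, rule run_mono[OF b], elim conjE)
      fix t M' I' assume t: "t \<le> T" and i: "Inv (Suc (L - Suc j)) M' I'"
      have "run (WHILEPOS a c) M' I' (\<lambda>t M' I'. t \<le> (T + 1) * j + 1 \<and> Inv L M' I')"
        using Suc.IH[of M' I'] i e Suc.prems by simp
      then show "run (WHILEPOS a c) M' I'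
          (\<lambda>t2 M' I'. t + t2 + 1 \<le> (T + 1) * Suc j + 1 \<and> Inv L M' I')"
        by (rule run_mono) (use t in auto)
    qed
  qed
  then have "run (WHILEPOS a c) M I (\<lambda>t M' I'. t \<le> (T + 1) * L + 1 \<and> Inv L M' I')"
    using start by simp
  then show ?thesis by (rule run_mono) (use Q in blast)
qed

end

section \<open>Loops with a counter\<close>

definition COPY :: "addr \<Rightarrow> addr \<Rightarrow> com" where
  "COPY r a = (SET (-1) 0 ;; ADD r a (-1))"
definition INC :: "addr \<Rightarrow> int \<Rightarrow> com" where
  "INC r k = (SET (-1) k ;; ADD r r (-1))"
definition REPEAT :: "addr \<Rightarrow> addr \<Rightarrow> com \<Rightarrow> com" where
  "REPEAT cnt src body = (COPY cnt src ;; WHILEPOS cnt (body ;; INC cnt (-1)))"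

lemma run_COPY [simp]: "a \<noteq> -1 \<Longrightarrow> run n v (COPY r a) M I Q \<longleftrightarrow> Q 2 (M(-1 := 0, r := M a)) I"
  by (simp add: COPY_def numeral_2_eq_2)
lemma run_INC [simp]: "r \<noteq> -1 \<Longrightarrow> run n v (INC r k) M I Q \<longleftrightarrow> Q 2 (M(-1 := k, r := M r + k)) I"
  by (simp add: INC_def numeral_2_eq_2)

text \<open>The invariant is evaluated after the counter update, which also overwrites the scratch
  register; the body itself only has to preserve the counter. In the time bound, 3 per round pays
  for \<open>INC\<close> and the guard, and the final 3 for \<open>COPY\<close> and the last
  guard.\<close>

lemma run_REPEAT:
  assumes src: "M src = int L" and ne: "src \<noteq> -1" "cnt \<noteq> -1"
    and start: "Inv 0 (M(-1 := 0, cnt := int L)) I"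
    and step: "\<And>k M I. k < L \<Longrightarrow> Inv k M I \<Longrightarrow> M cnt = int (L - k) \<Longrightarrow>
       run n v body M I (\<lambda>t M' I'. t \<le> T \<and> M' cnt = M cnt \<and> Inv (Suc k) (M'(-1 := -1, cnt := M cnt - 1)) I')"
    and Q: "\<And>t M I. t \<le> (T + 3) * L + 3 \<Longrightarrow> Inv L M I \<Longrightarrow> Q t M I"
  shows "run n v (REPEAT cnt src body) M I Q"
proof -
  let ?J = "\<lambda>k M I. Inv k M I \<and> M cnt = int (L - k)"
  have "run n v (WHILEPOS cnt (body ;; INC cnt (-1))) (M(-1 := 0, cnt := int L)) I (\<lambda>t. Q (2 + t))"
  proof (rule run_WHILE[where Inv = ?J and L = L and T = "T + 2"])
    fix k M I assume k: "k < L" "Inv k M I \<and> M cnt = int (L - k)"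
    have *: "run n v body M I (\<lambda>t M' I'. t \<le> T \<and> M' cnt = M cnt \<and> Inv (Suc k) (M'(-1 := -1, cnt := M cnt - 1)) I')"
      using k by (intro step) auto
    show "0 < M cnt \<and> run n v (body ;; INC cnt (-1)) M I
            (\<lambda>t M' I'. t \<le> T + 2 \<and> ?J (Suc k) M' I')"
      using k ne by (auto intro!: run_mono[OF *])
  next
    fix t M I assume "t \<le> (T + 2 + 1) * L + 1" "Inv L M I \<and> M cnt = int (L - L)"
    then show "Q (2 + t) M I" by (intro Q) (auto simp: algebra_simps)
  qed (use start ne in auto)
  then show ?thesis using src ne by (simp add: REPEAT_def)
qed

section \<open>Computing the features\<close>

definition fr :: "addr set \<Rightarrow> memory \<Rightarrow> memory \<Rightarrow> bool" where
  "fr X M M' \<longleftrightarrow> (\<forall>a. a \<notin> X \<longrightarrow> M' a = M a)"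

lemma frD: "fr X M M' \<Longrightarrow> a \<notin> X \<Longrightarrow> M' a = M a"
  by (simp add: fr_def)

lemma fr_refl [simp]: "fr X M M"
  by (simp add: fr_def)

lemma frI: "fr X M M' \<Longrightarrow> r \<in> X \<Longrightarrow> fr X M (M'(r := z))"
  by (auto simp: fr_def)

lemma fr_trans: "fr X M M' \<Longrightarrow> fr Y M' M'' \<Longrightarrow> X \<subseteq> Z \<Longrightarrow> Y \<subseteq> Z \<Longrightarrow> fr Z M M''"
  unfolding fr_def by (metis subsetD)

definition DOT :: com where
  "DOT = (SET (-37) 0 ;; REPEAT (-33) (-8)
     (LOAD (-29) (-38) ;; LOAD (-40) (-39) ;;
      IFPOS (-29) (ADD (-37) (-37) (-40)) (SUB (-37) (-37) (-40)) ;;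
      INC (-38) 8 ;; INC (-39) 8))"

text \<open>The sign of a feature selects addition or subtraction. The feature pointer is left just
  behind the row, so that successive calls walk through the sample matrix without computing row
  addresses.\<close>

lemma run_DOT:
  assumes N: "M (-8) = int N" and pf: "M (-38) = arr af b" and pv: "M (-39) = arr av 0"
    and F: "\<And>k. k < N \<Longrightarrow> M (arr af (b + k)) = F k" and V: "\<And>k. k < N \<Longrightarrow> M (arr av k) = V k"
    and F1: "\<And>k. k < N \<Longrightarrow> F k \<in> {1, -1}"
    and Q: "\<And>t M'. t \<le> 12 * N + 4 \<Longrightarrow> M' (-37) = (\<Sum>k<N. V k * F k) \<Longrightarrow> M' (-38) = arr af (b + N) \<Longrightarrow>
       fr {-1,-29,-33,-37,-38,-39,-40} M M' \<Longrightarrow> Q t M' I"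
  shows "run n v DOT M I Q"
  unfolding DOT_def run_SEQ run_SET
proof (rule run_REPEAT[where L = N and T = 9 and Inv = "\<lambda>j M' I'. I' = I \<and>
    M' (-37) = (\<Sum>k<j. V k * F k) \<and> M' (-38) = arr af (b + j) \<and> M' (-39) = arr av j \<and>
    fr {-1,-29,-33,-37,-38,-39,-40} M M'"], goal_cases)
  case (5 k M1 I1)
  then have I: "I1 = I" and 1: "M1 (-37) = (\<Sum>k<k. V k * F k)" "M1 (-38) = arr af (b + k)" "M1 (-39) = arr av k"
    and f: "fr {-1,-29,-33,-37,-38,-39,-40} M M1" by auto
  have 2: "M1 (arr af (b + k)) = F k" "M1 (arr av k) = V k"
    using frD[OF f] F V \<open>k < N\<close> by simp_all
  show ?case using 1 2 F1[OF \<open>k < N\<close>] f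
    by (auto simp: I arr_Suc intro!: frI)
next
  case (6 t M' I')
  then show ?case by (auto intro!: Q)
qed (use N pf pv in \<open>auto simp: fr_def\<close>)

definition FILL :: com where
  "FILL = REPEAT (-33) (-25) (LOAD (-29) (-28) ;;
     IFPOS (-27) (SET (-1) 0) (SET (-1) 0 ;; SUB (-29) (-1) (-29)) ;;
     STORE (-22) (-29) ;; INC (-22) 8 ;; INC (-28) 8 ;; INC (-24) 1)"

text \<open>One block of a tensor product: the first \<open>l\<close> entries are appended again,
  multiplied by the sign \<open>x\<close>. The hypothesis \<open>l \<le> c\<close> keeps the source
  block in front of every cell that is written.\<close>

lemma run_FILL:
  assumes l: "M (-25) = int l" and rp: "M (-28) = arr w b" and wp: "M (-22) = arr w (b + c)"
    and L: "M (-24) = int c" and lc: "l \<le> c" and x: "M (-27) = x" "x \<in> {1, -1}"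
    and F: "\<And>k. k < l \<Longrightarrow> M (arr w (b + k)) = F k" and w: "w < 8"
    and Q: "\<And>t M'. t \<le> 14 * l + 3 \<Longrightarrow> M' (-22) = arr w (b + (c + l)) \<Longrightarrow> M' (-24) = int (c + l) \<Longrightarrow>
       (\<And>k. k < l \<Longrightarrow> M' (arr w (b + (c + k))) = x * F k) \<Longrightarrow>
       fr ({-1,-22,-24,-28,-29,-33} \<union> arr w ` {b + c..}) M M' \<Longrightarrow> Q t M' I"
  shows "run n v FILL M I Q"
  unfolding FILL_def
proof (rule run_REPEAT[where L = l and T = 11 and Inv = "\<lambda>j M' I'. I' = I \<and>
    M' (-22) = arr w (b + (c + j)) \<and> M' (-24) = int (c + j) \<and> M' (-28) = arr w (b + j) \<and>
    (\<forall>k<j. M' (arr w (b + (c + k))) = x * F k) \<and>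
    fr ({-1,-22,-24,-28,-29,-33} \<union> arr w ` {b + c..}) M M'"], goal_cases)
  case (5 k M1 I1)
  then have I: "I1 = I" and 1: "M1 (-22) = arr w (b + (c + k))" "M1 (-24) = int (c + k)" "M1 (-28) = arr w (b + k)"
    and 2: "\<And>j. j < k \<Longrightarrow> M1 (arr w (b + (c + j))) = x * F j"
    and f: "fr ({-1,-22,-24,-28,-29,-33} \<union> arr w ` {b + c..}) M M1" by auto
  have 3: "M1 (arr w (b + k)) = F k" "M1 (-27) = x"
    using frD[OF f] F \<open>k < l\<close> lc x w by (auto simp: image_iff)
  show ?case using 1 2 3 x(2) f w
    by (auto simp: I arr_Suc less_Suc_eq intro!: frI)
next
  case (6 t M' I')
  then show ?case by (auto intro!: Q)
qed (use assms in \<open>auto simp: fr_def\<close>)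

text \<open>
  Feature \<open>k\<close> of degree \<open>d\<close> is the product of the coordinates named by the \<open>d\<close> digits of \<open>k\<close> in base
  \<open>n + 1\<close>, where digit 0 stands for the constant 1 and digit \<open>j + 1\<close> for coordinate \<open>j\<close>. Every
  multilinear monomial of degree at most \<open>d\<close> occurs; repetitions do no harm.
\<close>

fun homog :: "point \<Rightarrow> nat \<Rightarrow> int" where
  "homog x 0 = 1"
| "homog x (Suc j) = x j"

fun feat :: "nat \<Rightarrow> nat \<Rightarrow> point \<Rightarrow> nat \<Rightarrow> int" where
  "feat n 0 x k = 1"
| "feat n (Suc d) x k = homog x (k div (n + 1) ^ d) * feat n d x (k mod (n + 1) ^ d)"

definition ROUND :: com where
  "ROUND = (COPY (-25) (-24) ;; SET (-26) 0 ;; REPEAT (-32) (-2)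
     (COORD (-27) (-26) ;; COPY (-28) (-23) ;; FILL ;; INC (-26) 1))"

text \<open>A table of \<open>l\<close> features is followed by one signed copy for each coordinate,
  which prepends a digit in base \<open>n + 1\<close> to the index; the original block is the copy
  for digit 0. Register \<open>-25\<close> freezes the block length while \<open>-24\<close>
  grows.\<close>

lemma run_ROUND:
  assumes n: "M (-2) = int n" and L: "M (-24) = int l" and bp: "M (-23) = arr w b" and wp: "M (-22) = arr w (b + l)"
    and x: "\<And>j. j < n \<Longrightarrow> x j \<in> {1, -1}" and l: "l > 0"
    and F: "\<And>k. k < l \<Longrightarrow> M (arr w (b + k)) = F k" and w: "w < 8" "w > 0"
    and Q: "\<And>t M'. t \<le> (14 * l + 11) * n + 6 \<Longrightarrow> M' (-22) = arr w (b + (n + 1) * l) \<Longrightarrow> M' (-24) = int ((n + 1) * l) \<Longrightarrow>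
       (\<And>k. k < (n + 1) * l \<Longrightarrow> M' (arr w (b + k)) = homog x (k div l) * F (k mod l)) \<Longrightarrow>
       fr ({-1,-22,-24,-25,-26,-27,-28,-29,-32,-33} \<union> arr w ` {b + l..}) M M' \<Longrightarrow> Q t M' ((x, y) # I)"
  shows "run n v ROUND M ((x, y) # I) Q"
proof -
  let ?X = "{-1,-22,-24,-25,-26,-27,-28,-29,-32,-33} \<union> arr w ` {b + l..}"
  have "run n v (REPEAT (-32) (-2) (COORD (-27) (-26) ;; COPY (-28) (-23) ;; FILL ;; INC (-26) 1))
     (M(-1 := 0, -25 := int l, -26 := 0)) ((x, y) # I) (\<lambda>t. Q (3 + t))"
  proof (rule run_REPEAT[where L = n and T = "14 * l + 8" and Inv = "\<lambda>j M' I'. I' = (x, y) # I \<and>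
    M' (-25) = int l \<and> M' (-26) = int j \<and> M' (-22) = arr w (b + (j + 1) * l) \<and> M' (-24) = int ((j + 1) * l) \<and>
    (\<forall>k<(j + 1) * l. M' (arr w (b + k)) = homog x (k div l) * F (k mod l)) \<and> fr ?X M M'"], goal_cases)
    case (5 j M1 I1)
    then have I: "I1 = (x, y) # I" and 1: "M1 (-25) = int l" "M1 (-26) = int j"
      "M1 (-22) = arr w (b + (j + 1) * l)" "M1 (-24) = int ((j + 1) * l)"
      and 2: "\<And>k. k < (j + 1) * l \<Longrightarrow> M1 (arr w (b + k)) = homog x (k div l) * F (k mod l)"
      and f: "fr ?X M M1" by auto
    have 3: "M1 (arr w (b + k)) = F k" if "k < l" for k
      using 2[of k] that by simp
    have 4: "M1 (-23) = arr w b" using frD[OF f] bp by (auto simp: image_iff)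
    have 5: "0 \<le> M1 (-26)" "M1 (-26) < int n" "nat (M1 (-26)) = j" "(-23 :: int) \<noteq> -1"
      using 1 \<open>j < n\<close> by simp_all
    show ?case unfolding run_SEQ I run_COORD[where M = M1 and a = "-26", OF 5(1,2)] run_COPY[OF 5(4)]  5(3)
      proof (rule run_FILL[where l = l and b = b and c = "(j + 1) * l" and x = "x j" and F = F and w = w], goal_cases)
        case (10 t M2)
        note f2 = frD[OF 10(5)]
        have a: "M2 (-32) = M1 (-32)" "M2 (-25) = int l" "M2 (-26) = int j" 
          using f2 1 by (auto simp: image_iff)
        have b: "M2 (arr w (b + k)) = homog x (k div l) * F (k mod l)" if k: "k < (Suc j + 1) * l" for k
        proof (cases "k < (j + 1) * l")
          case True
          then show ?thesis using 2[OF True] f2[of "arr w (b + k)"] w by (auto simp: image_iff)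
        next
          case False
          \<comment> \<open>\<open>i\<close> is the offset inside the block just written. Its
            leading digit is \<open>Suc j\<close>, because digit 0 is reserved for the
            constant.\<close>
          define i where "i = k - (j + 1) * l"
          have i: "k = (j + 1) * l + i" "i < l" using False k by (auto simp: i_def)
          have "k div l = Suc j"
            using i by (auto intro: div_nat_eqI)
          moreover have "k mod l = i"
            unfolding i(1) mod_mult_self3 using i(2) by simp
          ultimately
          show ?thesis using 10(4)[OF i(2)] i by simp
        qed
        have c: "fr ?X M (M2(- 1 := z1, -26 := z3, - 32 := z2, -1 := z4))" for z1 z2 z3 z4
        proof -
          have "fr ?X M (M1(- 27 := x j, - 1 := 0, - 28 := M1 (- 23)))"
            using f by (intro frI) auto
          then have "fr ?X M M2"
            by (rule fr_trans[OF _ 10(5)[unfolded 1, simplified]]) auto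
          then show ?thesis by (intro frI) auto
        qed
        show ?case using a b c 10(1,2,3) w by (simp add: algebra_simps fun_upd_twist)
    qed (use 1 3 4 x[OF \<open>j < n\<close>] w l in auto)
  next
    case (6 t M' I')
    then have "Q (3 + t) M' ((x, y) # I)"
      by (intro Q) (auto simp: algebra_simps)
    then show ?case using 6 by simp
  qed (use assms in \<open>auto intro!: frI\<close>)
  then show ?thesis using L by (simp add: ROUND_def numeral_3_eq_3)
qed

definition FEAT :: com where
  "FEAT = (COPY (-23) (-22) ;; SET (-30) 1 ;; STORE (-22) (-30) ;; INC (-22) 8 ;; SET (-24) 1 ;;
     REPEAT (-31) (-6) ROUND)"

lemma feat_sign:
  assumes "\<And>j. j < n \<Longrightarrow> x j \<in> {1, -1}" and "k < (n + 1) ^ d"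
  shows "feat n d x k \<in> {1, -1}"
  using assms(2)
proof (induction d arbitrary: k)
  case (Suc d)
  have "k div (n + 1) ^ d < n + 1"
    using Suc.prems by (simp add: less_mult_imp_div_less)
  then have "homog x (k div (n + 1) ^ d) \<in> {1, -1}"
    using assms(1) by (cases "k div (n + 1) ^ d") auto
  moreover have "feat n d x (k mod (n + 1) ^ d) \<in> {1, -1}"
    by (rule Suc.IH) simp
  ultimately show ?case by auto
qed simp

abbreviation "feat_regs \<equiv> {-1,-22,-23,-24,-25,-26,-27,-28,-29,-30,-31,-32,-33}"

text \<open>The table starts as the single constant feature, and each of the \<open>d\<close> rounds
  multiplies its length by \<open>n + 1\<close>. Every round is charged at the final length.\<close>

lemma run_FEAT:
  assumes n: "M (-2) = int n" and d: "M (-6) = int d" and wp: "M (-22) = arr w b"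
    and x: "\<And>j. j < n \<Longrightarrow> x j \<in> {1, -1}" and w: "w < 8" "w > 0"
    and Q: "\<And>t M'. t \<le> (14 * (n + 1) ^ d * n + 11 * n + 9) * d + 10 \<Longrightarrow> M' (-22) = arr w (b + (n + 1) ^ d) \<Longrightarrow>
       (\<And>k. k < (n + 1) ^ d \<Longrightarrow> M' (arr w (b + k)) = feat n d x k) \<Longrightarrow>
       fr (feat_regs \<union> arr w ` {b..}) M M' \<Longrightarrow> Q t M' ((x, y) # I)"
  shows "run n v FEAT M ((x, y) # I) Q"
proof -
  let ?X = "feat_regs \<union> arr w ` {b..}"
  have ne: "(-22 :: int) \<noteq> -1" by simp
  show ?thesis
    unfolding FEAT_def run_SEQ run_COPY[OF ne] run_INC[OF ne] run_SET run_STORE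
  proof (rule run_REPEAT[where L = d and T = "14 * (n + 1) ^ d * n + 11 * n + 6" and Inv = "\<lambda>i M' I'. I' = (x, y) # I \<and>
      M' (-22) = arr w (b + (n + 1) ^ i) \<and> M' (-23) = arr w b \<and> M' (-24) = int ((n + 1) ^ i) \<and>
      (\<forall>k<(n + 1) ^ i. M' (arr w (b + k)) = feat n i x k) \<and> fr ?X M M'"], goal_cases)
    case (5 i M1 I1)
    then have I: "I1 = (x, y) # I" and 1: "M1 (-22) = arr w (b + (n + 1) ^ i)" "M1 (-23) = arr w b"
        "M1 (-24) = int ((n + 1) ^ i)"
      and 2: "\<And>k. k < (n + 1) ^ i \<Longrightarrow> M1 (arr w (b + k)) = feat n i x k"
      and f: "fr ?X M M1" by auto
    have n1: "M1 (-2) = int n" using frD[OF f] n by (auto simp: image_iff)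
    have le: "(n + 1) ^ i \<le> (n + 1) ^ d" using \<open>i < d\<close> by (intro power_increasing) auto
    show ?case unfolding I
    proof (rule run_ROUND[where F = "feat n i x" and l = "(n + 1) ^ i" and b = b and w = w and x = x], goal_cases)
      case (10 t M2)
      have "fr ?X M M2" by (rule fr_trans[OF f 10(5)]) auto
      moreover have "M2 (-23) = M1 (-23)" "M2 (-31) = M1 (-31)"
        using frD[OF 10(5)] w by (auto simp: image_iff)
      ultimately have "M2 (-31) = M1 (-31) \<and> (x, y) # I = (x, y) # I \<and>
          (M2(-1 := -1, -31 := M1 (-31) - 1)) (-22) = arr w (b + (n + 1) ^ Suc i) \<and>
          (M2(-1 := -1, -31 := M1 (-31) - 1)) (-23) = arr w b \<and>
          (M2(-1 := -1, -31 := M1 (-31) - 1)) (-24) = int ((n + 1) ^ Suc i) \<and>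
          (\<forall>k<(n + 1) ^ Suc i. (M2(-1 := -1, -31 := M1 (-31) - 1)) (arr w (b + k)) = feat n (Suc i) x k) \<and>
          fr ?X M (M2(-1 := -1, -31 := M1 (-31) - 1))"
        using 10(2,3,4) w 1 by (auto simp: algebra_simps intro!: frI)
      moreover have "(14 * (n + 1) ^ i + 11) * n + 6 \<le> (14 * (n + 1) ^ d + 11) * n + 6"
        using le by (intro add_right_mono mult_right_mono) auto
      with 10(1) have "t \<le> (14 * (n + 1) ^ d + 11) * n + 6" by (rule order_trans)
      then have "t \<le> 14 * (n + 1) ^ d * n + 11 * n + 6"
        by (simp add: algebra_simps)
      ultimately show ?case by blast
    qed (use 1 2 n1 x w in auto)
  next
    case (6 t M' I')
    then show ?case by (auto intro!: Q simp: algebra_simps)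
  qed (use assms in \<open>auto simp: arr_Suc intro!: frI\<close>)
qed

definition READ :: com where
  "READ = (SET (-22) 4 ;; SET (-34) 5 ;;
     REPEAT (-36) (-10) (LABEL (-35) ;; STORE (-34) (-35) ;; INC (-34) 8 ;; FEAT ;; NEXT))"

lemma run_READ:
  assumes n: "M (-2) = int n" and d: "M (-6) = int d" and m: "M (-10) = int m"
    and S: "length S = m" "\<And>i j. i < m \<Longrightarrow> j < n \<Longrightarrow> fst (S ! i) j \<in> {1, -1}" and N: "N = (n + 1) ^ d"
    and Q: "\<And>t M'. t \<le> ((14 * N * n + 11 * n + 9) * d + 18) * m + 5 \<Longrightarrow>
       (\<And>i. i < m \<Longrightarrow> M' (arr 5 i) = snd (S ! i)) \<Longrightarrow>
       (\<And>i k. i < m \<Longrightarrow> k < N \<Longrightarrow> M' (arr 4 (i * N + k)) = feat n d (fst (S ! i)) k) \<Longrightarrow>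
       fr (feat_regs \<union> {-34,-35,-36} \<union> range (arr 4) \<union> range (arr 5)) M M' \<Longrightarrow> Q t M' []"
  shows "run n v READ M S Q"
proof -
  let ?X = "feat_regs \<union> {-34,-35,-36} \<union> range (arr 4) \<union> range (arr 5)"
  have ne: "(-34 :: int) \<noteq> -1" by simp
  show ?thesis unfolding READ_def run_SEQ run_SET
  proof (rule run_REPEAT[where L = m and T = "(14 * N * n + 11 * n + 9) * d + 15" and Inv = "\<lambda>i M' I'. I' = drop i S \<and>
      M' (-22) = arr 4 (i * N) \<and> M' (-34) = arr 5 i \<and>
      (\<forall>j<i. M' (arr 5 j) = snd (S ! j)) \<and>
      (\<forall>j<i. \<forall>k<N. M' (arr 4 (j * N + k)) = feat n d (fst (S ! j)) k) \<and> fr ?X M M'"], goal_cases)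
    case (5 i M1 I1)
    then have I: "I1 = drop i S" and 1: "M1 (-22) = arr 4 (i * N)" "M1 (-34) = arr 5 i"
      and 2: "\<And>j. j < i \<Longrightarrow> M1 (arr 5 j) = snd (S ! j)"
        "\<And>j k. j < i \<Longrightarrow> k < N \<Longrightarrow> M1 (arr 4 (j * N + k)) = feat n d (fst (S ! j)) k"
      and f: "fr ?X M M1" by auto
    obtain x y where xy: "S ! i = (x, y)" by fastforce
    have I': "I1 = (x, y) # drop (Suc i) S"
      using S(1) \<open>i < m\<close> xy I by (metis Cons_nth_drop_Suc)
    have n1: "M1 (-2) = int n" "M1 (-6) = int d" using frD[OF f] n d by (auto simp: image_iff)
    show ?case unfolding run_SEQ I' run_LABEL run_STORE run_INC[OF ne]
    proof (rule run_FEAT[where w = 4 and b = "i * N" and d = d and x = x], goal_cases)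
      case (7 t M2)
      note g = frD[OF 7(4)]
      have a: "M2 (-34) = arr 5 (Suc i)" "M2 (-36) = M1 (-36)" "M2 (arr 5 i) = y"
        "\<And>j. j < i \<Longrightarrow> M2 (arr 5 j) = snd (S ! j)"
        using g 1 2 by (auto simp: image_iff arr_Suc)
      have b: "M2 (arr 4 (j * N + k)) = feat n d (fst (S ! j)) k" if "j < i" "k < N" for j k
      proof -
        \<comment> \<open>The earlier rows end at or before index \<open>i * N\<close>, where
          \<open>FEAT\<close> started to write.\<close>
        have "j * N + k < (j + 1) * N" using that by simp
        also have "\<dots> \<le> i * N" using that by (intro mult_right_mono) auto
        finally show ?thesis using g[of "arr 4 (j * N + k)"] 2(2)[OF that] 1 by (auto simp: image_iff)
      qed
      have "fr ?X M (M1(- 35 := y, arr 5 i := y, - 1 := 8, - 34 := arr 5 i + 8))"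
        using f by (intro frI) auto
      moreover have "fr (feat_regs \<union> arr 4 ` {i * N..}) (M1(- 35 := y, arr 5 i := y, - 1 := 8, - 34 := arr 5 i + 8)) M2"
        using 7(4) 1 by simp
      ultimately have c: "fr ?X M M2"
        by (rule fr_trans) auto
      show ?case using 7(1,2,3) a b c xy
        by (auto simp: less_Suc_eq N algebra_simps intro!: frI)
    qed (use 1 2 n1 S(2)[OF \<open>i < m\<close>] xy in auto)
  next
    case (6 t M' I')
    then show ?case using S(1) by (auto intro!: Q simp: algebra_simps)
  qed (use assms in \<open>auto simp: arr_def intro!: frI\<close>)
qed

section \<open>Training and evaluation\<close>

lemma arr_0: "arr w 0 = int w"
  by (simp add: arr_def)

text \<open>Used both for classification and for the subgradient. The value at 0 agrees with the
  branch taken by \<open>IFPOS\<close>, and -1 is also a valid subgradient of the absolute value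
  there.\<close>

definition sg :: "int \<Rightarrow> int" where
  "sg z = (if z > 0 then 1 else -1)"

definition dot :: "nat \<Rightarrow> (nat \<Rightarrow> int) \<Rightarrow> (nat \<Rightarrow> int) \<Rightarrow> int" where
  "dot N V f = (\<Sum>k<N. V k * f k)"

definition nerr :: "nat \<Rightarrow> nat \<Rightarrow> (nat \<Rightarrow> nat \<Rightarrow> int) \<Rightarrow> (nat \<Rightarrow> int) \<Rightarrow> (nat \<Rightarrow> int) \<Rightarrow> int \<Rightarrow> nat" where
  "nerr m N F y V \<theta> = card {i. i < m \<and> sg (dot N V (F i) - \<theta>) \<noteq> y i}"

text \<open>Subgradient descent with step length 1 on the sum of
  \<open>\<bar>K y i - dot N V (F i)\<bar>\<close>, started at 0: the added vector is the negative
  of a subgradient.\<close>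

fun descent :: "nat \<Rightarrow> nat \<Rightarrow> int \<Rightarrow> (nat \<Rightarrow> nat \<Rightarrow> int) \<Rightarrow> (nat \<Rightarrow> int) \<Rightarrow> nat \<Rightarrow> nat \<Rightarrow> int" where
  "descent m N K F y 0 k = 0"
| "descent m N K F y (Suc t) k = descent m N K F y t k +
     (\<Sum>i<m. sg (K * y i - dot N (descent m N K F y t) (F i)) * F i k)"

definition data :: "nat \<Rightarrow> nat \<Rightarrow> (nat \<Rightarrow> nat \<Rightarrow> int) \<Rightarrow> (nat \<Rightarrow> int) \<Rightarrow> memory \<Rightarrow> bool" where
  "data m N F y M \<longleftrightarrow> M (-8) = int N \<and> M (-10) = int m \<and>
     (\<forall>i<m. M (arr 5 i) = y i) \<and> (\<forall>i<m. \<forall>k<N. M (arr 4 (i * N + k)) = F i k)"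

lemma data_fr:
  assumes "data m N F y M" "fr X M M'" "-8 \<notin> X" "-10 \<notin> X" "range (arr 4) \<inter> X = {}" "range (arr 5) \<inter> X = {}"
  shows "data m N F y M'"
  using assms(1) frD[OF assms(2)] assms(3-) unfolding data_def by (simp add: disjoint_iff)

text \<open>The predictions are stored because all \<open>2 K\<close> thresholds reuse them, and
  because the full-batch update needs the residuals of the old iterate while array 1 is being
  overwritten.\<close>

definition PRED :: com where
  "PRED = (SET (-38) 4 ;; SET (-42) 7 ;; REPEAT (-36) (-10) (SET (-39) 1 ;; DOT ;; STORE (-42) (-37) ;; INC (-42) 8))"

lemma run_PRED:
  assumes D: "data m N F y M" and F1: "\<And>i k. i < m \<Longrightarrow> k < N \<Longrightarrow> F i k \<in> {1, -1}"
    and V: "\<And>k. k < N \<Longrightarrow> M (arr 1 k) = V k"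
    and Q: "\<And>t M'. t \<le> (12 * N + 11) * m + 5 \<Longrightarrow> (\<And>i. i < m \<Longrightarrow> M' (arr 7 i) = dot N V (F i)) \<Longrightarrow>
       fr ({-1,-29,-33,-36,-37,-38,-39,-40,-42} \<union> range (arr 7)) M M' \<Longrightarrow> Q t M' I"
  shows "run n v PRED M I Q"
proof -
  let ?X = "{-1,-29,-33,-36,-37,-38,-39,-40,-42} \<union> range (arr 7)"
  show ?thesis unfolding PRED_def run_SEQ run_SET
  proof (rule run_REPEAT[where L = m and T = "12 * N + 8" and Inv = "\<lambda>i M' I'. I' = I \<and>
      M' (-38) = arr 4 (i * N) \<and> M' (-42) = arr 7 i \<and>
      (\<forall>j<i. M' (arr 7 j) = dot N V (F j)) \<and> fr ?X M M'"], goal_cases)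
    case (5 i M1 I1)
    then have I: "I1 = I" and 1: "M1 (-38) = arr 4 (i * N)" "M1 (-42) = arr 7 i"
      and 2: "\<And>j. j < i \<Longrightarrow> M1 (arr 7 j) = dot N V (F j)"
      and f: "fr ?X M M1" by auto
    have D1: "data m N F y M1" by (rule data_fr[OF D f]) auto
    have V1: "M1 (arr 1 k) = V k" if "k < N" for k
      using frD[OF f, of "arr 1 k"] V[OF that] by (auto simp: image_iff)
    show ?case unfolding run_SEQ I run_SET
    proof (rule run_DOT[where N = N and af = 4 and b = "i * N" and av = 1 and F = "F i" and V = V], goal_cases)
      case (7 t M2)
      have "M2 (-42) = arr 7 i" "M2 (-36) = M1 (-36)" "\<And>j. j < i \<Longrightarrow> M2 (arr 7 j) = dot N V (F j)"
        using frD[OF 7(4)] 1 2 by auto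
      moreover have "fr ?X M (M1(-39 := 1))" using f by (intro frI) auto
      then have "fr ?X M M2" by (rule fr_trans[OF _ 7(4)]) auto
      ultimately show ?case using 7(1,2,3)
        by (auto simp: arr_Suc less_Suc_eq dot_def algebra_simps intro!: frI)
    qed (use D1 1 V1 F1 \<open>i < m\<close> in \<open>auto simp: data_def arr_0\<close>)
  next
    case (6 t M' I')
    then show ?case by (auto intro!: Q simp: algebra_simps)
  qed (use D in \<open>auto simp: data_def arr_0 intro!: frI\<close>)
qed

section \<open>Error counts over all thresholds\<close>

definition COUNT :: com where
  "COUNT = (SET (-45) 0 ;; SET (-42) 7 ;; SET (-34) 5 ;; REPEAT (-36) (-10) (
     LOAD (-37) (-42) ;; LOAD (-35) (-34) ;; SUB (-37) (-37) (-43) ;;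
     IFPOS (-37) (IFPOS (-35) (SET (-1) 0) (INC (-45) 1)) (IFPOS (-35) (INC (-45) 1) (SET (-1) 0)) ;;
     INC (-42) 8 ;; INC (-34) 8))"

lemma run_COUNT:
  assumes m: "M (-10) = int m" and y: "\<And>i. i < m \<Longrightarrow> M (arr 5 i) = y i"
    and y1: "\<And>i. i < m \<Longrightarrow> y i \<in> {1, -1}"
    and P: "\<And>i. i < m \<Longrightarrow> M (arr 7 i) = P i"
    and Q: "\<And>t M'. t \<le> 14 * m + 6 \<Longrightarrow> M' (-45) = int (card {i. i < m \<and> sg (P i - M (-43)) \<noteq> y i}) \<Longrightarrow>
       fr {-1,-34,-35,-36,-37,-42,-45} M M' \<Longrightarrow> Q t M' I"
  shows "run n v COUNT M I Q"
proof -
  let ?X = "{-1,-34,-35,-36,-37,-42,-45}"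
  define C where "C i = card {j. j < i \<and> sg (P j - M (-43)) \<noteq> y j}" for i
  have C_Suc: "C (Suc i) = (if sg (P i - M (-43)) \<noteq> y i then 1 else 0) + C i" for i
  proof -
    have "{j. j < Suc i \<and> sg (P j - M (-43)) \<noteq> y j} =
        (if sg (P i - M (-43)) \<noteq> y i then insert i {j. j < i \<and> sg (P j - M (-43)) \<noteq> y j}
         else {j. j < i \<and> sg (P j - M (-43)) \<noteq> y j})"
      by (auto simp: less_Suc_eq)
    then show ?thesis by (simp add: C_def)
  qed
  show ?thesis unfolding COUNT_def run_SEQ run_SET
  proof (rule run_REPEAT[where L = m and T = 11 and Inv = "\<lambda>i M' I'. I' = I \<and>
      M' (-42) = arr 7 i \<and> M' (-34) = arr 5 i \<and> M' (-45) = int (C i) \<and> fr ?X M M'"], goal_cases)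
    case (5 i M1 I1)
    from 5 have I: "I1 = I" and 1: "M1 (-42) = arr 7 i" "M1 (-34) = arr 5 i" "M1 (-45) = int (C i)"
      and f: "fr ?X M M1" by auto
    have 2: "M1 (arr 7 i) = P i" "M1 (arr 5 i) = y i" "M1 (-43) = M (-43)"
      using frD[OF f] P y \<open>i < m\<close> by auto
    consider "y i = 1" "P i - M (-43) > 0" | "y i = 1" "\<not> P i - M (-43) > 0"
      | "y i = -1" "P i - M (-43) > 0" | "y i = -1" "\<not> P i - M (-43) > 0"
      using y1[OF \<open>i < m\<close>] by blast
    then show ?case using 1 2 f
      by cases (simp_all add: I arr_Suc C_Suc sg_def frI)
  next
    case (6 t M' I')
    then show ?case by (auto intro!: Q simp: C_def algebra_simps)
  qed (use m in \<open>auto simp: arr_0 C_def intro!: frI\<close>)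
qed

definition KEEP :: com where
  "KEEP = (SUB (-29) (-47) (-45) ;; IFPOS (-29)
     (COPY (-47) (-45) ;; COPY (-48) (-43) ;; SET (-39) 1 ;; SET (-49) 2 ;;
      REPEAT (-33) (-8) (LOAD (-40) (-39) ;; STORE (-49) (-40) ;; INC (-39) 8 ;; INC (-49) 8))
     (SET (-1) 0))"

definition kept :: "nat \<Rightarrow> int \<Rightarrow> (nat \<Rightarrow> int) \<Rightarrow> int \<Rightarrow> memory \<Rightarrow> bool" where
  "kept N c W \<theta> M \<longleftrightarrow> M (-47) = c \<and> M (-48) = \<theta> \<and> (\<forall>k<N. M (arr 2 k) = W k)"

lemma run_KEEP:
  assumes N: "M (-8) = int N" and kept: "kept N c W \<theta> M" and V: "\<And>k. k < N \<Longrightarrow> M (arr 1 k) = V k"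
    and Q: "\<And>t M'. t \<le> 9 * N + 11 \<Longrightarrow>
       (if M (-45) < c then kept N (M (-45)) V (M (-43)) M' else kept N c W \<theta> M') \<Longrightarrow>
       fr ({-1,-29,-33,-39,-40,-47,-48,-49} \<union> range (arr 2)) M M' \<Longrightarrow> Q t M' I"
  shows "run n v KEEP M I Q"
proof -
  let ?X = "{-1,-29,-33,-39,-40,-47,-48,-49} \<union> range (arr 2)"
  show ?thesis
  proof (cases "M (-45) < c")
    case True
    have ne: "(-45 :: int) \<noteq> -1" "(-43 :: int) \<noteq> -1" by simp_all
    have pos: "(M(-29 := M (-47) - M (-45))) (-29) > 0" using True kept by (simp add: kept_def)
    show ?thesis unfolding KEEP_def run_SEQ run_IFPOS if_P[OF pos] run_SUB run_COPY[OF ne(1)] run_COPY[OF ne(2)] run_SET if_P[OF pos]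
    proof (rule run_REPEAT[where L = N and T = 6 and Inv = "\<lambda>i M' I'. I' = I \<and>
      M' (-39) = arr 1 i \<and> M' (-49) = arr 2 i \<and> M' (-47) = M (-45) \<and> M' (-48) = M (-43) \<and>
      (\<forall>j<i. M' (arr 2 j) = V j) \<and> fr ?X M M'"], goal_cases)
      case (5 i M1 I1)
      then have I: "I1 = I" and 1: "M1 (-39) = arr 1 i" "M1 (-49) = arr 2 i" "M1 (-47) = M (-45)" "M1 (-48) = M (-43)"
        and 2: "\<And>j. j < i \<Longrightarrow> M1 (arr 2 j) = V j" and f: "fr ?X M M1" by auto
      have 3: "M1 (arr 1 i) = V i" using frD[OF f, of "arr 1 i"] V[OF \<open>i < N\<close>] by (auto simp: image_iff)
      show ?case using 1 2 3 f by (auto simp: I arr_Suc less_Suc_eq intro!: frI)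
    next
      case (6 t M' I')
      then show ?case using True by (auto intro!: Q simp: kept_def)
    qed (use N in \<open>auto simp: arr_0 intro!: frI\<close>)
  next
    case False
    then show ?thesis using kept by (auto simp: KEEP_def kept_def intro!: Q frI)
  qed
qed

definition THRESH :: com where
  "THRESH = (SET (-1) 0 ;; SUB (-43) (-1) (-11) ;; ADD (-44) (-11) (-11) ;;
     REPEAT (-46) (-44) (COUNT ;; KEEP ;; INC (-43) 1))"

text \<open>\<open>G\<close> is any property of weights and threshold that is to be carried along;
  training uses it for the size bounds. The recorded count \<open>c\<close> only bounds the errors
  of the kept pair from above, which permits an initial pair whose errors were never
  counted.\<close>

lemma run_THRESH:
  assumes D: "data m N F y M" and y1: "\<And>i. i < m \<Longrightarrow> y i \<in> {1, -1}"
    and K: "M (-11) = int K" and P: "\<And>i. i < m \<Longrightarrow> M (arr 7 i) = dot N V (F i)"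
    and V: "\<And>k. k < N \<Longrightarrow> M (arr 1 k) = V k"
    and kept: "kept N c W \<theta> M" and G: "G W \<theta>" "int (nerr m N F y W \<theta>) \<le> c"
    and GV: "\<And>\<theta>. - int K \<le> \<theta> \<Longrightarrow> \<theta> < int K \<Longrightarrow> G V \<theta>"
    and Q: "\<And>t M' c' W' \<theta>'. t \<le> (14 * m + 9 * N + 22) * (2 * K) + 6 \<Longrightarrow> kept N c' W' \<theta>' M' \<Longrightarrow> G W' \<theta>' \<Longrightarrow>
        int (nerr m N F y W' \<theta>') \<le> c' \<Longrightarrow> c' \<le> c \<Longrightarrow>
        (\<And>\<theta>. - int K \<le> \<theta> \<Longrightarrow> \<theta> < int K \<Longrightarrow> c' \<le> int (nerr m N F y V \<theta>)) \<Longrightarrow>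
       fr ({-1,-29,-33,-34,-35,-36,-37,-39,-40,-42,-43,-44,-45,-46,-47,-48,-49} \<union> range (arr 2)) M M' \<Longrightarrow> Q t M' I"
  shows "run n v THRESH M I Q"
proof -
  let ?X = "{-1,-29,-33,-34,-35,-36,-37,-39,-40,-42,-43,-44,-45,-46,-47,-48,-49} \<union> range (arr 2)"
  show ?thesis unfolding THRESH_def run_SEQ run_SET run_SUB run_ADD
  proof (rule run_REPEAT[where L = "2 * K" and T = "14 * m + 9 * N + 19" and Inv = "\<lambda>i M' I'. I' = I \<and>
      M' (-43) = int i - int K \<and> fr ?X M M' \<and> (\<exists>c' W' \<theta>'. kept N c' W' \<theta>' M' \<and> G W' \<theta>' \<and> int (nerr m N F y W' \<theta>') \<le> c' \<and> c' \<le> c \<and>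
        (\<forall>\<theta>. - int K \<le> \<theta> \<and> \<theta> < int i - int K \<longrightarrow> c' \<le> int (nerr m N F y V \<theta>)))"], goal_cases)
    case (5 i M1 I1)
    then obtain c' W' \<theta>' where I: "I1 = I" and 1: "M1 (-43) = int i - int K"
      and f: "fr ?X M M1" and k: "kept N c' W' \<theta>' M1" "G W' \<theta>'" "int (nerr m N F y W' \<theta>') \<le> c'" "c' \<le> c"
      and min: "\<And>\<theta>. - int K \<le> \<theta> \<Longrightarrow> \<theta> < int i - int K \<Longrightarrow> c' \<le> int (nerr m N F y V \<theta>)" by auto
    have D1: "data m N F y M1" by (rule data_fr[OF D f]) auto
    have V1: "M1 (arr 1 k) = V k" if "k < N" for k
      using frD[OF f, of "arr 1 k"] V[OF that] by (auto simp: image_iff)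
    have P1: "M1 (arr 7 k) = dot N V (F k)" if "k < m" for k
      using frD[OF f, of "arr 7 k"] P[OF that] by (auto simp: image_iff)
    show ?case unfolding run_SEQ I
    proof (rule run_COUNT[where m = m and P = "\<lambda>i. dot N V (F i)" and y = y], goal_cases)
      case (5 t M2)
      note g = frD[OF 5(3)]
      have e: "M2 (-45) = int (nerr m N F y V (int i - int K))"
        using 5(2) 1 by (simp add: nerr_def)
      have a: "M2 (-43) = int i - int K" "M2 (-46) = M1 (-46)" "M2 (-8) = int N"
        using g 1 D1 by (auto simp: data_def)
      have k2: "kept N c' W' \<theta>' M2" using k(1) g by (simp add: kept_def)
      show ?case
      proof (rule run_KEEP[where N = N and c = c' and W = W' and \<theta> = \<theta>' and V = V], goal_cases)
        case (4 t' M3)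
        have f3: "fr ?X M M3"
          by (rule fr_trans[OF fr_trans[OF f 5(3), of ?X] 4(3)]) auto
        have b: "M3 (-43) = int i - int K" "M3 (-46) = M1 (-46)"
          using frD[OF 4(3)] a by (auto simp: image_iff)
        let ?M = "M3(-1 := 1, -43 := M3 (-43) + 1, -1 := -1, -46 := M1 (-46) - 1)"
        have kk: "kept N x V' z ?M = kept N x V' z M3" for x V' z
          by (simp add: kept_def)
        have GVi: "G V (int i - int K)" using \<open>i < 2 * K\<close> by (intro GV) auto
        have "\<exists>c' W' \<theta>'. kept N c' W' \<theta>' ?M \<and> G W' \<theta>' \<and> int (nerr m N F y W' \<theta>') \<le> c' \<and> c' \<le> c \<and>
           (\<forall>\<theta>. - int K \<le> \<theta> \<and> \<theta> < int (Suc i) - int K \<longrightarrow> c' \<le> int (nerr m N F y V \<theta>))"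
        proof (cases "M2 (-45) < c'")
          case True
          have "c'' \<le> int (nerr m N F y V \<theta>)" if "c'' = M2 (-45)" "- int K \<le> \<theta>" "\<theta> < int (Suc i) - int K" for c'' \<theta>
            using min[of \<theta>] that True e by (cases "\<theta> = int i - int K") auto
          then show ?thesis unfolding kk using 4(2) True k GVi e a
            by (intro exI[of _ "M2 (-45)"] exI[of _ V] exI[of _ "int i - int K"]) auto
        next
          case False
          have "c' \<le> int (nerr m N F y V \<theta>)" if "- int K \<le> \<theta>" "\<theta> < int (Suc i) - int K" for \<theta>
            using min[of \<theta>] that False e by (cases "\<theta> = int i - int K") auto
          then show ?thesis unfolding kk using 4(2) False k
            by (intro exI[of _ c'] exI[of _ W'] exI[of _ \<theta>']) auto
        qed
        moreover have "fr ?X M ?M" using f3 by (intro frI) auto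
        ultimately show ?case using 4(1) 5(1) b by simp
      qed (use a k2 g V1 in auto)
    qed (use D1 y1 P1 in \<open>auto simp: data_def\<close>)
  next
    case (6 t M' I')
    then obtain c' W' \<theta>' where I: "I' = I"
      and f: "fr ?X M M'" and k: "kept N c' W' \<theta>' M'" "G W' \<theta>'" "int (nerr m N F y W' \<theta>') \<le> c'" "c' \<le> c"
      and min: "\<And>\<theta>. - int K \<le> \<theta> \<Longrightarrow> \<theta> < int (2 * K) - int K \<Longrightarrow> c' \<le> int (nerr m N F y V \<theta>)" by auto
    show ?case unfolding I
      by (rule Q[OF _ k _ f]) (use 6(1) min in \<open>auto simp: algebra_simps\<close>)
  next
    case 4
    show ?case using kept G K by (auto simp: kept_def intro!: frI exI[of _ c] exI[of _ W] exI[of _ \<theta>])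
  qed (use K in auto)
qed

section \<open>The subgradient step\<close>

definition ROW :: com where
  "ROW = REPEAT (-33) (-8) (LOAD (-29) (-38) ;; LOAD (-40) (-39) ;;
     IFPOS (-50) (ADD (-40) (-40) (-29)) (SUB (-40) (-40) (-29)) ;;
     STORE (-39) (-40) ;; INC (-39) 8 ;; INC (-38) 8)"

lemma run_ROW:
  assumes N: "M (-8) = int N" and pf: "M (-38) = arr 4 b" and pv: "M (-39) = arr 1 0"
    and F: "\<And>k. k < N \<Longrightarrow> M (arr 4 (b + k)) = F k" and V: "\<And>k. k < N \<Longrightarrow> M (arr 1 k) = V k"
    and Q: "\<And>t M'. t \<le> 12 * N + 3 \<Longrightarrow> M' (-38) = arr 4 (b + N) \<Longrightarrow>
       (\<And>k. k < N \<Longrightarrow> M' (arr 1 k) = V k + sg (M (-50)) * F k) \<Longrightarrow>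
       fr ({-1,-29,-33,-38,-39,-40} \<union> range (arr 1)) M M' \<Longrightarrow> Q t M' I"
  shows "run n v ROW M I Q"
proof -
  let ?X = "{-1,-29,-33,-38,-39,-40} \<union> range (arr 1)"
  show ?thesis unfolding ROW_def
  proof (rule run_REPEAT[where L = N and T = 9 and Inv = "\<lambda>i M' I'. I' = I \<and>
      M' (-38) = arr 4 (b + i) \<and> M' (-39) = arr 1 i \<and>
      (\<forall>k<N. M' (arr 1 k) = (if k < i then V k + sg (M (-50)) * F k else V k)) \<and> fr ?X M M'"], goal_cases)
    case (5 i M1 I1)
    from 5 have I: "I1 = I" and 1: "M1 (-38) = arr 4 (b + i)" "M1 (-39) = arr 1 i"
      and 2: "\<And>k. k < N \<Longrightarrow> M1 (arr 1 k) = (if k < i then V k + sg (M (-50)) * F k else V k)"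
      and f: "fr ?X M M1" by auto
    have 3: "M1 (arr 4 (b + i)) = F i" "M1 (-50) = M (-50)"
      using frD[OF f] F[OF \<open>i < N\<close>] by (auto simp: image_iff)
    have 4: "M1 (arr 1 i) = V i" using 2[OF \<open>i < N\<close>] by simp
    show ?case using 1 2 3 4 f
      by (cases "M (-50) > 0") (simp_all add: I arr_Suc less_Suc_eq sg_def frI)
  next
    case (6 t M' I')
    then show ?case by (auto intro!: Q simp: algebra_simps)
  qed (use assms in \<open>auto intro!: frI\<close>)
qed

definition UPDATE :: com where
  "UPDATE = (SET (-38) 4 ;; SET (-42) 7 ;; SET (-34) 5 ;; REPEAT (-36) (-10) (
     LOAD (-37) (-42) ;; LOAD (-35) (-34) ;;
     IFPOS (-35) (SUB (-50) (-11) (-37)) (SET (-1) 0 ;; SUB (-1) (-1) (-11) ;; SUB (-50) (-1) (-37)) ;;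
     SET (-39) 1 ;; ROW ;; INC (-42) 8 ;; INC (-34) 8))"

text \<open>The label selects \<open>K\<close> or \<open>- K\<close>, so that \<open>K * y i\<close>
  is formed without a multiplication; the residual in \<open>-50\<close> then decides whether the
  row is added or subtracted.\<close>

lemma run_UPDATE:
  assumes D: "data m N F y M" and y1: "\<And>i. i < m \<Longrightarrow> y i \<in> {1, -1}"
    and K: "M (-11) = K" and P: "\<And>i. i < m \<Longrightarrow> M (arr 7 i) = P i"
    and V: "\<And>k. k < N \<Longrightarrow> M (arr 1 k) = V k"
    and Q: "\<And>t M'. t \<le> (12 * N + 17) * m + 6 \<Longrightarrow>
       (\<And>k. k < N \<Longrightarrow> M' (arr 1 k) = V k + (\<Sum>i<m. sg (K * y i - P i) * F i k)) \<Longrightarrow>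
       fr ({-1,-29,-33,-34,-35,-36,-37,-38,-39,-40,-42,-50} \<union> range (arr 1)) M M' \<Longrightarrow> Q t M' I"
  shows "run n v UPDATE M I Q"
proof -
  let ?X = "{-1,-29,-33,-34,-35,-36,-37,-38,-39,-40,-42,-50} \<union> range (arr 1)"
  show ?thesis unfolding UPDATE_def run_SEQ run_SET
  proof (rule run_REPEAT[where L = m and T = "12 * N + 14" and Inv = "\<lambda>j M' I'. I' = I \<and>
      M' (-38) = arr 4 (j * N) \<and> M' (-42) = arr 7 j \<and> M' (-34) = arr 5 j \<and>
      (\<forall>k<N. M' (arr 1 k) = V k + (\<Sum>i<j. sg (K * y i - P i) * F i k)) \<and> fr ?X M M'"], goal_cases)
    case (5 j M1 I1)
    from 5 have I: "I1 = I" and 1: "M1 (-38) = arr 4 (j * N)" "M1 (-42) = arr 7 j" "M1 (-34) = arr 5 j"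
      and 2: "\<And>k. k < N \<Longrightarrow> M1 (arr 1 k) = V k + (\<Sum>i<j. sg (K * y i - P i) * F i k)"
      and f: "fr ?X M M1" by auto
    have D1: "data m N F y M1" by (rule data_fr[OF D f]) auto
    have 3: "M1 (arr 7 j) = P j" "M1 (-11) = K"
      using frD[OF f] P[OF \<open>j < m\<close>] K by (auto simp: image_iff)
    have 4: "M1 (arr 5 j) = y j" "M1 (-8) = int N" "\<And>k. k < N \<Longrightarrow> M1 (arr 4 (j * N + k)) = F j k"
      using D1 \<open>j < m\<close> by (auto simp: data_def)
    have row: "run n v ROW M2 I (\<lambda>t M' I'. t \<le> 12 * N + 3 \<and> I' = I \<and> M' (-38) = arr 4 (Suc j * N) \<and>
        M' (-42) = arr 7 j \<and> M' (-34) = arr 5 j \<and> M' (-36) = M1 (-36) \<and>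
        (\<forall>k<N. M' (arr 1 k) = V k + (\<Sum>i<Suc j. sg (K * y i - P i) * F i k)) \<and> fr ?X M M')"
      if f2: "fr {-1,-35,-37,-39,-50} M1 M2" and s: "M2 (-39) = arr 1 0" "M2 (-50) = K * y j - P j" for M2
    proof (rule run_ROW[where N = N and b = "j * N" and F = "F j" and V = "\<lambda>k. M1 (arr 1 k)"], goal_cases)
      case (6 t M3)
      have "fr ?X M M2" by (rule fr_trans[OF f f2]) auto
      then have "fr ?X M M3" by (rule fr_trans[OF _ 6(4)]) auto
      moreover have "M3 (-42) = arr 7 j" "M3 (-34) = arr 5 j" "M3 (-36) = M1 (-36)"
        using frD[OF 6(4)] frD[OF f2] 1 by (auto simp: image_iff)
      ultimately show ?case using 6(1,2,3) 2 s(2) by (auto simp: add.commute)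
    qed (use frD[OF f2] s 1 4 in auto)
    consider "y j = 1" | "y j = -1" using y1[OF \<open>j < m\<close>] by auto
    then show ?case
    proof cases
      case a: 1
      have "fr {-1,-35,-37,-39,-50} M1 (M1(-37 := P j, -35 := 1, -50 := K - P j, -39 := 1))"
        by (auto simp: fr_def)
      from row[OF this] show ?thesis
        using 1 3 4 a by (auto simp: I arr_0 arr_Suc intro!: frI elim!: run_mono)
    next
      case a: 2
      have "fr {-1,-35,-37,-39,-50} M1 (M1(-37 := P j, -35 := -1, -1 := - K, -50 := - K - P j, -39 := 1))"
        by (auto simp: fr_def)
      from row[OF this] show ?thesis
        using 1 3 4 a by (auto simp: I arr_0 arr_Suc fun_upd_twist intro!: frI elim!: run_mono)
    qed
  next
    case (6 t M' I')
    then show ?case by (auto intro!: Q simp: algebra_simps)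
  qed (use assms in \<open>auto simp: arr_0 data_def intro!: frI\<close>)
qed

definition TRAIN :: com where
  "TRAIN = (COPY (-47) (-10) ;; REPEAT (-41) (-9) (PRED ;; THRESH ;; UPDATE))"

text \<open>Each step adds \<open>m\<close> signs to an entry. This linear growth is what bounds the
  number of hypotheses in the union bound.\<close>

lemma descent_bound:
  assumes "\<And>i k. i < m \<Longrightarrow> k < N \<Longrightarrow> F i k \<in> {1, -1}" and "k < N"
  shows "\<bar>descent m N K F y t k\<bar> \<le> int (t * m)"
proof (induction t)
  case (Suc t)
  let ?s = "\<Sum>i<m. sg (K * y i - dot N (descent m N K F y t) (F i)) * F i k"
  have "\<bar>?s\<bar> \<le> (\<Sum>i<m. \<bar>sg (K * y i - dot N (descent m N K F y t) (F i)) * F i k\<bar>)"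
    by (rule sum_abs)
  also have "\<dots> \<le> (\<Sum>i<m. 1)"
    using assms(1)[OF _ \<open>k < N\<close>] by (intro sum_mono) (fastforce simp: sg_def abs_mult)
  finally show ?case using Suc by (auto simp: algebra_simps)
qed simp

abbreviation "train_regs \<equiv> {-1,-29,-33,-34,-35,-36,-37,-38,-39,-40,-41,-42,-43,-44,-45,-46,-47,-48,-49,-50}"

lemma run_TRAIN:
  assumes D: "data m N F y M" and F1: "\<And>i k. i < m \<Longrightarrow> k < N \<Longrightarrow> F i k \<in> {1, -1}"
    and y1: "\<And>i. i < m \<Longrightarrow> y i \<in> {1, -1}" and K: "M (-11) = int K" and T: "M (-9) = int T"
    and zero: "\<And>k. k < N \<Longrightarrow> M (arr 1 k) = 0" "\<And>k. k < N \<Longrightarrow> M (arr 2 k) = 0" "M (-48) = 0"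
    and Q: "\<And>t M' W \<theta>. t \<le> (((12 * N + 11) * m + (14 * m + 9 * N + 22) * (2 * K) + (12 * N + 17) * m + 20) * T + 5) \<Longrightarrow>
       (\<And>k. k < N \<Longrightarrow> M' (arr 2 k) = W k) \<Longrightarrow> M' (-48) = \<theta> \<Longrightarrow>
       (\<And>k. k < N \<Longrightarrow> \<bar>W k\<bar> \<le> int (T * m)) \<Longrightarrow> \<bar>\<theta>\<bar> \<le> int K \<Longrightarrow>
       (\<And>s \<theta>'. s < T \<Longrightarrow> - int K \<le> \<theta>' \<Longrightarrow> \<theta>' < int K \<Longrightarrow>
          nerr m N F y W \<theta> \<le> nerr m N F y (descent m N (int K) F y s) \<theta>') \<Longrightarrow>
       fr (train_regs \<union> range (arr 1) \<union> range (arr 2) \<union> range (arr 7)) M M' \<Longrightarrow> Q t M' I"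
  shows "run n v TRAIN M I Q"
proof -
  let ?X = "train_regs \<union> range (arr 1) \<union> range (arr 2) \<union> range (arr 7)"
  let ?d = "descent m N (int K) F y"
  let ?c1 = "(12 * N + 11) * m + 5" and ?c2 = "(14 * m + 9 * N + 22) * (2 * K) + 6" and ?c3 = "(12 * N + 17) * m + 6"
  \<comment> \<open>The bounds that place the final pair in the finite class over which the union
    bound is taken.\<close>
  define G where "G W \<theta> \<longleftrightarrow> (\<forall>k<N. \<bar>W k\<bar> \<le> int (T * m)) \<and> \<bar>\<theta>\<bar> \<le> int K" for W :: "nat \<Rightarrow> int" and \<theta> :: int
  have ne: "(-10 :: int) \<noteq> -1" by simp
  have nerr_le: "nerr m N F y W \<theta> \<le> m" for W \<theta>
    unfolding nerr_def using card_mono[of "{..<m}" "{i. i < m \<and> sg (dot N W (F i) - \<theta>) \<noteq> y i}"] by auto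
  show ?thesis unfolding TRAIN_def run_SEQ run_COPY[OF ne]
  proof (rule run_REPEAT[where L = T and T = "?c1 + ?c2 + ?c3" and Inv = "\<lambda>s M' I'. I' = I \<and>
      (\<forall>k<N. M' (arr 1 k) = ?d s k) \<and> fr ?X M M' \<and>
      (\<exists>c W \<theta>. kept N c W \<theta> M' \<and> G W \<theta> \<and> int (nerr m N F y W \<theta>) \<le> c \<and>
        (\<forall>s'<s. \<forall>\<theta>'. - int K \<le> \<theta>' \<and> \<theta>' < int K \<longrightarrow> c \<le> int (nerr m N F y (?d s') \<theta>')))"], goal_cases)
    case (5 s M1 I1)
    then obtain c W \<theta> where I: "I1 = I" and 1: "\<And>k. k < N \<Longrightarrow> M1 (arr 1 k) = ?d s k" and f: "fr ?X M M1"
      and k: "kept N c W \<theta> M1" "G W \<theta>" "int (nerr m N F y W \<theta>) \<le> c"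
      and min: "\<And>s' \<theta>'. s' < s \<Longrightarrow> - int K \<le> \<theta>' \<Longrightarrow> \<theta>' < int K \<Longrightarrow> c \<le> int (nerr m N F y (?d s') \<theta>')" by auto
    have D1: "data m N F y M1" by (rule data_fr[OF D f]) auto
    have GV: "G (?d s) \<theta>" if "- int K \<le> \<theta>" "\<theta> < int K" for \<theta>
    proof -
      have "\<bar>?d s k\<bar> \<le> int (T * m)" if "k < N" for k
      proof -
        have "\<bar>?d s k\<bar> \<le> int (s * m)" by (rule descent_bound[OF F1 that])
        also have "\<dots> \<le> int (T * m)" using \<open>s < T\<close> by (simp add: mult_right_mono)
        finally show ?thesis .
      qed
      then show ?thesis using that by (auto simp: G_def)
    qed
    show ?case unfolding run_SEQ I
    proof (rule run_PRED[OF D1 F1 1], goal_cases)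
      case (4 t2 M2)
      note g2 = frD[OF 4(3)]
      have D2: "data m N F y M2" by (rule data_fr[OF D1 4(3)]) auto
      have 2: "M2 (arr 1 k) = ?d s k" if "k < N" for k using g2[of "arr 1 k"] 1[OF that] by (auto simp: image_iff)
      have k2: "kept N c W \<theta> M2" using k(1) g2 by (auto simp: kept_def image_iff)
      have K2: "M2 (-11) = int K" using g2 frD[OF f] K by (auto simp: image_iff)
      show ?case
      proof (rule run_THRESH[where G = G, OF D2 y1 K2 4(2) 2 k2 k(2,3) GV], goal_cases)
        case (6 t3 M3 c' W' \<theta>')
        note g3 = frD[OF 6(7)]
        have D3: "data m N F y M3" by (rule data_fr[OF D2 6(7)]) auto
        have 3: "M3 (arr 1 k) = ?d s k" if "k < N" for k using g3[of "arr 1 k"] 2[OF that] by (auto simp: image_iff)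
        have P3: "M3 (arr 7 k) = dot N (?d s) (F k)" if "k < m" for k
          using g3[of "arr 7 k"] 4(2)[OF that] by (auto simp: image_iff)
        have K3: "M3 (-11) = int K" using g3 K2 by (auto simp: image_iff)
        show ?case
        proof (rule run_UPDATE[OF D3 y1 K3 P3 3], goal_cases)
          case (4 t4 M4)
          note g4 = frD[OF 4(3)]
          let ?M = "M4(-1 := -1, -41 := M1 (-41) - 1)"
          have "fr ?X M M4"
            by (rule fr_trans[OF fr_trans[OF fr_trans[OF f \<open>fr _ M1 M2\<close>, of ?X] 6(7), of ?X] 4(3)]) auto
          then have "fr ?X M ?M" by (intro frI) auto
          moreover have "M4 (-41) = M1 (-41)" using g2 g3 g4 by (auto simp: image_iff)
          moreover have kM: "kept N c' W' \<theta>' ?M" using 6(2) g4 by (auto simp: kept_def image_iff)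
          have mM: "c' \<le> int (nerr m N F y (?d s') \<theta>')" if "s' < Suc s" "- int K \<le> \<theta>'" "\<theta>' < int K" for s' \<theta>'
            using min[of s' \<theta>'] 6(5) 6(6)[of \<theta>'] that by (cases "s' = s") auto
          have "\<exists>c W \<theta>. kept N c W \<theta> ?M \<and> G W \<theta> \<and> int (nerr m N F y W \<theta>) \<le> c \<and>
            (\<forall>s'<Suc s. \<forall>\<theta>'. - int K \<le> \<theta>' \<and> \<theta>' < int K \<longrightarrow> c \<le> int (nerr m N F y (?d s') \<theta>'))"
            by (rule exI[of _ c'], rule exI[of _ W'], rule exI[of _ \<theta>']) (use kM mM 6(3,4) in blast)
          note ex = this
          moreover have "?M (arr 1 k) = ?d (Suc s) k" if "k < N" for k
            using 4(2)[OF that] by simp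
          moreover have "t2 + (t3 + t4) \<le> ?c1 + ?c2 + ?c3" using \<open>t2 \<le> _\<close> 6(1) 4(1) by linarith
          ultimately show ?case using ex by (simp del: descent.simps)
        qed auto
      qed auto
    qed auto
  next
    case (6 t M' I')
    then obtain c W \<theta> where I: "I' = I" and f: "fr ?X M M'"
      and k: "kept N c W \<theta> M'" "G W \<theta>" "int (nerr m N F y W \<theta>) \<le> c"
      and min: "\<And>s' \<theta>'. s' < T \<Longrightarrow> - int K \<le> \<theta>' \<Longrightarrow> \<theta>' < int K \<Longrightarrow> c \<le> int (nerr m N F y (?d s') \<theta>')" by auto
    have "nerr m N F y W \<theta> \<le> nerr m N F y (?d s') \<theta>'" if "s' < T" "- int K \<le> \<theta>'" "\<theta>' < int K" for s' \<theta>'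
      using min[OF that] k(3) by linarith
    then show ?case unfolding I
      by (intro Q[where W = W and \<theta> = \<theta>] f) (use 6(1) k in \<open>auto simp: kept_def G_def algebra_simps\<close>)
  next
    case 4
    \<comment> \<open>The initial pair consists of zero weights and threshold 0; its recorded count
      \<open>m\<close> bounds the errors of every hypothesis.\<close>
    show ?case using zero nerr_le D
      by (auto simp: kept_def data_def G_def intro!: frI exI[of _ "int m"] exI[of _ "\<lambda>_. 0"] exI[of _ 0])
  qed (use T in auto)
qed

definition EVAL :: com where
  "EVAL = (SET (-22) 3 ;; FEAT ;; SET (-38) 3 ;; SET (-39) 2 ;; DOT ;; SUB (-37) (-37) (-48) ;;
     IFPOS (-37) (SET 0 1) (SET 0 (-1)))"

lemma run_EVAL:
  assumes n: "M (-2) = int n" and d: "M (-6) = int d" and N: "M (-8) = int ((n + 1) ^ d)"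
    and x: "\<And>j. j < n \<Longrightarrow> x j \<in> {1, -1}" and W: "\<And>k. k < (n + 1) ^ d \<Longrightarrow> M (arr 2 k) = W k" and \<theta>: "M (-48) = \<theta>"
  shows "run n v EVAL M [(x, y)] (\<lambda>t M' I'. t \<le> (14 * (n + 1) ^ d * n + 11 * n + 9) * d + 12 * (n + 1) ^ d + 20 \<and>
     M' 0 = sg (dot ((n + 1) ^ d) W (feat n d x) - \<theta>))"
  unfolding EVAL_def run_SEQ run_SET
proof (rule run_FEAT[where w = 3 and b = 0 and d = d], goal_cases)
  case (7 t M2)
  note g2 = frD[OF 7(4)]
  show ?case
  proof (rule run_DOT[where N = "(n + 1) ^ d" and af = 3 and b = 0 and av = 2 and F = "feat n d x" and V = W], goal_cases)
    case (7 t' M3)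
    have "M3 (-48) = \<theta>" using frD[OF 7(4)] g2 \<theta> by (auto simp: image_iff)
    then show ?case using 7(1,2) \<open>t \<le> _\<close> by (simp add: sg_def dot_def)
  next
    case (4 k)
    then show ?case using 7(3)[of k] by simp
  next
    case (6 k)
    then show ?case using feat_sign[OF x] by simp
  qed (use g2 N W in \<open>auto simp: arr_0 image_iff\<close>)
qed (use assms in \<open>auto simp: arr_0\<close>)

section \<open>Choice of the parameters\<close>

text \<open>Repeated addition takes time proportional to the value in \<open>b\<close>, so callers
  put the smaller factor, or one known to be polynomial in \<open>Z\<close>, in that place; the size
  of the other factor does not affect the step count.\<close>

definition MUL :: "addr \<Rightarrow> addr \<Rightarrow> addr \<Rightarrow> com" where
  "MUL r a b = (SET r 0 ;; REPEAT (-20) b (ADD r r a))"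

lemma run_MUL:
  assumes "M b = int l" "r \<notin> {-1, -20}" "a \<notin> {-1, -20, r}" "b \<notin> {-1, r}"
    and Q: "\<And>t M'. t \<le> 4 * l + 4 \<Longrightarrow> M' r = M a * int l \<Longrightarrow> fr {-1, -20, r} M M' \<Longrightarrow> Q t M' I"
  shows "run n v (MUL r a b) M I Q"
  unfolding MUL_def run_SEQ run_SET
proof (rule run_REPEAT[where L = l and T = 1 and Inv = "\<lambda>k M' I'. I' = I \<and> M' r = M a * int k \<and> fr {-1, -20, r} M M'"], goal_cases)
  case (5 k M1 I1)
  then have "M1 a = M a" using frD[of "{-1, -20, r}" M M1 a] assms(3) by auto
  then show ?case using 5 assms(2-4) by (auto simp: algebra_simps intro!: frI)
next
  case (6 t M' I')
  then show ?case by (auto intro!: Q)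
qed (use assms in \<open>auto intro!: frI\<close>)

definition TESTN :: "param \<Rightarrow> addr \<Rightarrow> addr \<Rightarrow> com" where
  "TESTN p a b = (TEST (-13) p a b ;; SET (-1) 1 ;; SUB (-13) (-1) (-13))"

text \<open>A parameter can only be compared with rationals, so a number of the order of its
  reciprocal is found by raising a candidate until the comparison succeeds. The flag in
  \<open>-13\<close> holds the negated comparison because the loop runs while it is
  positive.\<close>

definition SEARCH :: "param \<Rightarrow> addr \<Rightarrow> addr \<Rightarrow> com \<Rightarrow> com" where
  "SEARCH p a b upd = (TESTN p a b ;; WHILEPOS (-13) (upd ;; TESTN p a b))"

lemma run_TESTN:
  assumes "M a = A" "M b = B"
    and "\<And>M'. fr {-1, -13} M M' \<Longrightarrow> M' (-13) = (if real_of_int A \<le> v p * real_of_int B then 0 else 1) \<Longrightarrow> Q 3 M' I"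
  shows "run n v (TESTN p a b) M I Q"
  using assms by (simp add: TESTN_def numeral_3_eq_3 frI)

text \<open>The index \<open>kb\<close> only witnesses that the search ends; the exact number of
  rounds is the least successful index. The assumption \<open>stable\<close> is there because each
  comparison overwrites the scratch register and the flag.\<close>

lemma run_SEARCH:
  fixes g :: "nat \<Rightarrow> int"
  assumes ex: "real_of_int A \<le> v p * real_of_int (g kb)"
    and L: "L = (LEAST k. real_of_int A \<le> v p * real_of_int (g k))"
    and start: "Inv 0 M"
    and val: "\<And>k M. Inv k M \<Longrightarrow> M a = A \<and> M b = g k"
    and upd: "\<And>k M Q. Inv k M \<Longrightarrow> (\<And>t M'. t \<le> T \<Longrightarrow> Inv (Suc k) M' \<Longrightarrow> Q t M' I) \<Longrightarrow> run n v upd M I Q"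
    and stable: "\<And>k M M'. Inv k M \<Longrightarrow> fr {-1, -13} M M' \<Longrightarrow> Inv k M'"
    and Q: "\<And>t M'. t \<le> (T + 4) * L + 4 \<Longrightarrow> Inv L M' \<Longrightarrow> Q t M' I"
  shows "run n v (SEARCH p a b upd) M I Q"
proof -
  let ?P = "\<lambda>k. real_of_int A \<le> v p * real_of_int (g k)"
  let ?J = "\<lambda>k M I'. I' = I \<and> Inv k M \<and> M (-13) = (if ?P k then 0 else 1)"
  have PL: "?P L" unfolding L by (rule LeastI[of ?P, OF ex])
  have nP: "\<not> ?P k" if "k < L" for k using that not_less_Least unfolding L by blast
  show ?thesis unfolding SEARCH_def run_SEQ
  proof (rule run_TESTN)
    show "M a = A" "M b = g 0" using val[OF start] by auto
    fix M1 assume f: "fr {-1, -13} M M1" and z: "M1 (-13) = (if ?P 0 then 0 else 1)"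
    show "run n v (WHILEPOS (-13) (upd ;; TESTN p a b)) M1 I (\<lambda>t2. Q (3 + t2))"
    proof (rule run_WHILE[where Inv = ?J and L = L and T = "T + 3"])
      fix k M2 I2 assume k: "k < L" and J: "?J k M2 I2"
      have "run n v (upd ;; TESTN p a b) M2 I (\<lambda>t M' I'. t \<le> T + 3 \<and> ?J (Suc k) M' I')"
        unfolding run_SEQ
      proof (rule upd)
        show "Inv k M2" using J by simp
        fix t M3 assume t: "t \<le> T" and i: "Inv (Suc k) M3"
        show "run n v (TESTN p a b) M3 I (\<lambda>t2 M' I'. t + t2 \<le> T + 3 \<and> ?J (Suc k) M' I')"
          by (rule run_TESTN) (use val[OF i] t stable[OF i] in auto)
      qed
      then show "0 < M2 (-13) \<and> run n v (upd ;; TESTN p a b) M2 I2 (\<lambda>t M' I'. t \<le> T + 3 \<and> ?J (Suc k) M' I')"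
        using J nP[OF k] by simp
    next
      show "?J 0 M1 I" using stable[OF start f] z by simp
    next
      fix t M I' assume "t \<le> (T + 3 + 1) * L + 1" "?J L M I'"
      then show "Q (3 + t) M I'" by (auto intro!: Q simp: algebra_simps)
    qed (use PL in auto)
  qed
qed

text \<open>
  With \<open>q = 2 ^ eps_exp \<epsilon>\<close> of order \<open>1/\<epsilon>\<close>, the degree makes \<open>(1 - 2\<sigma>)\<^sup>d\<close> at most \<open>1/(2q)\<close>. For
  \<open>\<epsilon> \<ge> 3/4\<close> the time bound need not grow with \<open>n\<close>, so not even one coordinate per sample can be read;
  degree 0, that is a constant hypothesis, is then accurate enough.
\<close>

definition eps_exp :: "real \<Rightarrow> nat" where
  "eps_exp \<epsilon> = 3 + (LEAST k. 2 \<le> \<epsilon> * (8 * 2 ^ k))"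
definition sig_inv :: "real \<Rightarrow> nat" where
  "sig_inv \<sigma> = Suc (LEAST k. 1 \<le> \<sigma> * real (Suc k))"
definition del_exp :: "real \<Rightarrow> nat" where
  "del_exp \<delta> = Suc (LEAST k. 1 \<le> \<delta> * 2 ^ Suc k)"
definition degr :: "real \<Rightarrow> real \<Rightarrow> nat" where
  "degr \<epsilon> \<sigma> = (if 3 \<le> \<epsilon> * 4 then 0 else eps_exp \<epsilon> * sig_inv \<sigma>)"

abbreviation (input) prep_regs :: "addr set" where "prep_regs \<equiv> {-1,-2,-3,-4,-5,-6,-7,-8,-9,-10,-11,-12,-13,-14,-15,-16,-17,-18,-19,-20,-21}"

definition PREP_ACCURACY :: com where
  "PREP_ACCURACY = (COPY (-2) 0 ;; SET (-3) 8 ;; SET (-4) 3 ;; SET (-14) 2 ;;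
     SEARCH Eps (-14) (-3) (ADD (-3) (-3) (-3) ;; INC (-4) 1))"

lemma run_PREP_ACCURACY:
  assumes e: "v Eps > 0" and n: "M 0 = int n"
    and Q: "\<And>t M'. t \<le> 7 * eps_exp (v Eps) + 9 \<Longrightarrow> M' (-2) = int n \<Longrightarrow> M' (-3) = 2 ^ eps_exp (v Eps) \<Longrightarrow>
      M' (-4) = int (eps_exp (v Eps)) \<Longrightarrow> fr prep_regs M M' \<Longrightarrow> Q t M' I"
  shows "run n v PREP_ACCURACY M I Q"
proof -
  have ne: "(0 :: int) \<noteq> -1" by simp
  obtain k0 :: nat where k0: "2 / (v Eps * 8) < 2 ^ k0" using real_arch_pow[of 2 "2 / (v Eps * 8)"] by auto
  show ?thesis unfolding PREP_ACCURACY_def run_SEQ run_SET run_COPY[OF ne]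
  proof (rule run_SEARCH[where A = 2 and kb = k0 and g = "\<lambda>k. 8 * 2 ^ k" and T = 3 and
      Inv = "\<lambda>k M'. M' (-14) = 2 \<and> M' (-2) = int n \<and> M' (-3) = 8 * 2 ^ k \<and> M' (-4) = int (3 + k) \<and> fr prep_regs M M'", OF _ refl], goal_cases)
    case 1
    show ?case using k0 e by (simp add: field_simps)
  next
    case (4 k M1 Q)
    show ?case by (simp, rule 4(2)) (use 4(1) in \<open>auto intro!: frI\<close>)
  next
    case (5 k M1 M2)
    have "fr prep_regs M M2" by (rule fr_trans[OF _ 5(2)]) (use 5(1) in auto)
    then show ?case using 5(1) frD[OF 5(2)] by auto
  next
    case (6 t M')
    let ?k = "LEAST k. 2 \<le> v Eps * (8 * 2 ^ k)"
    have "(LEAST k. real_of_int 2 \<le> v Eps * real_of_int (8 * 2 ^ k)) = ?k" by simp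
    with 6 show ?case by (auto intro!: Q simp: eps_exp_def power_add)
  qed (use n in \<open>auto intro!: frI\<close>)
qed

definition PREP_DEGREE :: com where
  "PREP_DEGREE = (SET (-14) 3 ;; SET (-15) 4 ;; SET (-6) 0 ;; TESTN Eps (-14) (-15) ;;
     IFPOS (-13) (SET (-5) 1 ;; SET (-14) 1 ;; SEARCH Sig (-14) (-5) (INC (-5) 1) ;; MUL (-6) (-4) (-5))
       (SET (-1) 0))"

lemma run_PREP_DEGREE:
  assumes s: "v Sig > 0" and e: "M (-4) = int (eps_exp (v Eps))"
    and Q: "\<And>t M'. t \<le> 10 * degr (v Eps) (v Sig) + 17 \<Longrightarrow> M' (-6) = int (degr (v Eps) (v Sig)) \<Longrightarrow>
      M' (-2) = M (-2) \<Longrightarrow> M' (-3) = M (-3) \<Longrightarrow> fr prep_regs M M' \<Longrightarrow> Q t M' I"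
  shows "run n v PREP_DEGREE M I Q"
  unfolding PREP_DEGREE_def run_SEQ run_SET
proof (rule run_TESTN[where A = 3 and B = 4], goal_cases)
  case (3 M1)
  have f1: "fr prep_regs M M1"
    by (rule fr_trans[OF frI[OF frI[OF frI]] 3(1), of prep_regs]) auto
  have m1: "M1 (-2) = M (-2)" "M1 (-3) = M (-3)" "M1 (-4) = int (eps_exp (v Eps))" "M1 (-6) = 0"
    using frD[OF 3(1)] e by auto
  show ?case
  proof (cases "3 \<le> v Eps * 4")
    case True
    then show ?thesis using 3(2) f1 m1 by (auto intro!: Q frI simp: degr_def)
  next
    case False
    let ?s = "sig_inv (v Sig)"
    have pos: "M1 (-13) > 0" using 3(2) False by simp
    obtain k0 :: nat where k0: "1 / v Sig < real k0" using reals_Archimedean2 by blast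
    show ?thesis unfolding run_IFPOS if_P[OF pos] run_SEQ run_SET
    proof (rule run_SEARCH[where A = 1 and kb = k0 and g = "\<lambda>k. int (Suc k)" and T = 2 and
      Inv = "\<lambda>k M'. M' (-14) = 1 \<and> M' (-2) = M (-2) \<and> M' (-3) = M (-3) \<and> M' (-4) = int (eps_exp (v Eps)) \<and> M' (-5) = int (Suc k) \<and> fr prep_regs M M'", OF _ refl], goal_cases)
      case 1
      show ?case using k0 s by (simp add: field_simps)
    next
      case 2
      have "fr prep_regs M (M1(-5 := 1, -14 := 1))" using f1 by (intro frI) auto
      then show ?case using m1 by simp
    next
      case (4 k M1 Q)
      show ?case by (simp, rule 4(2)) (use 4(1) in \<open>auto intro!: frI\<close>)
    next
      case (5 k M1 M2)
      have "fr prep_regs M M2" by (rule fr_trans[OF _ 5(2)]) (use 5(1) in auto)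
      then show ?case using 5(1) frD[OF 5(2)] by auto
    next
      case (6 t M2)
      let ?k = "LEAST k. 1 \<le> v Sig * real (Suc k)"
      have k: "(LEAST k. real_of_int 1 \<le> v Sig * real_of_int (int (Suc k))) = ?k" by (simp add: add.commute)
      have s5: "M2 (-5) = int ?s" using 6(2) unfolding k by (simp add: sig_inv_def)
      have d: "degr (v Eps) (v Sig) = eps_exp (v Eps) * ?s" using False by (simp add: degr_def)
      \<comment> \<open>Both the search and the multiplication take time linear in
        \<open>?s\<close>, which is charged to the degree because the exponent of the accuracy is at
        least 3.\<close>
      have "?s \<le> eps_exp (v Eps) * ?s" by (simp add: eps_exp_def)
      then have t: "t + 4 * ?s + 13 \<le> 10 * degr (v Eps) (v Sig) + 17"
        unfolding d using 6(1) k by (simp add: sig_inv_def)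
      show ?case
      proof (rule run_MUL[where l = ?s], goal_cases)
        case (5 t' M3)
        have "fr prep_regs M M3" by (rule fr_trans[OF _ 5(3)]) (use 6(2) in auto)
        then show ?case using 5(1,2) frD[OF 5(3)] 6(2) t d by (intro Q) (auto simp: mult.commute)
      qed (use s5 in auto)
    qed (auto intro!: frI)
  qed
qed auto

definition PREP_CONFIDENCE :: com where
  "PREP_CONFIDENCE = (SET (-16) 2 ;; SET (-7) 1 ;; SET (-14) 1 ;;
     SEARCH Del (-14) (-16) (ADD (-16) (-16) (-16) ;; INC (-7) 1))"

lemma run_PREP_CONFIDENCE:
  assumes e: "v Del > 0"
    and Q: "\<And>t M'. t \<le> 7 * del_exp (v Del) + 9 \<Longrightarrow> M' (-2) = M (-2) \<Longrightarrow> M' (-3) = M (-3) \<Longrightarrow> M' (-6) = M (-6) \<Longrightarrow>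
      M' (-7) = int (del_exp (v Del)) \<Longrightarrow> fr prep_regs M M' \<Longrightarrow> Q t M' I"
  shows "run n v PREP_CONFIDENCE M I Q"
proof -
  obtain k0 :: nat where k0: "1 / (v Del * 2) < 2 ^ k0" using real_arch_pow[of 2 "1 / (v Del * 2)"] by auto
  show ?thesis unfolding PREP_CONFIDENCE_def run_SEQ run_SET
  proof (rule run_SEARCH[where A = 1 and kb = k0 and g = "\<lambda>k. 2 ^ Suc k" and T = 3 and
      Inv = "\<lambda>k M'. M' (-14) = 1 \<and> M' (-2) = M (-2) \<and> M' (-3) = M (-3) \<and> M' (-6) = M (-6) \<and> M' (-16) = 2 ^ Suc k \<and> M' (-7) = int (Suc k) \<and> fr prep_regs M M'", OF _ refl], goal_cases)
    case 1
    show ?case using k0 e by (simp add: field_simps)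
  next
    case (4 k M1 Q)
    show ?case by (simp, rule 4(2)) (use 4(1) in \<open>auto intro!: frI\<close>)
  next
    case (5 k M1 M2)
    have "fr prep_regs M M2" by (rule fr_trans[OF _ 5(2)]) (use 5(1) in auto)
    then show ?case using 5(1) frD[OF 5(2)] by auto
  next
    case (6 t M')
    let ?k = "LEAST k. 1 \<le> v Del * 2 ^ Suc k"
    have "(LEAST k. real_of_int 1 \<le> v Del * real_of_int (2 ^ Suc k)) = ?k" by simp
    with 6 show ?case by (auto intro!: Q simp: del_exp_def)
  qed (auto intro!: frI)
qed

definition PREP_DIMENSION :: com where
  "PREP_DIMENSION = (COPY (-17) (-2) ;; INC (-17) 1 ;; SET (-8) 1 ;;
     REPEAT (-21) (-6) (MUL (-18) (-8) (-17) ;; COPY (-8) (-18)))"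

lemma run_PREP_DIMENSION:
  assumes n: "M (-2) = int n" and d: "M (-6) = int d"
    and Q: "\<And>t M'. t \<le> (4 * n + 13) * d + 8 \<Longrightarrow> M' (-8) = int ((n + 1) ^ d) \<Longrightarrow> M' (-2) = M (-2) \<Longrightarrow> M' (-3) = M (-3) \<Longrightarrow> M' (-6) = M (-6) \<Longrightarrow>
      M' (-7) = M (-7) \<Longrightarrow> fr prep_regs M M' \<Longrightarrow> Q t M' I"
  shows "run n v PREP_DIMENSION M I Q"
proof -
  have ne: "(-2 :: int) \<noteq> -1" "(-17 :: int) \<noteq> -1" by simp_all
  show ?thesis unfolding PREP_DIMENSION_def run_SEQ run_SET run_COPY[OF ne(1)] run_INC[OF ne(2)]
  proof (rule run_REPEAT[where L = d and T = "4 * n + 10" and Inv = "\<lambda>k M' I'. I' = I \<and>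
      M' (-8) = int ((n + 1) ^ k) \<and> M' (-17) = int (n + 1) \<and> M' (-2) = M (-2) \<and> M' (-3) = M (-3) \<and> M' (-6) = M (-6) \<and>
      M' (-7) = M (-7) \<and> fr prep_regs M M'"], goal_cases)
    case (5 k M1 I1)
    then have I: "I1 = I" and 1: "M1 (-17) = int (n + 1)" by auto
    show ?case unfolding run_SEQ I
    proof (rule run_MUL[where l = "n + 1"], goal_cases)
      case g: (5 t M2)
      have "fr prep_regs M M2" by (rule fr_trans[OF _ g(3)]) (use 5 in auto)
      then show ?case using 5 g(1,2) frD[OF g(3)] by (auto simp: algebra_simps intro!: frI)
    qed (use 1 in auto)
  next
    case (6 t M' I')
    then show ?case by (auto intro!: Q simp: algebra_simps)
  qed (use assms in \<open>auto intro!: frI\<close>)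
qed

definition PREP_SIZES :: com where
  "PREP_SIZES = (MUL (-17) (-8) (-3) ;; MUL (-12) (-17) (-7) ;; MUL (-18) (-12) (-12) ;; MUL (-19) (-18) (-18) ;;
     SET (-18) 64 ;; MUL (-10) (-19) (-18) ;; MUL (-11) (-10) (-17) ;; MUL (-9) (-17) (-3) ;; INC (-9) 1)"

lemma run_PREP_SIZES:
  assumes q: "M (-3) = int q" and r: "M (-7) = int r" and N: "M (-8) = int N"
    and Z: "Z = N * q * r" and m: "m = 64 * Z ^ 4"
    and Q: "\<And>t M'. t \<le> 4 * (q + r + Z + Z * Z + 64 + N * q + q) + 31 \<Longrightarrow>
      M' (-8) = int N \<Longrightarrow> M' (-2) = M (-2) \<Longrightarrow> M' (-6) = M (-6) \<Longrightarrow>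
      M' (-10) = int m \<Longrightarrow> M' (-11) = int (m * N * q) \<Longrightarrow> M' (-9) = int (N * q * q + 1) \<Longrightarrow>
      fr prep_regs M M' \<Longrightarrow> Q t M' I"
  shows "run n v PREP_SIZES M I Q"
  unfolding PREP_SIZES_def run_SEQ run_SET
proof (rule run_MUL[where l = q], goal_cases)
  case (5 t1 M1)
  note f1 = 5
  have v1: "M1 (-17) = int (N * q)" "M1 (-7) = int r" using f1(2) frD[OF f1(3)] N r by simp_all
  show ?case
  proof (rule run_MUL[where l = r], goal_cases)
    case (5 t2 M2)
    note f2 = 5
    have v2: "M2 (-12) = int Z" using f2(2) v1 by (simp add: Z)
    show ?case
    proof (rule run_MUL[where l = Z], goal_cases)
      case (5 t3 M3)
      note f3 = 5
      have v3: "M3 (-18) = int (Z * Z)" using f3(2) v2 by simp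
      show ?case
      proof (rule run_MUL[where l = "Z * Z"], goal_cases)
        case (5 t4 M4)
        note f4 = 5
        show ?case
        proof (rule run_MUL[where l = 64], goal_cases)
          case (5 t5 M5)
          note f5 = 5
          have fr5: "fr prep_regs M M5"
          proof -
            have "fr prep_regs M M4"
              by (rule fr_trans[OF fr_trans[OF fr_trans[OF f1(3) f2(3), of prep_regs] f3(3), of prep_regs] f4(3)]) auto
            then have "fr prep_regs M (M4(-18 := 64))" by (intro frI) auto
            then show ?thesis by (rule fr_trans[OF _ f5(3)]) auto
          qed
          have v5: "M5 (-10) = int m" "M5 (-17) = int (N * q)" "M5 (-3) = int q" "M5 (-8) = int N"
            "M5 (-2) = M (-2)" "M5 (-6) = M (-6)"
            using f5(2) f4(2) v3 frD[OF f5(3)] frD[OF f4(3)] frD[OF f3(3)] frD[OF f2(3)] frD[OF f1(3)] v1 q N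
            by (simp_all add: m power4_eq_xxxx)
          show ?case
          proof (rule run_MUL[where l = "N * q"], goal_cases)
            case (5 t6 M6)
            note f6 = 5
            have v6: "M6 (-3) = int q" "M6 (-17) = int (N * q)" using frD[OF f6(3)] v5 by simp_all
            show ?case
            proof (rule run_MUL[where l = q], goal_cases)
              case (5 t7 M7)
              note f7 = 5
              have "fr prep_regs M M7"
                by (rule fr_trans[OF fr_trans[OF fr5 f6(3), of prep_regs] f7(3)]) auto
              then have "fr prep_regs M (M7(-1 := 1, -9 := M7 (-9) + 1))" by (intro frI) auto
              moreover have "t1 + (t2 + (t3 + (t4 + (1 + (t5 + (t6 + (t7 + 2))))))) \<le> 4 * (q + r + Z + Z * Z + 64 + N * q + q) + 31"
                using f1(1) f2(1) f3(1) f4(1) f5(1) f6(1) f7(1) by (simp add: algebra_simps)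
              ultimately show ?case
                using v5 v6 f6(2) f7(2) frD[OF f6(3)] frD[OF f7(3)] by (auto intro!: Q)
            qed (use v6 in auto)
          qed (use v5 in auto)
        qed auto
      qed (use v3 in auto)
    qed (use v2 in auto)
  qed (use v1 in auto)
qed (use q in auto)

definition LEARN :: com where
  "LEARN = (PREP_ACCURACY ;; PREP_DEGREE ;; PREP_CONFIDENCE ;; PREP_DIMENSION ;; PREP_SIZES ;; READ ;; TRAIN)"

section \<open>Time bounds as powers of Z\<close>

lemma prep_time_le:
  fixes n d N q r Z e :: nat
  assumes d: "d \<le> N" and nd: "n * d \<le> N * N" and e: "e \<le> q" and r: "1 \<le> r" and q: "1 \<le> q" and N: "1 \<le> N"
    and Z: "Z = N * q * r"
  shows "(7 * e + 9) + (10 * d + 17) + (7 * r + 9) + ((4 * n + 13) * d + 8) + (4 * (q + r + Z + Z * Z + 64 + N * q + q) + 31) \<le> 400 * Z ^ 2"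
proof -
  have 1: "N \<le> Z" "q \<le> Z" "r \<le> Z" "N * q \<le> Z" "1 \<le> Z" unfolding Z using N q r by auto
  have 2: "Z \<le> Z * Z" "1 \<le> Z * Z" "N * N \<le> Z * Z" using 1 by (auto intro: mult_mono)
  have "(4 * n + 13) * d = 4 * (n * d) + 13 * d" by (simp add: add_mult_distrib)
  then have "(4 * n + 13) * d \<le> 4 * (Z * Z) + 13 * (Z * Z)" using d nd 1 2 by linarith
  moreover have "7 * e + 9 + (10 * d + 17) + (7 * r + 9) + (X + 8) + (4 * (q + r + Z + Y + 64 + P + q) + 31) \<le> 400 * Y"
    if "X \<le> 4 * Y + 13 * Y" "Z \<le> Y" "1 \<le> Y" "P \<le> Z" for X Y P
  proof -
    have "7 * e \<le> 7 * Y" "10 * d \<le> 10 * Y" "7 * r \<le> 7 * Y" "q \<le> Y" "r \<le> Y" "Z \<le> Y" "P \<le> Y"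
      using that 1 d e by simp_all
    then show ?thesis using that(1,3) by simp
  qed
  ultimately show ?thesis using 1 2 unfolding power2_eq_square by blast
qed

text \<open>The hypothesis concerns \<open>n * d\<close> and not \<open>n\<close>: for degree 0
  there is a single feature while \<open>n\<close> is arbitrary, and then the factor
  \<open>d\<close> makes the term vanish.\<close>

lemma feat_time_le:
  fixes n d N Z :: nat
  assumes d: "d \<le> N" and nd: "n * d \<le> N * N" and N: "1 \<le> N" "N \<le> Z"
  shows "(14 * N * n + 11 * n + 9) * d \<le> 34 * Z ^ 3"
proof -
  have Z: "1 \<le> Z" using N by simp
  have "(14 * N * n + 11 * n + 9) * d = 14 * N * (n * d) + 11 * (n * d) + 9 * d" by (simp add: algebra_simps)
  also have "\<dots> \<le> 14 * N * (N * N) + 11 * (N * N) + 9 * N" using d nd by (intro add_mono mult_left_mono) auto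
  also have "\<dots> \<le> 14 * Z * (Z * Z) + 11 * (Z * Z) + 9 * Z" using N by (intro add_mono mult_mono) auto
  also have "\<dots> \<le> 14 * Z ^ 3 + 11 * Z ^ 3 + 9 * Z ^ 3"
    using power_increasing[of 2 3 Z] power_increasing[of 1 3 Z] Z
    by (intro add_mono mult_left_mono) (auto simp: power2_eq_square power3_eq_cube)
  finally show ?thesis by simp
qed

text \<open>The threshold search dominates: \<open>T\<close> iterations times \<open>2 K\<close>
  thresholds times a pass over \<open>m\<close> predictions, of orders \<open>Z^2\<close>,
  \<open>Z^5\<close> and \<open>Z^4\<close>. This is the origin of the exponent 11.\<close>

lemma train_time_le:
  fixes N q r Z m K T :: nat
  assumes r: "1 \<le> r" and q: "1 \<le> q" and N: "1 \<le> N" and Z: "Z = N * q * r"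
    and m: "m = 64 * Z ^ 4" and K: "K = m * N * q" and T: "T = N * q * q + 1"
  shows "((12 * N + 11) * m + (14 * m + 9 * N + 22) * (2 * K) + (12 * N + 17) * m + 20) * T + 5 \<le> 250000 * Z ^ 11"
proof -
  have 1: "N \<le> Z" "q \<le> Z" "N * q \<le> Z" "1 \<le> Z" unfolding Z using N q r by auto
  have K': "K \<le> 64 * Z ^ 4 * Z" unfolding K m mult.assoc using 1 by (intro mult_mono) auto
  have T': "T \<le> 2 * Z ^ 2"
  proof -
    have "N * q * q \<le> Z * Z" using 1 by (intro mult_mono) auto
    moreover have "1 \<le> Z * Z" using 1 by simp
    ultimately show ?thesis unfolding T power2_eq_square by linarith
  qed
  have p: "Z ^ k \<le> Z ^ l" if "k \<le> l" for k l using that 1 by (intro power_increasing) auto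
  have "(12 * N + 11) * m \<le> (12 * Z + 11 * Z) * m" using 1 by (intro mult_right_mono add_mono) auto
  also have "\<dots> = 1472 * Z ^ 5" by (simp add: m power_eq_if)
  also have "\<dots> \<le> 1472 * Z ^ 9" by (intro mult_left_mono p) auto
  finally have a: "(12 * N + 11) * m \<le> 1472 * Z ^ 9" .
  have "(12 * N + 17) * m \<le> (12 * Z + 17 * Z) * m" using 1 by (intro mult_right_mono add_mono) auto
  also have "\<dots> = 1856 * Z ^ 5" by (simp add: m power_eq_if)
  also have "\<dots> \<le> 1856 * Z ^ 9" by (intro mult_left_mono p) auto
  finally have b: "(12 * N + 17) * m \<le> 1856 * Z ^ 9" .
  have "14 * m + 9 * N + 22 \<le> 14 * (64 * Z ^ 4) + 9 * Z ^ 4 + 22 * Z ^ 4"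
    using p[of 1 4] p[of 0 4] 1 unfolding m by (intro add_mono) auto
  then have "(14 * m + 9 * N + 22) * (2 * K) \<le> (927 * Z ^ 4) * (2 * (64 * Z ^ 4 * Z))"
    using K' by (intro mult_mono) auto
  also have "\<dots> = 118656 * Z ^ 9" by (simp add: power_eq_if)
  finally have c: "(14 * m + 9 * N + 22) * (2 * K) \<le> 118656 * Z ^ 9" .
  have "(12 * N + 11) * m + (14 * m + 9 * N + 22) * (2 * K) + (12 * N + 17) * m + 20 \<le>
      1472 * Z ^ 9 + 118656 * Z ^ 9 + 1856 * Z ^ 9 + 20 * Z ^ 9"
    by (intro add_mono a b c) (use p[of 0 9] in simp)
  also have "\<dots> = 122004 * Z ^ 9" by simp
  finally have "((12 * N + 11) * m + (14 * m + 9 * N + 22) * (2 * K) + (12 * N + 17) * m + 20) * T \<le> 122004 * Z ^ 9 * (2 * Z ^ 2)"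
    using T' by (intro mult_mono) auto
  also have "\<dots> = 244008 * Z ^ 11" by (simp add: power_add[symmetric])
  finally show ?thesis using p[of 0 11] by simp
qed

text \<open>The hypothesis exists only as final memory content, so the statement about the
  evaluation program is part of the postcondition of the learner.\<close>

lemma run_LEARN:
  fixes n :: nat and v :: "param \<Rightarrow> real" and S :: "example list"
  defines "d \<equiv> degr (v Eps) (v Sig)" and "q \<equiv> 2 ^ eps_exp (v Eps)" and "r \<equiv> del_exp (v Del)"
  defines "N \<equiv> (n + 1) ^ d"
  defines "Z \<equiv> N * q * r"
  defines "m \<equiv> 64 * Z ^ 4"
  defines "K \<equiv> m * N * q" and "T \<equiv> N * q * q + 1"
  defines "F \<equiv> \<lambda>i. feat n d (fst (S ! i))" and "y \<equiv> \<lambda>i. snd (S ! i)"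
  assumes v: "v Eps > 0" "v Sig > 0" "v Del > 0" and n: "n \<ge> 1"
    and S: "length S = m" "\<And>i j. i < m \<Longrightarrow> j < n \<Longrightarrow> fst (S ! i) j \<in> {1, -1}" "\<And>i. i < m \<Longrightarrow> snd (S ! i) \<in> {1, -1}"
  shows "run n v LEARN (init_memory n) S (\<lambda>t M I. t \<le> 300000 * Z ^ 11 \<and>
    (\<exists>W \<theta>. (\<forall>k<N. \<bar>W k\<bar> \<le> int (T * m)) \<and> \<bar>\<theta>\<bar> \<le> int K \<and>
      (\<forall>s<T. \<forall>\<theta>'. - int K \<le> \<theta>' \<and> \<theta>' < int K \<longrightarrow>
         nerr m N F y W \<theta> \<le> nerr m N F y (descent m N (int K) F y s) \<theta>') \<and>
      (\<forall>x. (\<forall>j<n. x j \<in> {1, -1}) \<longrightarrow> run n v EVAL M [(x, 1)] (\<lambda>t M' I'. t \<le> 300000 * Z ^ 11 \<and>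
         M' 0 = sg (dot N W (feat n d x) - \<theta>)))))"
proof -
  have N1: "1 \<le> N" and q1: "1 \<le> q" and r1: "1 \<le> r" by (simp_all add: N_def q_def r_def del_exp_def)
  have dN: "d \<le> N"
  proof -
    have "d < 2 ^ d" by (rule less_exp)
    also have "\<dots> \<le> N" unfolding N_def using n by (intro power_mono) auto
    finally show ?thesis by simp
  qed
  have ndN: "n * d \<le> N * N"
  proof (cases d)
    case (Suc k)
    have "n \<le> n + 1" by simp
    also have "\<dots> = (n + 1) ^ 1" by simp
    also have "\<dots> \<le> N" unfolding N_def using Suc by (intro power_increasing) auto
    finally show ?thesis using dN by (intro mult_mono) auto
  qed simp
  have eq: "eps_exp (v Eps) \<le> q" unfolding q_def by (rule less_imp_le, rule less_exp)
  have NZ: "N \<le> Z" and Z1: "1 \<le> Z" unfolding Z_def using N1 q1 r1 by auto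
  note feat = feat_time_le[OF dN ndN N1 NZ]
  note prep = prep_time_le[OF dN ndN eq r1 q1 N1 Z_def[THEN meta_eq_to_obj_eq]]
  note train = train_time_le[OF r1 q1 N1 Z_def[THEN meta_eq_to_obj_eq] m_def[THEN meta_eq_to_obj_eq] K_def[THEN meta_eq_to_obj_eq] T_def[THEN meta_eq_to_obj_eq]]
  have p: "Z ^ k \<le> Z ^ l" if "k \<le> l" for k l using that Z1 by (intro power_increasing) auto
  have read: "((14 * N * n + 11 * n + 9) * d + 18) * m + 5 \<le> 3400 * Z ^ 7"
  proof -
    have "((14 * N * n + 11 * n + 9) * d + 18) * m \<le> (34 * Z ^ 3 + 18 * Z ^ 3) * m"
      using feat p[of 0 3] by (intro mult_right_mono add_mono) auto
    also have "\<dots> = 3328 * Z ^ 7" by (simp add: m_def power_add[symmetric])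
    finally show ?thesis using p[of 0 7] by simp
  qed
  have F1: "F i k \<in> {1, -1}" if "i < m" "k < N" for i k
    unfolding F_def using feat_sign S(2)[OF that(1)] that(2) unfolding N_def by blast
  show ?thesis unfolding LEARN_def run_SEQ
  proof (rule run_PREP_ACCURACY, goal_cases)
    case (3 t1 M1)
    note s1 = 3
    show ?case
    proof (rule run_PREP_DEGREE, goal_cases)
      case (3 t2 M2)
      note s2 = 3
      show ?case
      proof (rule run_PREP_CONFIDENCE, goal_cases)
        case (2 t3 M3)
        note s3 = 2
        show ?case
        proof (rule run_PREP_DIMENSION[where n = n and d = d], goal_cases)
          case (3 t4 M4)
          note s4 = 3
          show ?case
          proof (rule run_PREP_SIZES[where q = q and r = r and N = N and Z = Z and m = m], goal_cases)
            case (6 t5 M5)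
            note s5 = 6
            have f5: "fr prep_regs (init_memory n) M5"
              using s1(5) s2(5) s3(6) s4(7) s5(8) by (auto simp: fr_def)
            have v5: "M5 (-2) = int n" "M5 (-6) = int d" "M5 (-10) = int m" "M5 (-8) = int N" "M5 (-11) = int K" "M5 (-9) = int T"
              using s1 s2 s3 s4 s5 by (simp_all add: d_def K_def T_def)
            have t5: "t1 + t2 + t3 + t4 + t5 \<le> 400 * Z ^ 2"
              using s1(1) s2(1) s3(1) s4(1) s5(1) prep unfolding d_def r_def by linarith
            show ?case
            proof (rule run_READ[where d = d and m = m and N = N], goal_cases)
              case (7 t6 M6)
              note s6 = 7
              have v6: "M6 (-2) = int n" "M6 (-6) = int d" "M6 (-10) = int m" "M6 (-8) = int N" "M6 (-11) = int K" "M6 (-9) = int T"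
                using v5 frD[OF s6(4)] by (auto simp: image_iff)
              have D6: "data m N F y M6" using s6(2,3) v6 by (simp add: data_def F_def y_def)
              have z6: "M6 (arr 1 k) = 0" "M6 (arr 2 k) = 0" "M6 (-48) = 0" for k
                using frD[OF s6(4)] frD[OF f5] by (auto simp: image_iff init_memory_def)
              show ?case
              proof (rule run_TRAIN[OF D6 F1 _ v6(5,6) z6], goal_cases)
                case (4 t7 M7 W \<theta>)
                note s7 = 4
                have v7: "M7 (-2) = int n" "M7 (-6) = int d" "M7 (-8) = int N"
                  using v6 frD[OF s7(7)] by (auto simp: image_iff)
                have ev: "run n v EVAL M7 [(x, 1)] (\<lambda>t M' I'. t \<le> 300000 * Z ^ 11 \<and> M' 0 = sg (dot N W (feat n d x) - \<theta>))"
                  if x: "\<forall>j<n. x j \<in> {1, -1}" for x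
                proof -
                  have "(14 * N * n + 11 * n + 9) * d + 12 * N + 20 \<le> 300000 * Z ^ 11"
                    using feat NZ p[of 3 11] p[of 1 11] p[of 0 11] by simp
                  then show ?thesis using x
                    by (intro run_mono[OF run_EVAL[where d = d and W = W and \<theta> = \<theta>]]) (use v7 s7(2,3) in \<open>auto simp: N_def\<close>)
                qed
                have "t1 + (t2 + (t3 + (t4 + (t5 + (t6 + t7))))) \<le> 300000 * Z ^ 11"
                  using t5 s6(1) s7(1) read train p[of 2 11] p[of 7 11] by linarith
                with s7(4,5,6) ev show ?case
                  by (intro conjI exI[of _ W] exI[of _ \<theta>]) blast+
              qed (use S in \<open>auto simp: y_def\<close>)
            qed (use v5 S in \<open>auto simp: N_def\<close>)
          qed (use s1 s2 s3 s4 in \<open>auto simp: q_def r_def N_def Z_def m_def\<close>)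
        qed (use s1 s2 s3 in \<open>auto simp: d_def\<close>)
      qed (use v in auto)
    qed (use v s1 in auto)
  qed (use v in \<open>auto simp: init_memory_def\<close>)
qed

section \<open>Low-degree approximation of smoothed functions\<close>

lemma finite_cube [simp]: "finite (cube n)"
  by (simp add: cube_def finite_PiE)

lemma card_cube: "card (cube n) = 2 ^ n"
  by (simp add: cube_def card_PiE numeral_2_eq_2)

lemma cube_coord: "x \<in> cube n \<Longrightarrow> i < n \<Longrightarrow> x i \<in> {1, -1}"
  by (auto simp: cube_def PiE_def Pi_def)

definition avg :: "nat \<Rightarrow> (point \<Rightarrow> real) \<Rightarrow> real" where
  "avg n g = (\<Sum>x\<in>cube n. g x) / 2 ^ n"

definition chi :: "nat set \<Rightarrow> point \<Rightarrow> real" where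
  "chi S x = (\<Prod>i\<in>S. real_of_int (x i))"

lemma sum_cube_prod: "(\<Sum>x\<in>cube n. \<Prod>i<n. g i (x i)) = (\<Prod>i<n. g i (-1) + g i 1 :: real)"
  unfolding cube_def by (subst prod_sum_PiE[symmetric]) auto

lemma chi_prod: "S \<subseteq> {..<n} \<Longrightarrow> chi S x = (\<Prod>i<n. if i \<in> S then real_of_int (x i) else 1)"
  unfolding chi_def by (simp add: prod.If_cases Int_absorb1)

text \<open>The average factorises over the coordinates, and a coordinate lying in exactly one of
  the two sets contributes the factor \<open>-1 + 1\<close>.\<close>

lemma avg_chi_chi:
  assumes "S \<subseteq> {..<n}" "R \<subseteq> {..<n}"
  shows "avg n (\<lambda>x. chi S x * chi R x) = (if S = R then 1 else 0)"
proof -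
  let ?g = "\<lambda>i a. (if i \<in> S then real_of_int a else 1) * (if i \<in> R then real_of_int a else 1)"
  have "(\<Sum>x\<in>cube n. chi S x * chi R x) = (\<Sum>x\<in>cube n. \<Prod>i<n. ?g i (x i))"
    unfolding chi_prod[OF assms(1)] chi_prod[OF assms(2)] prod.distrib ..
  also have "\<dots> = (\<Prod>i<n. ?g i (-1) + ?g i 1)" by (rule sum_cube_prod)
  also have "\<dots> = (if S = R then 2 ^ n else 0)"
  proof (cases "S = R")
    case True
    have "(\<Prod>i<n. ?g i (-1) + ?g i 1) = (\<Prod>i<n. 2)" by (rule prod.cong) (auto simp: True)
    then show ?thesis using True by simp
  next
    case False
    then obtain i where "i < n" "(i \<in> S) \<noteq> (i \<in> R)" using assms by blast
    then have "?g i (-1) + ?g i 1 = 0" by auto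
    then have "(\<Prod>i<n. ?g i (-1) + ?g i 1) = 0" using \<open>i < n\<close> by (intro prod_zero bexI[of _ i]) auto
    then show ?thesis using False by simp
  qed
  finally show ?thesis by (simp add: avg_def)
qed

lemma avg_sum: "avg n (\<lambda>x. \<Sum>S\<in>A. g S x) = (\<Sum>S\<in>A. avg n (g S))"
  unfolding avg_def by (subst sum.swap) (simp add: sum_divide_distrib)

lemma avg_scale: "avg n (\<lambda>x. c * g x) = c * avg n g"
  unfolding avg_def by (simp add: sum_distrib_left)

lemma avg_chi_square:
  assumes "A \<subseteq> Pow {..<n}"
  shows "avg n (\<lambda>x. (\<Sum>S\<in>A. c S * chi S x)\<^sup>2) = (\<Sum>S\<in>A. (c S)\<^sup>2)"
proof -
  have fin: "finite A" using assms finite_subset by blast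
  have "(\<Sum>S\<in>A. c S * chi S x)\<^sup>2 = (\<Sum>S\<in>A. \<Sum>R\<in>A. c S * c R * (chi S x * chi R x))" for x
    unfolding power2_eq_square sum_product by (simp add: algebra_simps)
  then have "avg n (\<lambda>x. (\<Sum>S\<in>A. c S * chi S x)\<^sup>2) = (\<Sum>S\<in>A. \<Sum>R\<in>A. c S * c R * avg n (\<lambda>x. chi S x * chi R x))"
    by (simp add: avg_sum avg_scale)
  also have "\<dots> = (\<Sum>S\<in>A. \<Sum>R\<in>A. if S = R then c S * c R else 0)"
    by (intro sum.cong refl, subst avg_chi_chi) (use assms in auto)
  also have "\<dots> = (\<Sum>S\<in>A. (c S)\<^sup>2)" using fin by (simp add: power2_eq_square)
  finally show ?thesis .
qed

lemma avg_abs_le_sqrt: "avg n (\<lambda>x. \<bar>g x\<bar>) \<le> sqrt (avg n (\<lambda>x. (g x)\<^sup>2))"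
proof (rule real_le_rsqrt)
  have "(\<Sum>x\<in>cube n. \<bar>g x\<bar>)\<^sup>2 \<le> (\<Sum>x\<in>cube n. (g x)\<^sup>2) * card (cube n)"
    using sum_squared_le_sum_of_squares[of "\<lambda>x. \<bar>g x\<bar>" "cube n"] by simp
  then show "(avg n (\<lambda>x. \<bar>g x\<bar>))\<^sup>2 \<le> avg n (\<lambda>x. (g x)\<^sup>2)"
    by (simp add: avg_def card_cube power_divide divide_le_eq field_simps power2_eq_square)
qed

section \<open>Fourier coefficients and the noise operator\<close>

definition fhat :: "nat \<Rightarrow> (point \<Rightarrow> real) \<Rightarrow> nat set \<Rightarrow> real" where
  "fhat n f S = avg n (\<lambda>x. f x * chi S x)"

text \<open>The squared distance of \<open>f\<close> from its Fourier expansion is nonnegative; by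
  orthonormality the cross term and the square term are the same sum.\<close>

lemma bessel: "(\<Sum>S\<in>Pow {..<n}. (fhat n f S)\<^sup>2) \<le> avg n (\<lambda>x. (f x)\<^sup>2)"
proof -
  let ?p = "\<lambda>x. \<Sum>S\<in>Pow {..<n}. fhat n f S * chi S x"
  have "0 \<le> avg n (\<lambda>x. (f x - ?p x)\<^sup>2)" unfolding avg_def by (simp add: sum_nonneg)
  also have "\<dots> = avg n (\<lambda>x. (f x)\<^sup>2) - 2 * avg n (\<lambda>x. f x * ?p x) + avg n (\<lambda>x. (?p x)\<^sup>2)"
    unfolding avg_def power2_diff by (simp add: sum.distrib sum_subtractf sum_distrib_left diff_divide_distrib add_divide_distrib mult.assoc)
  also have "avg n (\<lambda>x. f x * ?p x) = (\<Sum>S\<in>Pow {..<n}. (fhat n f S)\<^sup>2)"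
  proof -
    have "f x * ?p x = (\<Sum>S\<in>Pow {..<n}. fhat n f S * (f x * chi S x))" for x
      by (simp add: sum_distrib_left algebra_simps)
    then show ?thesis by (simp add: avg_sum avg_scale fhat_def power2_eq_square)
  qed
  also have "avg n (\<lambda>x. (?p x)\<^sup>2) = (\<Sum>S\<in>Pow {..<n}. (fhat n f S)\<^sup>2)" by (rule avg_chi_square) simp
  finally show ?thesis by simp
qed

definition smooth :: "nat \<Rightarrow> real \<Rightarrow> (point \<Rightarrow> real) \<Rightarrow> point \<Rightarrow> real" where
  "smooth n \<sigma> f x = measure_pmf.expectation (noise n \<sigma>) (\<lambda>z. f (hadamard n x z))"

lemma set_noise: "set_pmf (noise n \<sigma>) \<subseteq> cube n"
  unfolding noise_def by (subst set_Pi_pmf) (auto simp: PiE_dflt_def cube_def PiE_def extensional_def)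

text \<open>The probabilities \<sigma> and \<open>1 - \<sigma>\<close> are written as one affine
  function of \<open>z i\<close>, so that the product can later be expanded over subsets of the
  coordinates.\<close>

lemma pmf_noise:
  assumes "0 < \<sigma>" "\<sigma> < 1/2" "z \<in> cube n"
  shows "pmf (noise n \<sigma>) z = (\<Prod>i<n. (1 + (1 - 2 * \<sigma>) * real_of_int (z i)) / 2)"
proof -
  have *: "pmf (map_pmf (\<lambda>b. if b then - 1 else 1) (bernoulli_pmf \<sigma>)) (z i) = (1 + (1 - 2 * \<sigma>) * real_of_int (z i)) / 2"
    if "i < n" for i
  proof -
    have inj: "inj (\<lambda>b. if b then - 1 else (1::int))" by (auto simp: inj_def)
    have "pmf (map_pmf (\<lambda>b. if b then - 1 else 1) (bernoulli_pmf \<sigma>)) ((\<lambda>b. if b then - 1 else (1::int)) c) = pmf (bernoulli_pmf \<sigma>) c" for c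
      by (rule pmf_map_inj'[OF inj])
    from this[of True] this[of False] show ?thesis
      using cube_coord[OF assms(3) that] assms(1,2) by (auto simp: field_simps)
  qed
  have "pmf (noise n \<sigma>) z = (\<Prod>i<n. pmf (map_pmf (\<lambda>b. if b then - 1 else 1) (bernoulli_pmf \<sigma>)) (z i))"
    unfolding noise_def using assms(3) by (intro pmf_Pi') (auto simp: cube_def PiE_def extensional_def)
  also have "\<dots> = (\<Prod>i<n. (1 + (1 - 2 * \<sigma>) * real_of_int (z i)) / 2)"
    by (intro prod.cong refl *) simp
  finally show ?thesis .
qed

lemma hadamard_cube:
  assumes "x \<in> cube n" "z \<in> cube n"
  shows "hadamard n x z \<in> cube n"
proof -
  have "x i * z i \<in> {-1, 1}" if "i < n" for i
    using cube_coord[OF assms(1) that] cube_coord[OF assms(2) that] by auto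
  then show ?thesis by (simp add: cube_def hadamard_def)
qed

lemma hadamard_hadamard:
  assumes "x \<in> cube n" "z \<in> cube n"
  shows "hadamard n x (hadamard n x z) = z"
proof
  fix i
  show "hadamard n x (hadamard n x z) i = z i"
    using assms(2) cube_coord[OF assms(1), of i]
    by (cases "i < n") (auto simp: hadamard_def cube_def PiE_def extensional_def)
qed

text \<open>The involution taking \<open>z\<close> to \<open>w = hadamard n x z\<close> moves the
  noise into a kernel in \<open>x\<close> and \<open>w\<close>. Expanding this product over subsets
  gives the characters, with one factor \<open>1 - 2 * \<sigma>\<close> for each element of
  \<open>S\<close>.\<close>

lemma smooth_fourier:
  assumes s: "0 < \<sigma>" "\<sigma> < 1/2" and x: "x \<in> cube n"
  shows "smooth n \<sigma> f x = (\<Sum>S\<in>Pow {..<n}. (1 - 2 * \<sigma>) ^ card S * fhat n f S * chi S x)"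
proof -
  let ?r = "1 - 2 * \<sigma>"
  have "smooth n \<sigma> f x = (\<Sum>z\<in>cube n. f (hadamard n x z) * pmf (noise n \<sigma>) z)"
    unfolding smooth_def by (rule integral_measure_pmf_real) (use set_noise in auto)
  also have "\<dots> = (\<Sum>w\<in>cube n. f w * pmf (noise n \<sigma>) (hadamard n x w))"
    by (rule sum.reindex_bij_witness[of _ "hadamard n x" "hadamard n x"])
      (use x in \<open>auto simp: hadamard_cube hadamard_hadamard\<close>)
  also have "\<dots> = (\<Sum>w\<in>cube n. \<Sum>S\<in>Pow {..<n}. ?r ^ card S * chi S x * (f w * chi S w) / 2 ^ n)"
  proof (rule sum.cong[OF refl])
    fix w assume w: "w \<in> cube n"
    have "pmf (noise n \<sigma>) (hadamard n x w) = (\<Prod>i<n. (1 + ?r * real_of_int (x i * w i)) / 2)"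
      by (subst pmf_noise[OF s hadamard_cube[OF x w]]) (auto simp: hadamard_def)
    also have "\<dots> = (\<Prod>i<n. 1 + ?r * real_of_int (x i * w i)) / 2 ^ n"
      by (simp add: prod_dividef)
    also have "(\<Prod>i<n. 1 + ?r * real_of_int (x i * w i)) = (\<Prod>i<n. ?r * real_of_int (x i * w i) + 1)"
      by (simp add: add.commute)
    also have "\<dots> = (\<Sum>S\<in>Pow {..<n}. (\<Prod>i\<in>S. ?r * real_of_int (x i * w i)) * (\<Prod>i\<in>{..<n} - S. 1))"
      by (rule prod_add) simp
    also have "\<dots> = (\<Sum>S\<in>Pow {..<n}. ?r ^ card S * chi S x * chi S w)"
      by (simp add: prod.distrib chi_def mult.assoc)
    finally show "f w * pmf (noise n \<sigma>) (hadamard n x w) = (\<Sum>S\<in>Pow {..<n}. ?r ^ card S * chi S x * (f w * chi S w) / 2 ^ n)"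
      by (simp add: sum_distrib_left sum_divide_distrib algebra_simps)
  qed
  also have "\<dots> = (\<Sum>S\<in>Pow {..<n}. ?r ^ card S * chi S x * fhat n f S)"
    by (subst sum.swap) (simp add: fhat_def avg_def sum_divide_distrib sum_distrib_left)
  finally show ?thesis by (simp add: algebra_simps)
qed

lemma feat_chi:
  assumes "S \<subseteq> {..<n}" "card S \<le> d"
  shows "\<exists>k<(n + 1) ^ d. \<forall>x. real_of_int (feat n d x k) = chi S x"
  using assms
proof (induction d arbitrary: S)
  case 0
  then have "S = {}" using finite_subset by fastforce
  then show ?case by (simp add: chi_def)
next
  case (Suc d)
  let ?L = "(n + 1) ^ d"
  show ?case
  proof (cases "card S \<le> d")
    case True
    then obtain k where k: "k < ?L" "\<And>x. real_of_int (feat n d x k) = chi S x" using Suc by blast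
    \<comment> \<open>The same index serves for degree \<open>Suc d\<close>: its new leading digit
      is 0, which stands for the constant 1.\<close>
    show ?thesis by (rule exI[of _ k]) (use k in \<open>auto intro: less_le_trans\<close>)
  next
    case False
    then obtain j where j: "j \<in> S" by fastforce
    have fin: "finite S" using Suc.prems(1) finite_subset by blast
    have "card (S - {j}) \<le> d" using Suc.prems(2) j fin by (simp add: card_Diff_singleton)
    then obtain k where k: "k < ?L" "\<And>x. real_of_int (feat n d x k) = chi (S - {j}) x"
      using Suc.IH[of "S - {j}"] Suc.prems(1) by blast
    have jn: "j < n" using j Suc.prems(1) by auto
    have "(Suc j * ?L + k) div ?L = Suc j" using k(1) by (auto intro: div_nat_eqI)
    moreover have "(Suc j * ?L + k) mod ?L = k" unfolding mod_mult_self3 using k(1) by simp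
    moreover have "chi S x = real_of_int (x j) * chi (S - {j}) x" for x
      unfolding chi_def by (rule prod.remove[OF fin j])
    moreover have "Suc j * ?L + k < (n + 1) ^ Suc d"
    proof -
      have "Suc j * ?L + k < (Suc j + 1) * ?L" using k(1) by simp
      also have "\<dots> \<le> (n + 1) * ?L" using jn by (intro mult_right_mono) auto
      finally show ?thesis by simp
    qed
    ultimately show ?thesis using k(2) by (intro exI[of _ "Suc j * ?L + k"]) simp
  qed
qed

lemma smooth_approx:
  assumes s: "0 < \<sigma>" "\<sigma> < 1/2" and f: "\<And>x. x \<in> cube n \<Longrightarrow> f x \<in> {1, -1}"
  shows "\<exists>u. (\<Sum>k<(n + 1) ^ d. (u k)\<^sup>2) \<le> 1 \<and>
    avg n (\<lambda>x. \<bar>smooth n \<sigma> f x - (\<Sum>k<(n + 1) ^ d. u k * real_of_int (feat n d x k))\<bar>) \<le> (1 - 2 * \<sigma>) ^ d"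
proof -
  let ?r = "1 - 2 * \<sigma>" and ?N = "(n + 1) ^ d"
  have r: "0 < ?r" "?r < 1" using s by auto
  define A where "A = {S. S \<subseteq> {..<n} \<and> card S \<le> d}"
  define B where "B = {S. S \<subseteq> {..<n} \<and> d < card S}"
  have AB: "Pow {..<n} = A \<union> B" "A \<inter> B = {}" and fin: "finite A" "finite B"
    unfolding A_def B_def by (auto intro: finite_subset[of _ "Pow {..<n}"])
  define c where "c S = ?r ^ card S * fhat n f S" for S
  have fsq: "(\<Sum>S\<in>Pow {..<n}. (fhat n f S)\<^sup>2) \<le> 1"
  proof -
    have "avg n (\<lambda>x. (f x)\<^sup>2) = avg n (\<lambda>x. 1)" unfolding avg_def
      using f by (intro arg_cong[where f = "\<lambda>s. s / 2 ^ n"] sum.cong) (auto simp: power2_eq_1_iff)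
    also have "\<dots> = 1" by (simp add: avg_def card_cube)
    finally show ?thesis using bessel[of n f] by linarith
  qed
  \<comment> \<open>A monomial may occur under several indices. All its weight is put on one of
    them, so that the coefficient vector has the same norm as the truncated Fourier
    expansion.\<close>
  have "\<exists>\<kappa>. \<forall>S\<in>A. \<kappa> S < ?N \<and> (\<forall>x. real_of_int (feat n d x (\<kappa> S)) = chi S x)"
    using feat_chi unfolding A_def by (intro bchoice) auto
  then obtain \<kappa> where \<kappa>: "\<And>S. S \<in> A \<Longrightarrow> \<kappa> S < ?N" "\<And>S x. S \<in> A \<Longrightarrow> real_of_int (feat n d x (\<kappa> S)) = chi S x" by blast
  have inj: "inj_on \<kappa> A"
  proof (rule inj_onI, rule ccontr)
    fix S R assume a: "S \<in> A" "R \<in> A" "\<kappa> S = \<kappa> R" "S \<noteq> R"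
    have "chi S = chi R" using \<kappa>(2)[OF a(1)] \<kappa>(2)[OF a(2)] a(3) by auto
    \<comment> \<open>Orthonormality separates the characters: the left side is 0 and the right side
      is 1.\<close>
    then have "avg n (\<lambda>x. chi S x * chi R x) = avg n (\<lambda>x. chi S x * chi S x)" by simp
    then show False using a avg_chi_chi[of S n R] avg_chi_chi[of S n S] by (auto simp: A_def)
  qed
  define u where "u k = (\<Sum>S\<in>A. if \<kappa> S = k then c S else 0)" for k
  have u_\<kappa>: "u (\<kappa> S) = c S" if "S \<in> A" for S
  proof -
    have "u (\<kappa> S) = (\<Sum>R\<in>A. if R = S then c R else 0)"
      unfolding u_def by (rule sum.cong) (use inj that in \<open>auto dest: inj_onD\<close>)
    then show ?thesis using fin that by simp
  qed
  have u_0: "u k = 0" if "k \<notin> \<kappa> ` A" for k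
    unfolding u_def using that by (intro sum.neutral) auto
  have sum_u: "(\<Sum>k<?N. g k) = (\<Sum>S\<in>A. g (\<kappa> S))" if "\<And>k. k \<notin> \<kappa> ` A \<Longrightarrow> g k = 0" for g :: "nat \<Rightarrow> real"
  proof -
    have "(\<Sum>k<?N. g k) = (\<Sum>k\<in>\<kappa> ` A. g k)"
      by (rule sum.mono_neutral_right) (use \<kappa>(1) that in auto)
    then show ?thesis by (simp add: sum.reindex[OF inj])
  qed
  have poly: "(\<Sum>k<?N. u k * real_of_int (feat n d x k)) = (\<Sum>S\<in>A. c S * chi S x)" for x
    by (subst sum_u) (auto simp: u_0 u_\<kappa> \<kappa>(2) intro!: sum.cong)
  have csq: "(c S)\<^sup>2 \<le> (fhat n f S)\<^sup>2" for S
  proof -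
    have "(?r ^ card S)\<^sup>2 \<le> 1" using r by (intro power_le_one) auto
    then show ?thesis unfolding c_def power_mult_distrib by (intro mult_left_le_one_le) auto
  qed
  have "(\<Sum>k<?N. (u k)\<^sup>2) = (\<Sum>S\<in>A. (c S)\<^sup>2)" by (subst sum_u) (auto simp: u_0 u_\<kappa>)
  also have "\<dots> \<le> (\<Sum>S\<in>A. (fhat n f S)\<^sup>2)" by (intro sum_mono csq)
  also have "\<dots> \<le> (\<Sum>S\<in>Pow {..<n}. (fhat n f S)\<^sup>2)" using AB fin by (intro sum_mono2) auto
  finally have u1: "(\<Sum>k<?N. (u k)\<^sup>2) \<le> 1" using fsq by simp
  have rest: "smooth n \<sigma> f x - (\<Sum>k<?N. u k * real_of_int (feat n d x k)) = (\<Sum>S\<in>B. c S * chi S x)" if "x \<in> cube n" for x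
    unfolding poly smooth_fourier[OF s that] AB(1) sum.union_disjoint[OF fin AB(2)] by (simp add: c_def)
  have "avg n (\<lambda>x. \<bar>smooth n \<sigma> f x - (\<Sum>k<?N. u k * real_of_int (feat n d x k))\<bar>) = avg n (\<lambda>x. \<bar>\<Sum>S\<in>B. c S * chi S x\<bar>)"
    unfolding avg_def by (intro arg_cong[where f = "\<lambda>s. s / 2 ^ n"] sum.cong refl) (simp only: rest)
  also have "\<dots> \<le> sqrt (\<Sum>S\<in>B. (c S)\<^sup>2)"
    using avg_abs_le_sqrt[of n "\<lambda>x. \<Sum>S\<in>B. c S * chi S x"] AB by (subst avg_chi_square[symmetric]) auto
  also have "\<dots> \<le> sqrt ((?r ^ d)\<^sup>2)"
  proof (rule real_sqrt_le_mono)
    have "(\<Sum>S\<in>B. (c S)\<^sup>2) \<le> (\<Sum>S\<in>B. (?r ^ d)\<^sup>2 * (fhat n f S)\<^sup>2)"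
      unfolding c_def power_mult_distrib
      using r by (intro sum_mono mult_right_mono power_mono power_decreasing) (auto simp: B_def)
    also have "\<dots> = (?r ^ d)\<^sup>2 * (\<Sum>S\<in>B. (fhat n f S)\<^sup>2)" by (simp add: sum_distrib_left)
    also have "\<dots> \<le> (?r ^ d)\<^sup>2 * 1"
    proof (rule mult_left_mono)
      have "(\<Sum>S\<in>B. (fhat n f S)\<^sup>2) \<le> (\<Sum>S\<in>Pow {..<n}. (fhat n f S)\<^sup>2)" using AB fin by (intro sum_mono2) auto
      then show "(\<Sum>S\<in>B. (fhat n f S)\<^sup>2) \<le> 1" using fsq by linarith
    qed simp
    finally show "(\<Sum>S\<in>B. (c S)\<^sup>2) \<le> (?r ^ d)\<^sup>2" by simp
  qed
  also have "\<dots> = ?r ^ d" using r by simp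
  finally show ?thesis using u1 by blast
qed

section \<open>Subgradient descent on the absolute loss\<close>

lemma sg_values: "sg z \<in> {1, -1}"
  by (simp add: sg_def)

lemma sg_mult_self: "sg z * z = \<bar>z\<bar>"
  by (simp add: sg_def)

text \<open>The squared distance from the iterate to \<open>K u\<close> drops by \<open>m\<^sup>2 N\<close> in every step in which the
  scaled empirical loss exceeds that of \<open>u\<close> by more than \<open>m\<^sup>2 N\<close>.\<close>

lemma descent_loss:
  fixes u :: "nat \<Rightarrow> real" and m N q :: nat
  defines "K \<equiv> m * N * q"
  assumes F: "\<And>i k. i < m \<Longrightarrow> k < N \<Longrightarrow> F i k \<in> {1, -1}"
    and y: "\<And>i. i < m \<Longrightarrow> y i \<in> {1, -1}"
    and u: "(\<Sum>k<N. (u k)\<^sup>2) \<le> 1" and pos: "m > 0" "N > 0"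
  shows "\<exists>t<N * q * q + 1. (\<Sum>i<m. \<bar>real_of_int (int K * y i - dot N (descent m N (int K) F y t) (F i))\<bar>)
     \<le> real K * (\<Sum>i<m. \<bar>real_of_int (y i) - (\<Sum>k<N. u k * real_of_int (F i k))\<bar>) + real m * real m * real N"
proof (rule ccontr)
  let ?T = "N * q * q + 1" and ?D = "descent m N (int K) F y"
  define a where "a i = (\<Sum>k<N. u k * real_of_int (F i k))" for i
  define s where "s t i = sg (int K * y i - dot N (?D t) (F i))" for t i
  define G where "G t k = (\<Sum>i<m. real_of_int (s t i) * real_of_int (F i k))" for t k
  define loss where "loss t = (\<Sum>i<m. \<bar>real_of_int (int K * y i - dot N (?D t) (F i))\<bar>)" for t
  define L where "L = (\<Sum>i<m. \<bar>real_of_int (y i) - a i\<bar>)"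
  define pot where "pot t = (\<Sum>k<N. (real_of_int (?D t k) - real K * u k)\<^sup>2)" for t
  assume neg: "\<not> (\<exists>t<?T. (\<Sum>i<m. \<bar>real_of_int (int K * y i - dot N (?D t) (F i))\<bar>)
     \<le> real K * (\<Sum>i<m. \<bar>real_of_int (y i) - (\<Sum>k<N. u k * real_of_int (F i k))\<bar>) + real m * real m * real N)"
  have big: "real K * L + real m * real m * real N < loss t" if "t < ?T" for t
    using neg that unfolding loss_def L_def a_def by (auto simp: not_le)
  have D_Suc: "real_of_int (?D (Suc t) k) = real_of_int (?D t k) + G t k" for t k
    by (simp add: G_def s_def)
  have Gsq: "(\<Sum>k<N. (G t k)\<^sup>2) \<le> real m * real m * real N" for t
  proof -
    have "(G t k)\<^sup>2 \<le> real m * real m" if "k < N" for k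
    proof -
      have "\<bar>G t k\<bar> \<le> (\<Sum>i<m. \<bar>real_of_int (s t i) * real_of_int (F i k)\<bar>)" unfolding G_def by (rule sum_abs)
      also have "\<dots> \<le> (\<Sum>i<m. 1)"
      proof (rule sum_mono)
        fix i assume "i \<in> {..<m}"
        then show "\<bar>real_of_int (s t i) * real_of_int (F i k)\<bar> \<le> 1"
          using F[of i k] that sg_values[of "int K * y i - dot N (?D t) (F i)"] by (auto simp: s_def)
      qed
      finally have "\<bar>G t k\<bar> \<le> real m" by simp
      then have "\<bar>G t k\<bar> * \<bar>G t k\<bar> \<le> real m * real m" by (intro mult_mono) auto
      then show ?thesis by (simp add: power2_eq_square abs_mult_self_eq)
    qed
    then have "(\<Sum>k<N. (G t k)\<^sup>2) \<le> (\<Sum>k<N. real m * real m)" by (intro sum_mono) auto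
    then show ?thesis by (simp add: mult.commute)
  qed
  \<comment> \<open>The subgradient inequality: moving towards \<open>K u\<close> lowers the loss at
    least to first order, and \<open>K u\<close> has scaled loss \<open>K * L\<close>.\<close>
  have cross: "(\<Sum>k<N. G t k * (real_of_int (?D t k) - real K * u k)) \<le> real K * L - loss t" for t
  proof -
    have "(\<Sum>k<N. G t k * (real_of_int (?D t k) - real K * u k)) =
      (\<Sum>i<m. real_of_int (s t i) * (real_of_int (dot N (?D t) (F i)) - real K * a i))"
      unfolding G_def dot_def a_def sum_distrib_right
      by (subst sum.swap) (simp add: sum_distrib_left sum_subtractf algebra_simps)
    also have "\<dots> \<le> (\<Sum>i<m. real K * \<bar>real_of_int (y i) - a i\<bar> - \<bar>real_of_int (int K * y i - dot N (?D t) (F i))\<bar>)"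
    proof (rule sum_mono)
      fix i
      let ?z = "int K * y i - dot N (?D t) (F i)"
      have 1: "real_of_int (s t i) * real_of_int ?z = \<bar>real_of_int ?z\<bar>"
        using sg_mult_self[of ?z] unfolding s_def by (metis of_int_abs of_int_mult)
      have "real_of_int (s t i) * (real K * (real_of_int (y i) - a i)) \<le> real K * \<bar>real_of_int (y i) - a i\<bar>"
      proof -
        have "real_of_int (s t i) * (real K * (real_of_int (y i) - a i)) \<le> \<bar>real_of_int (s t i)\<bar> * \<bar>real K * (real_of_int (y i) - a i)\<bar>"
          by (metis abs_ge_self abs_mult)
        then show ?thesis using sg_values[of ?z] by (auto simp: s_def abs_mult)
      qed
      moreover have "real_of_int (s t i) * (real_of_int (dot N (?D t) (F i)) - real K * a i) =
          real_of_int (s t i) * (real K * (real_of_int (y i) - a i)) - real_of_int (s t i) * real_of_int ?z"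
        by (simp add: algebra_simps)
      ultimately show "real_of_int (s t i) * (real_of_int (dot N (?D t) (F i)) - real K * a i)
         \<le> real K * \<bar>real_of_int (y i) - a i\<bar> - \<bar>real_of_int ?z\<bar>" using 1 by linarith
    qed
    also have "\<dots> = real K * L - loss t" by (simp add: sum_subtractf sum_distrib_left L_def loss_def)
    finally show ?thesis .
  qed
  \<comment> \<open>Twice the excess loss, more than \<open>2 m^2 N\<close>, outweighs the squared
    step length, at most \<open>m^2 N\<close>.\<close>
  have step: "pot (Suc t) \<le> pot t - real m * real m * real N" if "t < ?T" for t
  proof -
    have "pot (Suc t) = (\<Sum>k<N. (real_of_int (?D t k) - real K * u k)\<^sup>2 + 2 * (G t k * (real_of_int (?D t k) - real K * u k)) + (G t k)\<^sup>2)"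
      unfolding pot_def D_Suc by (intro sum.cong refl) (simp add: power2_eq_square algebra_simps)
    also have "\<dots> = pot t + 2 * (\<Sum>k<N. G t k * (real_of_int (?D t k) - real K * u k)) + (\<Sum>k<N. (G t k)\<^sup>2)"
      by (simp add: sum.distrib sum_distrib_left pot_def)
    finally show ?thesis using cross[of t] Gsq[of t] big[OF that] by linarith
  qed
  have dec: "pot t \<le> pot 0 - real t * (real m * real m * real N)" if "t \<le> ?T" for t
    using that
  proof (induction t)
    case (Suc t)
    then show ?case using step[of t] by (simp add: algebra_simps)
  qed simp
  have "pot 0 = real K * real K * (\<Sum>k<N. (u k)\<^sup>2)"
    unfolding pot_def by (simp add: power_mult_distrib sum_distrib_left power2_eq_square algebra_simps)
  also have "\<dots> \<le> real K * real K * 1" using u by (intro mult_left_mono) auto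
  finally have "pot ?T \<le> real K * real K - real ?T * (real m * real m * real N)" using dec[of ?T] by simp
  \<comment> \<open>The initial potential is at most \<open>K^2 = N q^2 * (m^2 N)\<close>, so
    \<open>N q^2\<close> steps exhaust it and the one extra step makes it negative.\<close>
  also have "\<dots> = - (real m * real m * real N)" by (simp add: K_def algebra_simps)
  also have "\<dots> < 0" using pos by simp
  finally have "pot ?T < 0" .
  moreover have "0 \<le> pot t" for t unfolding pot_def by (intro sum_nonneg) simp
  ultimately show False using not_less by blast
qed

text \<open>The thresholds that err form one half-open interval, between \<open>g\<close> and
  \<open>K\<close> for label 1 and between \<open>-K\<close> and \<open>g\<close> for label -1. Its
  length is at most the scaled loss, also when \<open>g\<close> lies outside
  \<open>[-K, K)\<close>.\<close>

lemma card_threshold_errors: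
  assumes "y \<in> {1, -1 :: int}"
  shows "real (card {\<theta> \<in> {- int K..<int K}. sg (g - \<theta>) \<noteq> y}) \<le> \<bar>real_of_int (int K * y - g)\<bar>"
proof -
  consider "y = 1" | "y = -1" using assms by auto
  then have "card {\<theta> \<in> {- int K..<int K}. sg (g - \<theta>) \<noteq> y} \<le> nat \<bar>int K * y - g\<bar>"
  proof cases
    case 1
    have "card {\<theta> \<in> {- int K..<int K}. sg (g - \<theta>) \<noteq> y} \<le> card {g..<int K}"
      by (rule card_mono) (auto simp: 1 sg_def split: if_splits)
    then show ?thesis using 1 by simp
  next
    case 2
    have "card {\<theta> \<in> {- int K..<int K}. sg (g - \<theta>) \<noteq> y} \<le> card {- int K..<g}"
      by (rule card_mono) (auto simp: 2 sg_def split: if_splits)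
    then show ?thesis using 2 by simp
  qed
  moreover have "real (nat \<bar>z\<bar>) = \<bar>real_of_int z\<bar>" for z by simp
  ultimately show ?thesis by (metis of_nat_le_iff)
qed

lemma nerr_sum: "real (nerr m N F y V \<theta>) = (\<Sum>i<m. if sg (dot N V (F i) - \<theta>) \<noteq> y i then 1 else 0)"
proof -
  have "{i. i < m \<and> sg (dot N V (F i) - \<theta>) \<noteq> y i} = {i \<in> {..<m}. sg (dot N V (F i) - \<theta>) \<noteq> y i}" by auto
  then show ?thesis unfolding nerr_def by (simp add: sum.If_cases Int_def)
qed

text \<open>Summed over the \<open>2K\<close> thresholds, the errors on an example amount to at most its scaled loss.\<close>

lemma threshold_exists:
  assumes K: "K > 0" and y: "\<And>i. i < m \<Longrightarrow> y i \<in> {1, -1}"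
  shows "\<exists>\<theta>. - int K \<le> \<theta> \<and> \<theta> < int K \<and>
    2 * real K * real (nerr m N F y V \<theta>) \<le> (\<Sum>i<m. \<bar>real_of_int (int K * y i - dot N V (F i))\<bar>)"
proof (rule ccontr)
  let ?R = "\<Sum>i<m. \<bar>real_of_int (int K * y i - dot N V (F i))\<bar>" and ?I = "{- int K..<int K}"
  assume "\<not> ?thesis"
  then have "?R / (2 * real K) < real (nerr m N F y V \<theta>)" if "\<theta> \<in> ?I" for \<theta>
    using that K by (auto simp: field_simps not_le)
  then have "(\<Sum>\<theta>\<in>?I. ?R / (2 * real K)) < (\<Sum>\<theta>\<in>?I. real (nerr m N F y V \<theta>))"
    using K by (intro sum_strict_mono) auto
  moreover have "(\<Sum>\<theta>\<in>?I. ?R / (2 * real K)) = ?R" using K by simp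
  moreover have "(\<Sum>\<theta>\<in>?I. real (nerr m N F y V \<theta>)) = (\<Sum>i<m. real (card {\<theta> \<in> ?I. sg (dot N V (F i) - \<theta>) \<noteq> y i}))"
    unfolding nerr_sum by (subst sum.swap) (simp add: sum.If_cases Int_def)
  moreover have "\<dots> \<le> ?R" by (intro sum_mono card_threshold_errors y) auto
  ultimately show False by linarith
qed

text \<open>The reason for the scale \<open>K = m N q\<close>: after division by \<open>K\<close>
  the optimisation excess \<open>m^2 N\<close> becomes \<open>m / q\<close>, that is
  \<open>1/q\<close> per example.\<close>

lemma descent_threshold:
  fixes u :: "nat \<Rightarrow> real" and m N q :: nat
  defines "K \<equiv> m * N * q"
  assumes F: "\<And>i k. i < m \<Longrightarrow> k < N \<Longrightarrow> F i k \<in> {1, -1}"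
    and y: "\<And>i. i < m \<Longrightarrow> y i \<in> {1, -1}"
    and u: "(\<Sum>k<N. (u k)\<^sup>2) \<le> 1" and pos: "m > 0" "N > 0" "q > 0"
  shows "\<exists>t<N * q * q + 1. \<exists>\<theta>. - int K \<le> \<theta> \<and> \<theta> < int K \<and>
     2 * real (nerr m N F y (descent m N (int K) F y t) \<theta>) \<le>
       (\<Sum>i<m. \<bar>real_of_int (y i) - (\<Sum>k<N. u k * real_of_int (F i k))\<bar>) + real m / real q"
proof -
  let ?D = "descent m N (int K) F y" and ?L = "\<Sum>i<m. \<bar>real_of_int (y i) - (\<Sum>k<N. u k * real_of_int (F i k))\<bar>"
  have K: "K > 0" using pos by (simp add: K_def)
  obtain t where t: "t < N * q * q + 1"
    "(\<Sum>i<m. \<bar>real_of_int (int K * y i - dot N (?D t) (F i))\<bar>) \<le> real K * ?L + real m * real m * real N"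
    using descent_loss[of m N F y u q] F y u pos unfolding K_def by auto
  obtain \<theta> where \<theta>: "- int K \<le> \<theta>" "\<theta> < int K"
    "2 * real K * real (nerr m N F y (?D t) \<theta>) \<le> (\<Sum>i<m. \<bar>real_of_int (int K * y i - dot N (?D t) (F i))\<bar>)"
    using threshold_exists[OF K, of m y N F "?D t"] y by blast
  have "real K * (2 * real (nerr m N F y (?D t) \<theta>)) \<le> real K * (?L + real m / real q)"
  proof -
    have "real K * (real m / real q) = real m * real m * real N" using pos by (simp add: K_def)
    then have "real K * (?L + real m / real q) = real K * ?L + real m * real m * real N" by (simp add: distrib_left)
    moreover have "real K * (2 * real (nerr m N F y (?D t) \<theta>)) = 2 * real K * real (nerr m N F y (?D t) \<theta>)" by simp
    ultimately show ?thesis using t(2) \<theta>(3) by linarith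
  qed
  then have "2 * real (nerr m N F y (?D t) \<theta>) \<le> ?L + real m / real q" using K by simp
  then show ?thesis using t(1) \<theta>(1,2) by blast
qed

section \<open>Concentration\<close>

text \<open>Independence of the sample makes the exponential moment a product. Nonnegative integrals
  avoid any integrability condition.\<close>

lemma nn_integral_exp_replicate:
  fixes g :: "'a \<Rightarrow> real"
  shows "(\<integral>\<^sup>+S. ennreal (exp (sum_list (map g S))) \<partial>replicate_pmf m D) = (\<integral>\<^sup>+e. ennreal (exp (g e)) \<partial>D) ^ m"
proof (induction m)
  case (Suc m)
  have "(\<integral>\<^sup>+S. ennreal (exp (sum_list (map g S))) \<partial>replicate_pmf (Suc m) D) =
    (\<integral>\<^sup>+x. \<integral>\<^sup>+S. ennreal (exp (g x)) * ennreal (exp (sum_list (map g S))) \<partial>replicate_pmf m D \<partial>D)"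
    by (simp add: nn_integral_bind_pmf nn_integral_return_pmf exp_add ennreal_mult)
  also have "\<dots> = (\<integral>\<^sup>+x. ennreal (exp (g x)) * (\<integral>\<^sup>+e. ennreal (exp (g e)) \<partial>D) ^ m \<partial>D)"
    by (simp add: nn_integral_cmult Suc.IH)
  also have "\<dots> = (\<integral>\<^sup>+e. ennreal (exp (g e)) \<partial>D) ^ Suc m"
    by (simp add: nn_integral_multc)
  finally show ?case .
qed simp

lemma hoeffding_replicate:
  fixes f :: "'a \<Rightarrow> real" and D :: "'a pmf"
  assumes f: "\<And>e. e \<in> set_pmf D \<Longrightarrow> f e \<in> {a..b}" and ab: "a < b" and \<tau>: "\<tau> > 0"
  shows "measure_pmf.prob (replicate_pmf m D)
     {S. real m * measure_pmf.expectation D f + real m * \<tau> \<le> sum_list (map f S)} \<le> exp (- 2 * real m * \<tau>\<^sup>2 / (b - a)\<^sup>2)"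
proof -
  \<comment> \<open>The exponent \<open>?c\<close> minimises
    \<open>- c \<tau> + c^2 (b - a)^2 / 8\<close> in Chernoff's method; the minimum is
    \<open>- 2 \<tau>^2 / (b - a)^2\<close>.\<close>
  let ?\<mu> = "measure_pmf.expectation D f" and ?c = "4 * \<tau> / (b - a)\<^sup>2" and ?R = "measure_pmf (replicate_pmf m D)"
  let ?g = "\<lambda>e. ?c * (f e - ?\<mu>)"
  let ?A = "{S. real m * ?\<mu> + real m * \<tau> \<le> sum_list (map f S)}"
  interpret f: interval_bounded_random_variable "measure_pmf D" f a b
    by unfold_locales (use f in \<open>auto simp: AE_measure_pmf_iff\<close>)
  have c: "?c > 0" using ab \<tau> by simp
  have mgf: "(\<integral>\<^sup>+e. ennreal (exp (?g e)) \<partial>D) \<le> ennreal (exp (?c\<^sup>2 * (b - a)\<^sup>2 / 8))"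
    by (rule f.Hoeffdings_lemma_nn_integral[OF c])
  have sum_g: "sum_list (map (\<lambda>e. c * (f e - \<mu>)) S) = c * (sum_list (map f S) - real (length S) * \<mu>)" for S c \<mu>
    by (induction S) (simp_all add: algebra_simps)
  let ?u = "\<lambda>S. ennreal (exp (sum_list (map ?g S)))"
  have "emeasure ?R ?A = emeasure ?R (?A \<inter> set_pmf (replicate_pmf m D))"
    by (simp add: emeasure_Int_set_pmf)
  also have "\<dots> \<le> emeasure ?R {S \<in> space ?R. 1 \<le> ennreal (exp (- (?c * real m * \<tau>))) * ?u S}"
  proof (rule emeasure_mono)
    show "?A \<inter> set_pmf (replicate_pmf m D) \<subseteq> {S \<in> space ?R. 1 \<le> ennreal (exp (- (?c * real m * \<tau>))) * ?u S}"
    proof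
      fix S assume S: "S \<in> ?A \<inter> set_pmf (replicate_pmf m D)"
      then have "length S = m" by (simp add: set_replicate_pmf)
      have "?c * (real m * \<tau>) \<le> ?c * (sum_list (map f S) - real m * ?\<mu>)"
        using S c by (intro mult_left_mono) auto
      then have "0 \<le> - (?c * real m * \<tau>) + sum_list (map ?g S)"
        unfolding sum_g \<open>length S = m\<close> by (simp add: mult.assoc)
      then have "1 \<le> exp (- (?c * real m * \<tau>) + sum_list (map ?g S))" by simp
      then have "ennreal 1 \<le> ennreal (exp (- (?c * real m * \<tau>)) * exp (sum_list (map ?g S)))"
        unfolding exp_add by (rule ennreal_leI)
      then show "S \<in> {S \<in> space ?R. 1 \<le> ennreal (exp (- (?c * real m * \<tau>))) * ?u S}"
        by (simp add: ennreal_mult)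
    qed
  qed simp
  also have "\<dots> \<le> ennreal (exp (- (?c * real m * \<tau>))) * (\<integral>\<^sup>+S. ?u S * indicator (space ?R) S \<partial>?R)"
    using nn_integral_Markov_inequality[of ?u "space ?R" ?R "ennreal (exp (- (?c * real m * \<tau>)))"] by simp
  also have "(\<integral>\<^sup>+S. ?u S * indicator (space ?R) S \<partial>?R) = (\<integral>\<^sup>+S. ?u S \<partial>?R)" by simp
  also have "\<dots> \<le> ennreal (exp (?c\<^sup>2 * (b - a)\<^sup>2 / 8)) ^ m"
    unfolding nn_integral_exp_replicate by (rule power_mono[OF mgf]) simp
  also have "\<dots> = ennreal (exp (real m * (?c\<^sup>2 * (b - a)\<^sup>2 / 8)))"
    by (subst exp_of_nat_mult) (simp add: ennreal_power)
  also have "ennreal (exp (- (?c * real m * \<tau>))) * \<dots> = ennreal (exp (- (?c * real m * \<tau>) + real m * (?c\<^sup>2 * (b - a)\<^sup>2 / 8)))"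
    by (simp only: exp_add ennreal_mult exp_ge_zero)
  also have "- (?c * real m * \<tau>) + real m * (?c\<^sup>2 * (b - a)\<^sup>2 / 8) = - 2 * real m * \<tau>\<^sup>2 / (b - a)\<^sup>2"
  proof -
    have "- (4 * \<tau> / w\<^sup>2 * real m * \<tau>) + real m * ((4 * \<tau> / w\<^sup>2)\<^sup>2 * w\<^sup>2 / 8) = - 2 * real m * \<tau>\<^sup>2 / w\<^sup>2" if "w \<noteq> 0" for w
      using that by (simp add: field_simps power2_eq_square)
    from this[of "b - a"] ab show ?thesis by simp
  qed
  finally have "emeasure ?R ?A \<le> ennreal (exp (- 2 * real m * \<tau>\<^sup>2 / (b - a)\<^sup>2))"
    by (simp add: mult_left_mono)
  then show ?thesis by (simp add: measure_pmf.emeasure_eq_measure)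
qed

section \<open>The smoothed error as an absolute loss\<close>

lemma expectation_abs_error:
  assumes s: "0 < \<sigma>" "\<sigma> < 1/2" and f: "\<And>x. x \<in> cube n \<Longrightarrow> f x \<in> {1, -1 :: int}" and D: "uniform_marginal n D"
  shows "measure_pmf.expectation D (\<lambda>(x, y). \<bar>real_of_int y - smooth n \<sigma> (\<lambda>x. real_of_int (f x)) x\<bar>) =
    2 * measure_pmf.expectation (noise n \<sigma>) (\<lambda>z. measure_pmf.prob D {(x, y). f (hadamard n x z) \<noteq> y})"
proof -
  let ?X = "cube n \<times> {-1, 1 :: int}" and ?g = "\<lambda>x. real_of_int (f x)"
  have X: "set_pmf D \<subseteq> ?X" "finite ?X" using D by (auto simp: uniform_marginal_def)
  have P: "measure_pmf.prob D {(x, y). f (hadamard n x z) \<noteq> y} = (\<Sum>(x, y)\<in>?X. (if f (hadamard n x z) \<noteq> y then 1 else 0) * pmf D (x, y))" for z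
  proof -
    have "measure_pmf.prob D {(x, y). f (hadamard n x z) \<noteq> y} = measure_pmf.expectation D (indicator {(x, y). f (hadamard n x z) \<noteq> y})"
      by simp
    also have "\<dots> = (\<Sum>e\<in>?X. indicator {(x, y). f (hadamard n x z) \<noteq> y} e * pmf D e)"
      by (rule integral_measure_pmf_real) (use X in auto)
    also have "\<dots> = (\<Sum>(x, y)\<in>?X. (if f (hadamard n x z) \<noteq> y then 1 else 0) * pmf D (x, y))"
      by (rule sum.cong) (auto simp: indicator_def)
    finally show ?thesis .
  qed
  have pt: "\<bar>real_of_int y - smooth n \<sigma> ?g x\<bar> = 2 * (\<Sum>z\<in>cube n. (if f (hadamard n x z) \<noteq> y then 1 else 0) * pmf (noise n \<sigma>) z)"
    if xy: "x \<in> cube n" "y \<in> {-1, 1}" for x y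
  proof -
    have one: "(\<Sum>z\<in>cube n. pmf (noise n \<sigma>) z) = 1"
      using set_noise by (intro sum_pmf_eq_1) auto
    have sm: "smooth n \<sigma> ?g x = (\<Sum>z\<in>cube n. ?g (hadamard n x z) * pmf (noise n \<sigma>) z)"
      unfolding smooth_def by (rule integral_measure_pmf_real) (use set_noise in auto)
    \<comment> \<open>Since \<open>y\<close> is a sign, multiplying by it changes the difference at
      most in sign; the product turns out nonnegative, so it is the absolute value.\<close>
    have "real_of_int y * (real_of_int y - smooth n \<sigma> ?g x) =
      real_of_int y * real_of_int y * (\<Sum>z\<in>cube n. pmf (noise n \<sigma>) z) - (\<Sum>z\<in>cube n. real_of_int y * ?g (hadamard n x z) * pmf (noise n \<sigma>) z)"
      unfolding one sm by (simp add: sum_distrib_left algebra_simps)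
    also have "\<dots> = (\<Sum>z\<in>cube n. (real_of_int y * real_of_int y - real_of_int y * ?g (hadamard n x z)) * pmf (noise n \<sigma>) z)"
      by (simp add: sum_distrib_left sum_subtractf algebra_simps)
    also have "\<dots> = (\<Sum>z\<in>cube n. 2 * ((if f (hadamard n x z) \<noteq> y then 1 else 0) * pmf (noise n \<sigma>) z))"
    proof (rule sum.cong[OF refl])
      fix z assume "z \<in> cube n"
      then have "f (hadamard n x z) \<in> {1, -1}" using f hadamard_cube[OF xy(1)] by blast
      then show "(real_of_int y * real_of_int y - real_of_int y * ?g (hadamard n x z)) * pmf (noise n \<sigma>) z =
        2 * ((if f (hadamard n x z) \<noteq> y then 1 else 0) * pmf (noise n \<sigma>) z)" using xy(2) by auto
    qed
    finally have e: "real_of_int y * (real_of_int y - smooth n \<sigma> ?g x) = 2 * (\<Sum>z\<in>cube n. (if f (hadamard n x z) \<noteq> y then 1 else 0) * pmf (noise n \<sigma>) z)"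
      by (simp add: sum_distrib_left)
    have nn: "0 \<le> (\<Sum>z\<in>cube n. (if f (hadamard n x z) \<noteq> y then 1 else 0) * pmf (noise n \<sigma>) z)"
      by (intro sum_nonneg) auto
    show ?thesis using e nn xy(2) by auto
  qed
  have "measure_pmf.expectation D (\<lambda>(x, y). \<bar>real_of_int y - smooth n \<sigma> ?g x\<bar>) =
    (\<Sum>e\<in>?X. (case e of (x, y) \<Rightarrow> \<bar>real_of_int y - smooth n \<sigma> ?g x\<bar>) * pmf D e)"
    by (rule integral_measure_pmf_real) (use X in auto)
  also have "\<dots> = (\<Sum>e\<in>?X. \<Sum>z\<in>cube n. 2 * ((case e of (x, y) \<Rightarrow> (if f (hadamard n x z) \<noteq> y then 1 else 0) * pmf D (x, y)) * pmf (noise n \<sigma>) z))"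
  proof (rule sum.cong[OF refl])
    fix e assume "e \<in> ?X"
    then obtain x y where e: "e = (x, y)" "x \<in> cube n" "y \<in> {-1, 1}" by auto
    show "(case e of (x, y) \<Rightarrow> \<bar>real_of_int y - smooth n \<sigma> ?g x\<bar>) * pmf D e =
      (\<Sum>z\<in>cube n. 2 * ((case e of (x, y) \<Rightarrow> (if f (hadamard n x z) \<noteq> y then 1 else 0) * pmf D (x, y)) * pmf (noise n \<sigma>) z))"
      unfolding e(1) prod.case pt[OF e(2,3)] by (simp add: sum_distrib_left sum_distrib_right algebra_simps)
  qed
  also have "\<dots> = (\<Sum>z\<in>cube n. 2 * (measure_pmf.prob D {(x, y). f (hadamard n x z) \<noteq> y} * pmf (noise n \<sigma>) z))"
    unfolding P by (subst sum.swap) (simp add: sum_distrib_left sum_distrib_right)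
  also have "\<dots> = 2 * measure_pmf.expectation (noise n \<sigma>) (\<lambda>z. measure_pmf.prob D {(x, y). f (hadamard n x z) \<noteq> y})"
    by (subst integral_measure_pmf_real[where A = "cube n"]) (use set_noise in \<open>auto simp: sum_distrib_left\<close>)
  finally show ?thesis .
qed

text \<open>Here the uniformity of the marginal enters: the Fourier estimate, an average over the
  cube, becomes a statement about \<open>D\<close>.\<close>

lemma expectation_marginal:
  assumes "uniform_marginal n D"
  shows "measure_pmf.expectation D (\<lambda>(x, y). g x) = avg n g"
proof -
  have ne: "cube n \<noteq> {}" using card_cube[of n] by (metis card.empty power_eq_0_iff zero_neq_numeral)
  have "measure_pmf.expectation D (\<lambda>(x, y). g x) = measure_pmf.expectation (map_pmf fst D) g"
    by (simp add: case_prod_unfold)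
  also have "\<dots> = avg n g"
    using assms ne by (simp add: uniform_marginal_def integral_pmf_of_set avg_def card_cube)
  finally show ?thesis .
qed

text \<open>The triangle inequality through the smoothed concept. Its distance from the labels is
  twice the smoothed error, and its distance from the polynomial is the Fourier tail.\<close>

lemma comparator:
  assumes s: "0 < \<sigma>" "\<sigma> < 1/2" and f: "\<And>x. x \<in> cube n \<Longrightarrow> f x \<in> {1, -1 :: int}" and D: "uniform_marginal n D"
  shows "\<exists>u. (\<Sum>k<(n + 1) ^ d. (u k)\<^sup>2) \<le> 1 \<and>
    measure_pmf.expectation D (\<lambda>(x, y). \<bar>real_of_int y - (\<Sum>k<(n + 1) ^ d. u k * real_of_int (feat n d x k))\<bar>) \<le>
      2 * measure_pmf.expectation (noise n \<sigma>) (\<lambda>z. measure_pmf.prob D {(x, y). f (hadamard n x z) \<noteq> y}) + (1 - 2 * \<sigma>) ^ d"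
proof -
  let ?T = "smooth n \<sigma> (\<lambda>x. real_of_int (f x))"
  obtain u where u: "(\<Sum>k<(n + 1) ^ d. (u k)\<^sup>2) \<le> 1"
    "avg n (\<lambda>x. \<bar>?T x - (\<Sum>k<(n + 1) ^ d. u k * real_of_int (feat n d x k))\<bar>) \<le> (1 - 2 * \<sigma>) ^ d"
    using smooth_approx[OF s, of n "\<lambda>x. real_of_int (f x)" d] f by fastforce
  let ?p = "\<lambda>x. \<Sum>k<(n + 1) ^ d. u k * real_of_int (feat n d x k)"
  have "finite (set_pmf D)" using D finite_subset unfolding uniform_marginal_def by (metis finite_cartesian_product finite_cube finite.emptyI finite.insertI)
  then have int: "integrable D g" for g :: "example \<Rightarrow> real" by (rule integrable_measure_pmf_finite)
  have "measure_pmf.expectation D (\<lambda>(x, y). \<bar>real_of_int y - ?p x\<bar>) \<le>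
    measure_pmf.expectation D (\<lambda>e. (case e of (x, y) \<Rightarrow> \<bar>real_of_int y - ?T x\<bar>) + (case e of (x, y) \<Rightarrow> \<bar>?T x - ?p x\<bar>))"
    by (rule integral_mono[OF int int]) (auto split: prod.splits)
  also have "\<dots> = measure_pmf.expectation D (\<lambda>(x, y). \<bar>real_of_int y - ?T x\<bar>) + avg n (\<lambda>x. \<bar>?T x - ?p x\<bar>)"
    unfolding Bochner_Integration.integral_add[OF int int] expectation_marginal[OF D, symmetric] ..
  finally show ?thesis using u(2) expectation_abs_error[where f = f, OF s f D]
    by (intro exI[of _ u] conjI u(1)) linarith
qed

section \<open>Uniform convergence over finitely many hypotheses\<close>

definition hyp :: "nat \<Rightarrow> nat \<Rightarrow> (nat \<Rightarrow> int) \<Rightarrow> int \<Rightarrow> point \<Rightarrow> int" where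
  "hyp n d W \<theta> x = sg (dot ((n + 1) ^ d) W (feat n d x) - \<theta>)"

text \<open>The number of weight vectors and thresholds is at most \<open>exp (28 Z^2)\<close>, and
  the extra event for the comparator raises the exponent to \<open>29 Z^2\<close>. The sample size
  makes each event have probability at most \<open>exp (-32 Z^2)\<close>; the remaining
  \<open>3 Z^2\<close> exceeds \<open>r\<close>.\<close>

lemma hypotheses_count:
  fixes N q r Z m K T :: nat
  assumes pos: "N \<ge> 1" "q \<ge> 1" "r \<ge> 1" and Z: "Z = N * q * r" and m: "m = 64 * Z ^ 4"
    and K: "K = m * N * q" and T: "T = N * q * q + 1"
  shows "real ((2 * (T * m) + 1) ^ N * (2 * K + 1) + 1) * exp (- real m / (2 * (real q)\<^sup>2 * (real N)\<^sup>2)) \<le> (1 / 2) ^ r"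
proof -
  have le: "N \<le> Z" "q \<le> Z" "r \<le> Z" "N * q \<le> Z" "1 \<le> Z" unfolding Z using pos by auto
  have p: "Z ^ k \<le> Z ^ l" if "k \<le> l" for k l using that le by (intro power_increasing) auto
  have expZ: "real (Z ^ k) \<le> exp (real k * real Z)" for k
  proof -
    have "real Z \<le> exp (real Z)" using exp_ge_add_one_self[of "real Z"] by linarith
    then show ?thesis by (simp add: exp_of_nat_mult power_mono)
  qed
  have exp2: "(2::real) ^ k \<le> exp (real k)" for k
  proof -
    have "(2::real) \<le> exp 1" using exp_ge_add_one_self[of 1] by simp
    then have "(2::real) ^ k \<le> exp 1 ^ k" by (intro power_mono) auto
    then show ?thesis by (simp add: exp_of_nat_mult[symmetric])
  qed
  have T_le: "T \<le> 2 * Z ^ 2"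
  proof -
    have "N * q * q \<le> Z * Z" using le by (intro mult_mono) auto
    moreover have "1 \<le> Z * Z" using le by simp
    ultimately show ?thesis unfolding T power2_eq_square by linarith
  qed
  have "2 * (T * m) + 1 \<le> 2 * (2 * Z ^ 2 * (64 * Z ^ 4)) + Z ^ 6"
    unfolding m using T_le p[of 0 6] by (intro add_mono mult_mono) auto
  also have "\<dots> = 257 * Z ^ 6" by (simp add: power_add[symmetric])
  also have "\<dots> \<le> 2 ^ 9 * Z ^ 6" by simp
  finally have "real (2 * (T * m) + 1) \<le> real (2 ^ 9 * Z ^ 6)" by (rule of_nat_mono)
  also have "\<dots> \<le> exp 9 * exp (6 * real Z)"
    using expZ[of 6] exp2[of 9] unfolding of_nat_mult by (intro mult_mono) auto
  also have "\<dots> = exp (9 + 6 * real Z)" by (simp add: exp_add)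
  also have "\<dots> \<le> exp (15 * real Z)" using le by simp
  finally have "real (2 * (T * m) + 1) ^ N \<le> exp (15 * real Z) ^ N" by (intro power_mono) auto
  also have "\<dots> = exp (real N * (15 * real Z))" by (simp add: exp_of_nat_mult)
  also have "\<dots> \<le> exp (15 * (real Z)\<^sup>2)"
  proof -
    have "real N * (15 * real Z) \<le> real Z * (15 * real Z)" using le by (intro mult_right_mono) auto
    then show ?thesis by (simp add: power2_eq_square)
  qed
  finally have c1: "real (2 * (T * m) + 1) ^ N \<le> exp (15 * (real Z)\<^sup>2)" .
  have "2 * K + 1 \<le> 2 * (64 * Z ^ 4 * Z) + Z ^ 5"
    unfolding K m mult.assoc using le p[of 0 5] by (intro add_mono mult_mono) auto
  also have "\<dots> = 129 * Z ^ 5" by (simp add: power_eq_if)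
  also have "\<dots> \<le> 2 ^ 8 * Z ^ 5" by simp
  finally have "real (2 * K + 1) \<le> real (2 ^ 8 * Z ^ 5)" by (rule of_nat_mono)
  also have "\<dots> \<le> exp 8 * exp (5 * real Z)"
    using expZ[of 5] exp2[of 8] unfolding of_nat_mult by (intro mult_mono) auto
  also have "\<dots> = exp (8 + 5 * real Z)" by (simp add: exp_add)
  also have "\<dots> \<le> exp (13 * (real Z)\<^sup>2)"
  proof -
    have "1 \<le> real Z" using le by simp
    then have "real Z \<le> (real Z)\<^sup>2" by (simp add: power2_eq_square)
    then have "8 + 5 * real Z \<le> 13 * (real Z)\<^sup>2" using \<open>1 \<le> real Z\<close> by linarith
    then show ?thesis by simp
  qed
  finally have c2: "real (2 * K + 1) \<le> exp (13 * (real Z)\<^sup>2)" .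
  have Zsq: "real Z \<le> (real Z)\<^sup>2" "1 \<le> (real Z)\<^sup>2"
  proof -
    have "1 \<le> real Z" using le by simp
    then show "real Z \<le> (real Z)\<^sup>2" by (simp add: power2_eq_square)
    then show "1 \<le> (real Z)\<^sup>2" using \<open>1 \<le> real Z\<close> by linarith
  qed
  have "real ((2 * (T * m) + 1) ^ N * (2 * K + 1)) = real (2 * (T * m) + 1) ^ N * real (2 * K + 1)"
    by (simp only: of_nat_mult of_nat_power)
  also have "\<dots> \<le> exp (15 * (real Z)\<^sup>2) * exp (13 * (real Z)\<^sup>2)"
    by (intro mult_mono c1 c2) auto
  also have "\<dots> = exp (28 * (real Z)\<^sup>2)" by (simp add: exp_add[symmetric])
  finally have "real ((2 * (T * m) + 1) ^ N * (2 * K + 1) + 1) \<le> exp (28 * (real Z)\<^sup>2) + 1" by simp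
  also have "\<dots> \<le> exp (28 * (real Z)\<^sup>2) * exp (real Z ^ 2)"
  proof -
    have "2 \<le> exp ((real Z)\<^sup>2)" using exp_ge_add_one_self[of "(real Z)\<^sup>2"] Zsq by linarith
    then have "exp (28 * (real Z)\<^sup>2) * 2 \<le> exp (28 * (real Z)\<^sup>2) * exp (real Z ^ 2)" by (intro mult_left_mono) auto
    moreover have "1 \<le> exp (28 * (real Z)\<^sup>2)" by simp
    ultimately show ?thesis by linarith
  qed
  also have "\<dots> = exp (29 * (real Z)\<^sup>2)" by (simp add: exp_add[symmetric])
  finally have c3: "real ((2 * (T * m) + 1) ^ N * (2 * K + 1) + 1) \<le> exp (29 * (real Z)\<^sup>2)" .
  have ex: "- real m / (2 * (real q)\<^sup>2 * (real N)\<^sup>2) \<le> - 32 * (real Z)\<^sup>2"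
  proof -
    have "(real (N * q))\<^sup>2 \<le> (real Z)\<^sup>2" using le by (intro power_mono of_nat_mono) auto
    then have "(real Z)\<^sup>2 * (2 * (real q)\<^sup>2 * (real N)\<^sup>2) * 32 \<le> (real Z)\<^sup>2 * (2 * (real Z)\<^sup>2) * 32"
      by (intro mult_right_mono mult_left_mono) (auto simp: power_mult_distrib mult.commute)
    also have "\<dots> = real m" by (simp add: m power_eq_if)
    finally have "32 * (real Z)\<^sup>2 \<le> real m / (2 * (real q)\<^sup>2 * (real N)\<^sup>2)"
      using pos by (simp add: field_simps)
    then show ?thesis by simp
  qed
  have "real ((2 * (T * m) + 1) ^ N * (2 * K + 1) + 1) * exp (- real m / (2 * (real q)\<^sup>2 * (real N)\<^sup>2))
      \<le> exp (29 * (real Z)\<^sup>2) * exp (- 32 * (real Z)\<^sup>2)"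
    using c3 ex by (intro mult_mono) auto
  also have "\<dots> = exp (- 3 * (real Z)\<^sup>2)" by (simp add: exp_add[symmetric])
  also have "\<dots> \<le> exp (- real r)"
  proof -
    have "real r \<le> real Z" using le by simp
    then have "real r \<le> 3 * (real Z)\<^sup>2" using Zsq by linarith
    then show ?thesis by simp
  qed
  also have "\<dots> = 1 / exp (real r)" by (simp add: exp_minus field_simps)
  also have "\<dots> \<le> 1 / 2 ^ r" using exp2[of r] by (intro divide_left_mono) auto
  finally show ?thesis by (simp add: power_one_over)
qed

text \<open>The comparator is fixed before the sample is drawn, so its loss costs a single event.
  The output depends on the sample and therefore needs a union over all pairs within the size
  bounds.\<close>

lemma uniform_convergence:
  fixes n d q r :: nat and D :: "example pmf" and u :: "nat \<Rightarrow> real"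
  defines "N \<equiv> (n + 1) ^ d"
  defines "Z \<equiv> N * q * r"
  defines "m \<equiv> 64 * Z ^ 4"
  defines "K \<equiv> m * N * q" and "T \<equiv> N * q * q + 1"
  defines "loss \<equiv> \<lambda>(x, y). \<bar>real_of_int y - (\<Sum>k<N. u k * real_of_int (feat n d x k))\<bar>"
  assumes pos: "q \<ge> 1" "r \<ge> 1" and D: "uniform_marginal n D" and u: "(\<Sum>k<N. (u k)\<^sup>2) \<le> 1"
  shows "1 - (1 / 2) ^ r \<le> measure_pmf.prob (replicate_pmf m D) {S.
    sum_list (map loss S) < real m * measure_pmf.expectation D loss + real m * (1 / real q) \<and>
    (\<forall>W \<theta>. (\<forall>k<N. \<bar>W k\<bar> \<le> int (T * m)) \<and> \<bar>\<theta>\<bar> \<le> int K \<longrightarrow>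
       err D (hyp n d W \<theta>) < real (nerr m N (\<lambda>i. feat n d (fst (S ! i))) (\<lambda>i. snd (S ! i)) W \<theta>) / real m + 1 / (2 * real q))}"
  (is "_ \<le> measure_pmf.prob ?R ?G")
proof -
  have N1: "N \<ge> 1" by (simp add: N_def)
  have m0: "m > 0" using pos N1 by (simp add: m_def Z_def)
  let ?X = "exp (- real m / (2 * (real q)\<^sup>2 * (real N)\<^sup>2))"
  \<comment> \<open>Errors count as -1, so that the upper-tail bound yields what is wanted: the true
    error exceeds the empirical one by little.\<close>
  define miss where "miss = (\<lambda>(W, \<theta>) (x, y). if hyp n d W \<theta> x \<noteq> y then -1 else 0 :: real)"
  define B0 where "B0 = {S. real m * measure_pmf.expectation D loss + real m * (1 / real q) \<le> sum_list (map loss S)}"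
  define B where "B h = {S. real m * measure_pmf.expectation D (miss h) + real m * (1 / (2 * real q)) \<le> sum_list (map (miss h) S)}" for h
  define H where "H = (({..<N} \<rightarrow>\<^sub>E {- int (T * m)..int (T * m)}) \<times> {- int K..int K})"
  have finH: "finite H" unfolding H_def by (intro finite_cartesian_product finite_PiE) auto
  have cardH: "card H = (2 * (T * m) + 1) ^ N * (2 * K + 1)"
    unfolding H_def card_cartesian_product by (subst card_PiE) (auto simp: nat_add_distrib nat_mult_distrib)
  have in_cube: "x \<in> cube n" "y \<in> {-1, 1}" if "(x, y) \<in> set_pmf D" for x y
    using D that by (auto simp: uniform_marginal_def)
  have feat1: "feat n d x k \<in> {1, -1}" if "x \<in> cube n" "k < N" for x k
    using feat_sign[of n x k d] cube_coord[OF that(1)] that(2) by (simp add: N_def)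
  have P0: "measure_pmf.prob ?R B0 \<le> ?X"
  proof -
    \<comment> \<open>Every coefficient has absolute value at most 1 and every feature is a sign, so
      the polynomial is at most \<open>N\<close> in absolute value.\<close>
    have "loss e \<in> {0..1 + real N}" if "e \<in> set_pmf D" for e
    proof -
      obtain x y where e: "e = (x, y)" by fastforce
      have u1: "\<bar>u k\<bar> \<le> 1" if "k < N" for k
      proof -
        have "(u k)\<^sup>2 \<le> (\<Sum>k<N. (u k)\<^sup>2)" using that by (intro member_le_sum) auto
        then have "(u k)\<^sup>2 \<le> 1" using u by linarith
        then show ?thesis by (simp add: abs_square_le_1)
      qed
      have "\<bar>\<Sum>k<N. u k * real_of_int (feat n d x k)\<bar> \<le> (\<Sum>k<N. \<bar>u k * real_of_int (feat n d x k)\<bar>)" by (rule sum_abs)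
      also have "\<dots> \<le> (\<Sum>k<N. 1)"
      proof (rule sum_mono)
        fix k assume "k \<in> {..<N}"
        then show "\<bar>u k * real_of_int (feat n d x k)\<bar> \<le> 1"
          using u1[of k] feat1[of x k] in_cube(1) that e by (auto simp: abs_mult)
      qed
      finally have "\<bar>\<Sum>k<N. u k * real_of_int (feat n d x k)\<bar> \<le> real N" by simp
      moreover have "\<bar>real_of_int y\<bar> = 1" using in_cube(2)[of x y] that e by auto
      ultimately show ?thesis unfolding loss_def e by auto
    qed
    then have "measure_pmf.prob ?R B0 \<le> exp (- 2 * real m * (1 / real q)\<^sup>2 / (1 + real N - 0)\<^sup>2)"
      unfolding B0_def using pos by (intro hoeffding_replicate) auto
    also have "\<dots> \<le> ?X"
    proof -
      have "(1 + real N)\<^sup>2 \<le> (2 * real N)\<^sup>2" using N1 by (intro power_mono) auto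
      then have "2 * real m * (1 / real q)\<^sup>2 / (2 * real N)\<^sup>2 \<le> 2 * real m * (1 / real q)\<^sup>2 / (1 + real N)\<^sup>2"
        using N1 by (intro divide_left_mono) (auto simp: zero_less_mult_iff)
      moreover have "2 * real m * (1 / real q)\<^sup>2 / (2 * real N)\<^sup>2 = real m / (2 * (real q)\<^sup>2 * (real N)\<^sup>2)"
        by (simp add: power_mult_distrib power_divide field_simps)
      ultimately show ?thesis by simp
    qed
    finally show ?thesis .
  qed
  have Ph: "measure_pmf.prob ?R (B h) \<le> ?X" for h
  proof -
    have "miss h e \<in> {-1..0}" for e by (auto simp: miss_def split: prod.splits)
    then have "measure_pmf.prob ?R (B h) \<le> exp (- 2 * real m * (1 / (2 * real q))\<^sup>2 / (0 - (-1))\<^sup>2)"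
      unfolding B_def using pos by (intro hoeffding_replicate) auto
    also have "\<dots> \<le> ?X"
    proof -
      have "1 \<le> (real N)\<^sup>2" using N1 by simp
      then have "2 * (real q)\<^sup>2 * 1 \<le> 2 * (real q)\<^sup>2 * (real N)\<^sup>2" by (intro mult_left_mono) auto
      then have "real m / (2 * (real q)\<^sup>2 * (real N)\<^sup>2) \<le> real m / (2 * (real q)\<^sup>2)"
        using pos N1 by (intro divide_left_mono) auto
      then show ?thesis by (simp add: power_divide power_mult_distrib)
    qed
    finally show ?thesis .
  qed
  have "measure_pmf.prob ?R (B0 \<union> (\<Union>h\<in>H. B h)) \<le> measure_pmf.prob ?R B0 + measure_pmf.prob ?R (\<Union>h\<in>H. B h)"
    by (intro measure_Un_le) auto
  also have "\<dots> \<le> ?X + (\<Sum>h\<in>H. measure_pmf.prob ?R (B h))"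
    by (intro add_mono P0 measure_pmf.finite_measure_subadditive_finite finH) auto
  also have "\<dots> \<le> ?X + (\<Sum>h\<in>H. ?X)" by (intro add_left_mono sum_mono Ph)
  also have "\<dots> = real ((2 * (T * m) + 1) ^ N * (2 * K + 1) + 1) * ?X"
    unfolding cardH[symmetric] by (simp add: algebra_simps)
  also have "\<dots> \<le> (1 / 2) ^ r"
    by (rule hypotheses_count[OF N1 pos]) (simp_all add: Z_def m_def K_def T_def)
  finally have bad: "measure_pmf.prob ?R (B0 \<union> (\<Union>h\<in>H. B h)) \<le> (1 / 2) ^ r" .
  have good: "S \<in> ?G" if S: "S \<in> set_pmf ?R" "S \<notin> B0 \<union> (\<Union>h\<in>H. B h)" for S
  proof -
    have len: "length S = m" using S(1) by (simp add: set_replicate_pmf)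
    have "err D (hyp n d W \<theta>) < real (nerr m N (\<lambda>i. feat n d (fst (S ! i))) (\<lambda>i. snd (S ! i)) W \<theta>) / real m + 1 / (2 * real q)"
      if W: "\<forall>k<N. \<bar>W k\<bar> \<le> int (T * m)" "\<bar>\<theta>\<bar> \<le> int K" for W \<theta>
    proof -
      \<comment> \<open>The weights are read from memory and arbitrary beyond \<open>N\<close>.
        Restriction brings them into the finite set \<open>H\<close> without changing the
        hypothesis.\<close>
      let ?h = "(restrict W {..<N}, \<theta>)"
      have "?h \<in> H" using W by (auto simp: H_def abs_le_iff)
      then have nb: "sum_list (map (miss ?h) S) < real m * measure_pmf.expectation D (miss ?h) + real m * (1 / (2 * real q))"
        using S(2) by (auto simp: B_def not_le)
      have hr: "hyp n d (restrict W {..<N}) \<theta> x = hyp n d W \<theta> x" for x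
        by (simp add: hyp_def dot_def N_def)
      have ms: "miss ?h = (\<lambda>e. - indicator {(x, y). hyp n d W \<theta> x \<noteq> y} e)"
        by (auto simp: miss_def hr indicator_def fun_eq_iff)
      have "measure_pmf.expectation D (miss ?h) = - err D (hyp n d W \<theta>)"
        unfolding ms err_def by simp
      moreover have "sum_list (map (miss ?h) S) = - real (nerr m N (\<lambda>i. feat n d (fst (S ! i))) (\<lambda>i. snd (S ! i)) W \<theta>)"
        unfolding nerr_sum sum_list_sum_nth ms
        by (auto simp: len sum_negf[symmetric] indicator_def hyp_def N_def case_prod_unfold lessThan_atLeast0 intro!: sum.cong)
      ultimately show ?thesis using nb m0 by (simp add: field_simps)
    qed
    then show ?thesis using S(2) by (auto simp: B0_def not_le)
  qed
  have "1 - (1 / 2) ^ r \<le> 1 - measure_pmf.prob ?R (B0 \<union> (\<Union>h\<in>H. B h))" using bad by simp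
  also have "\<dots> = measure_pmf.prob ?R (space ?R - (B0 \<union> (\<Union>h\<in>H. B h)))"
    by (subst measure_pmf.prob_compl) auto
  also have "\<dots> \<le> measure_pmf.prob ?R ?G"
    by (intro measure_pmf.finite_measure_mono_AE AE_pmfI) (use good in auto)
  finally show ?thesis .
qed

section \<open>Estimates for the searched parameters\<close>

lemma ln2_half: "1 / 2 \<le> ln (2::real)" "ln (2::real) \<le> 1"
  using ln_le_minus_one[of "1 / 2"] ln_le_minus_one[of "2::real"] by (simp_all add: ln_div)

text \<open>The lower bound is the success of the search. The upper bound comes from the failure of
  the preceding candidate, or from the initial value 8 if the search stops at once; minimality is
  used in the same way for the other two parameters.\<close>

lemma eps_exp_facts:
  assumes "\<epsilon> > 0"
  shows "2 \<le> \<epsilon> * 2 ^ eps_exp \<epsilon>" "3 \<le> eps_exp \<epsilon>" "\<epsilon> < 1 \<Longrightarrow> 2 ^ eps_exp \<epsilon> \<le> 8 / \<epsilon>" "3 \<le> \<epsilon> * 4 \<Longrightarrow> eps_exp \<epsilon> = 3"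
proof -
  let ?P = "\<lambda>k. 2 \<le> \<epsilon> * (8 * 2 ^ k)"
  let ?k = "LEAST k. ?P k"
  obtain k0 :: nat where "2 / (\<epsilon> * 8) < 2 ^ k0" using real_arch_pow[of 2 "2 / (\<epsilon> * 8)"] by auto
  then have "?P k0" using assms by (simp add: field_simps)
  then have P: "?P ?k" by (rule LeastI)
  then show "2 \<le> \<epsilon> * 2 ^ eps_exp \<epsilon>" by (simp add: eps_exp_def power_add)
  show "3 \<le> eps_exp \<epsilon>" by (simp add: eps_exp_def)
  show "2 ^ eps_exp \<epsilon> \<le> 8 / \<epsilon>" if "\<epsilon> < 1"
  proof (cases ?k)
    case 0
    then have "(2::real) ^ eps_exp \<epsilon> = 8" by (simp add: eps_exp_def)
    then show ?thesis using assms that by (simp add: field_simps)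
  next
    case (Suc j)
    then have "\<not> ?P j" using not_less_Least[of j ?P] by simp
    then show ?thesis using assms Suc by (simp add: eps_exp_def power_add field_simps)
  qed
  show "eps_exp \<epsilon> = 3" if "3 \<le> \<epsilon> * 4"
  proof -
    have "?k = 0" by (rule Least_eq_0) (use that in simp)
    then show ?thesis by (simp add: eps_exp_def)
  qed
qed

lemma sig_inv_facts:
  assumes "0 < \<sigma>" "\<sigma> < 1 / 2"
  shows "1 \<le> \<sigma> * real (sig_inv \<sigma>)" "real (sig_inv \<sigma>) \<le> 2 / \<sigma>"
proof -
  let ?P = "\<lambda>k. 1 \<le> \<sigma> * real (Suc k)"
  obtain k0 :: nat where "1 / \<sigma> < real k0" using reals_Archimedean2 by blast
  then have "?P k0" using assms by (simp add: field_simps)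
  then have "?P (LEAST k. ?P k)" by (rule LeastI)
  then show "1 \<le> \<sigma> * real (sig_inv \<sigma>)" by (simp add: sig_inv_def)
  show "real (sig_inv \<sigma>) \<le> 2 / \<sigma>"
  proof (cases "LEAST k. ?P k")
    case 0
    then show ?thesis using assms by (simp add: sig_inv_def)
  next
    case (Suc j)
    then have "\<not> ?P j" using not_less_Least[of j ?P] by simp
    then have "\<sigma> * real (Suc j) < 1" by simp
    then have "\<sigma> * real (sig_inv \<sigma>) \<le> 2" using Suc assms by (simp add: sig_inv_def algebra_simps)
    then show ?thesis using assms by (simp add: field_simps)
  qed
qed

lemma del_exp_facts:
  assumes "0 < \<delta>" "\<delta> < 1"
  shows "(1 / 2) ^ del_exp \<delta> \<le> \<delta>" "1 \<le> del_exp \<delta>" "real (del_exp \<delta>) \<le> 1 + 2 * ln (1 / \<delta>)"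
proof -
  let ?P = "\<lambda>k. 1 \<le> \<delta> * 2 ^ Suc k"
  obtain k0 :: nat where "1 / (\<delta> * 2) < 2 ^ k0" using real_arch_pow[of 2 "1 / (\<delta> * 2)"] by auto
  then have "?P k0" using assms by (simp add: field_simps)
  then have "?P (LEAST k. ?P k)" by (rule LeastI)
  then have "1 \<le> \<delta> * 2 ^ del_exp \<delta>" by (simp add: del_exp_def)
  then show "(1 / 2) ^ del_exp \<delta> \<le> \<delta>" by (simp add: power_one_over field_simps)
  show "1 \<le> del_exp \<delta>" by (simp add: del_exp_def)
  show "real (del_exp \<delta>) \<le> 1 + 2 * ln (1 / \<delta>)"
  proof (cases "LEAST k. ?P k")
    case 0
    then show ?thesis using assms by (simp add: del_exp_def)
  next
    case (Suc j)
    then have "\<not> ?P j" using not_less_Least[of j ?P] by simp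
    then have "2 ^ Suc j \<le> 1 / \<delta>" using assms by (simp add: field_simps)
    then have "ln (2 ^ Suc j) \<le> ln (1 / \<delta>)" by (intro ln_mono) auto
    then have "real (Suc j) * ln 2 \<le> ln (1 / \<delta>)" by (simp only: ln_realpow zero_less_numeral)
    moreover have "real (Suc j) * (1 / 2) \<le> real (Suc j) * ln 2"
      using ln2_half by (intro mult_left_mono) auto
    ultimately have "real (Suc j) * (1 / 2) \<le> ln (1 / \<delta>)" by linarith
    then show ?thesis using Suc by (simp add: del_exp_def)
  qed
qed

text \<open>With \<open>l = ln (1 / \<epsilon>)\<close> the exponent of \<open>q\<close> is at most
  \<open>26 l\<close> and the inverse noise rate at most \<open>2 / \<sigma>\<close>, so the degree
  is at most \<open>52 l / \<sigma>\<close>. Replacing \<open>n + 1\<close> by \<open>n^2\<close>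
  doubles this to 104, and \<open>q \<le> 8 a\<close> adds the last factor \<open>a\<close>. For
  degree 0 the term 1 in \<open>1 + a ^ 105\<close> is enough.\<close>

lemma size_bound:
  fixes n :: nat
  assumes n: "n \<ge> 2" and e: "\<epsilon> > 0" and s: "0 < \<sigma>" "\<sigma> < 1 / 2" and d: "0 < \<delta>" "\<delta> < 1"
  defines "a \<equiv> real n powr (ln (1 / \<epsilon>) / \<sigma>)" and "b \<equiv> ln (1 / \<delta>)"
  shows "real ((n + 1) ^ degr \<epsilon> \<sigma> * 2 ^ eps_exp \<epsilon> * del_exp \<delta>) \<le> 8 * (1 + a ^ 105) * (1 + 2 * b)"
proof -
  have r: "real (del_exp \<delta>) \<le> 1 + 2 * b" unfolding b_def by (rule del_exp_facts(3)[OF d])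
  have b: "b > 0" unfolding b_def using d by simp
  have a0: "a > 0" unfolding a_def using n by simp
  have "real ((n + 1) ^ degr \<epsilon> \<sigma> * 2 ^ eps_exp \<epsilon>) \<le> 8 * (1 + a ^ 105)"
  proof (cases "3 \<le> \<epsilon> * 4")
    case True
    then show ?thesis using eps_exp_facts(4)[OF e] a0 by (simp add: degr_def)
  next
    case False
    define l where "l = ln (1 / \<epsilon>)"
    have "\<epsilon> < 3 / 4" using False by simp
    \<comment> \<open>Being bounded away from 0, \<open>l\<close> absorbs additive constants:
      \<open>6 + 2 l \<le> 26 l\<close> below. Close to \<epsilon> = 1 this would fail.\<close>
    have l: "1 / 4 \<le> l"
    proof -
      have "ln \<epsilon> \<le> \<epsilon> - 1" using e by (rule ln_le_minus_one)
      then show ?thesis using \<open>\<epsilon> < 3 / 4\<close> e by (simp add: l_def ln_div)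
    qed
    have ln2: "1 / 2 \<le> ln (2::real)" "ln (2::real) \<le> 1" using ln2_half by auto
    have expl: "exp l = 1 / \<epsilon>" using e by (simp add: l_def)
    have q: "2 ^ eps_exp \<epsilon> \<le> 8 * exp l" using eps_exp_facts(3)[OF e] \<open>\<epsilon> < 3 / 4\<close> by (simp add: expl)
    have ee: "real (eps_exp \<epsilon>) \<le> 26 * l"
    proof -
      have "ln (2 ^ eps_exp \<epsilon>) \<le> ln (8 * exp l)" using q by (intro ln_mono) auto
      moreover have "ln (2 ^ eps_exp \<epsilon>) = real (eps_exp \<epsilon>) * ln 2" by (rule ln_realpow)
      moreover have "ln (8 * exp l) = 3 * ln 2 + l"
      proof -
        have "(8::real) = 2 ^ 3" by simp
        then have "ln (8::real) = 3 * ln 2" by (metis ln_realpow of_nat_numeral zero_less_numeral)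
        then show ?thesis by (simp add: ln_mult)
      qed
      moreover have "real (eps_exp \<epsilon>) * (1 / 2) \<le> real (eps_exp \<epsilon>) * ln 2" using ln2 by (intro mult_left_mono) auto
      ultimately show ?thesis using l ln2 by linarith
    qed
    have dg: "real (degr \<epsilon> \<sigma>) \<le> 52 * (l / \<sigma>)"
    proof -
      have "real (degr \<epsilon> \<sigma>) = real (eps_exp \<epsilon>) * real (sig_inv \<sigma>)" using False by (simp add: degr_def)
      also have "\<dots> \<le> (26 * l) * (2 / \<sigma>)" using ee sig_inv_facts(2)[OF s] l by (intro mult_mono) auto
      finally show ?thesis by simp
    qed
    have N: "real ((n + 1) ^ degr \<epsilon> \<sigma>) \<le> a ^ 104"
    proof -
      have "n + 1 \<le> 2 * n" using n by simp
      also have "2 * n \<le> n * n" using n by (intro mult_right_mono) auto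
      finally have "n + 1 \<le> n ^ 2" by (simp add: power2_eq_square)
      then have "(n + 1) ^ degr \<epsilon> \<sigma> \<le> (n ^ 2) ^ degr \<epsilon> \<sigma>" by (rule power_mono) simp
      then have "real ((n + 1) ^ degr \<epsilon> \<sigma>) \<le> real ((n ^ 2) ^ degr \<epsilon> \<sigma>)" by (rule of_nat_mono)
      also have "\<dots> = real n powr (2 * real (degr \<epsilon> \<sigma>))"
        using n by (simp add: power_mult[symmetric] powr_realpow[symmetric])
      also have "\<dots> \<le> real n powr (104 * (l / \<sigma>))" using dg n by (intro powr_mono) auto
      also have "\<dots> = (real n powr (l / \<sigma>)) powr 104" by (simp add: powr_powr mult.commute)
      also have "\<dots> = a ^ 104" using a0 powr_realpow[of a 104] by (simp add: a_def l_def)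
      finally show ?thesis .
    qed
    have "exp l \<le> a"
    proof -
      have "l * 1 \<le> (l / \<sigma>) * ln (real n)"
      proof -
        have "2 \<le> 1 / \<sigma>" using s by (simp add: field_simps)
        then have "l * 2 \<le> l * (1 / \<sigma>)" using l by (intro mult_left_mono) auto
        moreover have "1 / 2 \<le> ln (real n)"
        proof -
          have "ln 2 \<le> ln (real n)" using n by (intro ln_mono) auto
          then show ?thesis using ln2 by linarith
        qed
        ultimately have "(l * 2) * (1 / 2) \<le> (l / \<sigma>) * ln (real n)" using l by (intro mult_mono) auto
        then show ?thesis by simp
      qed
      then show ?thesis unfolding a_def using n by (simp add: powr_def l_def)
    qed
    then have "real (2 ^ eps_exp \<epsilon>) \<le> 8 * a" using q by simp
    then have "real ((n + 1) ^ degr \<epsilon> \<sigma>) * real (2 ^ eps_exp \<epsilon>) \<le> a ^ 104 * (8 * a)"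
      using N a0 by (intro mult_mono) auto
    also have "\<dots> = 8 * a ^ 105" by (simp add: power_Suc2[symmetric] del: power_Suc)
    finally show ?thesis by simp
  qed
  then have "real ((n + 1) ^ degr \<epsilon> \<sigma> * 2 ^ eps_exp \<epsilon>) * real (del_exp \<delta>) \<le> 8 * (1 + a ^ 105) * (1 + 2 * b)"
    using r a0 b by (intro mult_mono) auto
  then show ?thesis by simp
qed

text \<open>As \<open>\<sigma> * sig_inv \<sigma> \<ge> 1\<close>, the inner power is at most
  \<open>exp (-2) \<le> 1/4\<close>. Raising it to the exponent of \<open>q\<close> gives
  \<open>1 / q^2\<close>, which is at most \<open>1 / (2 q)\<close>.\<close>

lemma noise_rate_power:
  assumes "\<epsilon> > 0" "0 < \<sigma>" "\<sigma> < 1 / 2" "\<not> 3 \<le> \<epsilon> * 4"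
  shows "(1 - 2 * \<sigma>) ^ degr \<epsilon> \<sigma> \<le> 1 / (2 * 2 ^ eps_exp \<epsilon>)"
proof -
  let ?s = "sig_inv \<sigma>" and ?e = "eps_exp \<epsilon>"
  have "(1 - 2 * \<sigma>) ^ ?s \<le> exp (- 2 * \<sigma>) ^ ?s"
    using exp_ge_add_one_self[of "- 2 * \<sigma>"] assms by (intro power_mono) auto
  also have "\<dots> = exp (real ?s * (- 2 * \<sigma>))" by (simp only: exp_of_nat_mult)
  also have "\<dots> \<le> exp (- 2)"
    using sig_inv_facts(1)[OF assms(2,3)] by (simp add: mult.commute)
  also have "\<dots> \<le> 1 / 4"
  proof -
    have "(2::real) \<le> exp 1" using exp_ge_add_one_self[of 1] by simp
    then have "2 * 2 \<le> exp 1 * exp (1::real)" by (intro mult_mono) auto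
    then have "4 \<le> exp (2::real)" by (simp add: exp_add[symmetric])
    then show ?thesis by (simp add: exp_minus field_simps)
  qed
  finally have s: "(1 - 2 * \<sigma>) ^ ?s \<le> 1 / 4" .
  have "(1 - 2 * \<sigma>) ^ degr \<epsilon> \<sigma> = ((1 - 2 * \<sigma>) ^ ?s) ^ ?e"
    using assms(4) by (simp add: degr_def power_mult[symmetric] mult.commute)
  also have "\<dots> \<le> (1 / 4) ^ ?e" using s assms by (intro power_mono) auto
  also have "\<dots> = 1 / (2 ^ ?e * 2 ^ ?e)"
    by (simp add: power_one_over power_mult_distrib[symmetric])
  also have "\<dots> \<le> 1 / (2 * 2 ^ ?e)"
  proof -
    have "(2::real) ^ 1 \<le> 2 ^ ?e" using eps_exp_facts(2)[OF assms(1)] by (intro power_increasing) auto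
    then show ?thesis by (intro divide_left_mono mult_right_mono) auto
  qed
  finally show ?thesis .
qed

lemma good_comparator:
  assumes e: "\<epsilon> > 0" and s: "0 < \<sigma>" "\<sigma> < 1 / 2"
    and C: "\<C> \<noteq> {}" "\<C> \<subseteq> (cube n \<rightarrow> {- 1, 1})" and D: "uniform_marginal n D"
  defines "d \<equiv> degr \<epsilon> \<sigma>" and "q \<equiv> 2 ^ eps_exp \<epsilon>"
  shows "\<exists>u. (\<Sum>k<(n + 1) ^ d. (u k)\<^sup>2) \<le> 1 \<and>
    measure_pmf.expectation D (\<lambda>(x, y). \<bar>real_of_int y - (\<Sum>k<(n + 1) ^ d. u k * real_of_int (feat n d x k))\<bar>) / 2 + 3 / (2 * q)
      \<le> smoothed_opt n \<sigma> D \<C> + \<epsilon>"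
proof -
  let ?v = "\<lambda>f. measure_pmf.expectation (noise n \<sigma>) (\<lambda>z. measure_pmf.prob D {(x, y). f (hadamard n x z) \<noteq> y})"
  have v0: "0 \<le> ?v f" for f by (intro integral_nonneg_AE) simp
  have opt0: "0 \<le> smoothed_opt n \<sigma> D \<C>"
    unfolding smoothed_opt_def using C(1) v0 by (intro cINF_greatest) auto
  have q0: "q > 0" by (simp add: q_def)
  have q2: "2 / q \<le> \<epsilon>" using eps_exp_facts(1)[OF e] q0 by (simp add: q_def field_simps)
  show ?thesis
  proof (cases "3 \<le> \<epsilon> * 4")
    case True
    \<comment> \<open>The zero polynomial has absolute loss 1, and \<open>1/2 + 3/16 = 11/16\<close>
      is below 3/4. The initial value 8 of the accuracy search leaves this room.\<close>
    have "q = 8" unfolding q_def eps_exp_facts(4)[OF e True] by simp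
    have "measure_pmf.expectation D (\<lambda>(x, y). \<bar>real_of_int y\<bar>) = measure_pmf.expectation D (\<lambda>_. 1)"
      by (intro integral_cong_AE) (use D in \<open>auto simp: AE_measure_pmf_iff uniform_marginal_def\<close>)
    then show ?thesis using True opt0 by (intro exI[of _ "\<lambda>_. 0"]) (simp add: \<open>q = 8\<close>)
  next
    case False
    \<comment> \<open>A concept within \<open>1/(4q)\<close> of the infimum is chosen. Half the
      truncation error adds \<open>1/(4q)\<close>, and with the reserved \<open>3/(2q)\<close> the
      total is \<open>2/q\<close>.\<close>
    have "(INF f\<in>\<C>. ?v f) < smoothed_opt n \<sigma> D \<C> + 1 / (4 * q)"
      using q0 by (simp add: smoothed_opt_def)
    moreover have "bdd_below (?v ` \<C>)" using v0 by (intro bdd_belowI[of _ 0]) auto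
    ultimately obtain f where f: "f \<in> \<C>" "?v f < smoothed_opt n \<sigma> D \<C> + 1 / (4 * q)"
      using cINF_less_iff[OF C(1), of ?v] by blast
    have fx: "f x \<in> {1, -1}" if "x \<in> cube n" for x using f(1) C(2) that by (auto simp: Pi_def)
    obtain u where u: "(\<Sum>k<(n + 1) ^ d. (u k)\<^sup>2) \<le> 1"
      "measure_pmf.expectation D (\<lambda>(x, y). \<bar>real_of_int y - (\<Sum>k<(n + 1) ^ d. u k * real_of_int (feat n d x k))\<bar>) \<le>
        2 * ?v f + (1 - 2 * \<sigma>) ^ d"
      using comparator[where f = f and d = d, OF s fx D] by blast
    have "(1 - 2 * \<sigma>) ^ d \<le> 1 / (2 * q)" unfolding d_def q_def by (rule noise_rate_power[OF e s False])
    moreover have "1 / (4 * q) = (1 / q) / 4" "1 / (2 * q) = (1 / q) / 2" "3 / (2 * q) = 3 * (1 / q) / 2" "2 / q = 2 * (1 / q)" by simp_all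
    ultimately show ?thesis using u f(2) q2 by (intro exI[of _ u] conjI) linarith+
  qed
qed

text \<open>In \<open>poly2\<close> the outer variable stands for \<open>b\<close> and the
  coefficients are polynomials in \<open>a\<close>. This is the time bound
  \<open>300000 Z^11\<close> with the bound on \<open>Z\<close> substituted, hence a fixed
  polynomial.\<close>

definition budget :: "real poly poly" where
  "budget = [:[:300000 * 8 ^ 11:]:] * [:1 + monom 1 105:] ^ 11 * [:1, [:2:]:] ^ 11"

lemma poly2_budget: "poly2 budget a b = 300000 * (8 * (1 + a ^ 105) * (1 + 2 * b)) ^ 11"
proof -
  have "poly2 budget a b = (300000 * 8 ^ 11) * (1 + a ^ 105) ^ 11 * (1 + 2 * b) ^ 11"
    by (simp add: poly2_def budget_def poly_monom mult.commute)
  then show ?thesis by (simp only: power_mult_distrib mult.assoc)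
qed

theorem theorem1p4:
  shows "\<exists>(A :: learner) (P :: real poly poly).
    \<forall>(n::nat) (\<epsilon>::real) (\<sigma>::real) (\<delta>::real).
      n \<ge> 2 \<and> \<epsilon> > 0 \<and> 0 < \<sigma> \<and> \<sigma> < 1 / 2 \<and> 0 < \<delta> \<and> \<delta> < 1 \<longrightarrow>
      (let B = poly2 P (real n powr (ln (1 / \<epsilon>) / \<sigma>)) (ln (1 / \<delta>)) in
        \<exists>m::nat. real m \<le> B \<and>
          (\<forall>(\<C> :: (point \<Rightarrow> int) set) (D :: example pmf).
             \<C> \<noteq> {} \<and> \<C> \<subseteq> (cube n \<rightarrow> {- 1, 1}) \<and> uniform_marginal n D \<longrightarrow>
             (\<forall>S\<in>set_pmf (replicate_pmf m D).
                \<exists>h\<in>cube n \<rightarrow> {- 1, 1}. outputs A n (params \<epsilon> \<sigma> \<delta>) B S h) \<and>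
             measure_pmf.prob (replicate_pmf m D)
               {S. \<exists>h\<in>cube n \<rightarrow> {- 1, 1}. outputs A n (params \<epsilon> \<sigma> \<delta>) B S h \<and>
                     err D h \<le> smoothed_opt n \<sigma> D \<C> + \<epsilon>} \<ge> 1 - \<delta>))"
proof (intro exI[of _ "(LEARN, EVAL)"] exI[of _ budget] allI impI, elim conjE, unfold Let_def)
  fix n :: nat and \<epsilon> \<sigma> \<delta> :: real
  assume n: "n \<ge> 2" and e: "\<epsilon> > 0" and s: "0 < \<sigma>" "\<sigma> < 1 / 2" and dl: "0 < \<delta>" "\<delta> < 1"
  define d where "d = degr \<epsilon> \<sigma>"
  define q :: nat where "q = 2 ^ eps_exp \<epsilon>"
  define r where "r = del_exp \<delta>"
  define N where "N = (n + 1) ^ d"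
  define Z where "Z = N * q * r"
  define m where "m = 64 * Z ^ 4"
  define K where "K = m * N * q"
  define T where "T = N * q * q + 1"
  note defs = d_def q_def r_def N_def Z_def m_def K_def T_def
  let ?B = "poly2 budget (real n powr (ln (1 / \<epsilon>) / \<sigma>)) (ln (1 / \<delta>))"
  let ?v = "params \<epsilon> \<sigma> \<delta>"
  have q1: "q \<ge> 1" and r1: "r \<ge> 1" and N1: "N \<ge> 1" by (simp_all add: q_def r_def N_def del_exp_def)
  have Z1: "Z \<ge> 1" unfolding Z_def using q1 r1 N1 by simp
  have m0: "m > 0" using Z1 by (simp add: m_def)
  have B: "real (300000 * Z ^ 11) \<le> ?B"
  proof -
    have "real Z \<le> 8 * (1 + (real n powr (ln (1 / \<epsilon>) / \<sigma>)) ^ 105) * (1 + 2 * ln (1 / \<delta>))"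
      unfolding defs by (rule size_bound[OF n e s dl])
    then have "real Z ^ 11 \<le> (8 * (1 + (real n powr (ln (1 / \<epsilon>) / \<sigma>)) ^ 105) * (1 + 2 * ln (1 / \<delta>))) ^ 11"
      by (rule power_mono) simp
    then show ?thesis unfolding poly2_budget by simp
  qed
  have mB: "real m \<le> ?B"
  proof -
    have "Z ^ 4 \<le> Z ^ 11" using Z1 by (intro power_increasing) auto
    then have "real m \<le> real (300000 * Z ^ 11)" unfolding m_def by (intro of_nat_mono) simp
    then show ?thesis using B by linarith
  qed
  show "\<exists>m::nat. real m \<le> ?B \<and>
          (\<forall>(\<C> :: (point \<Rightarrow> int) set) (D :: example pmf).
             \<C> \<noteq> {} \<and> \<C> \<subseteq> (cube n \<rightarrow> {- 1, 1}) \<and> uniform_marginal n D \<longrightarrow>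
             (\<forall>S\<in>set_pmf (replicate_pmf m D).
                \<exists>h\<in>cube n \<rightarrow> {- 1, 1}. outputs (LEARN, EVAL) n ?v ?B S h) \<and>
             measure_pmf.prob (replicate_pmf m D)
               {S. \<exists>h\<in>cube n \<rightarrow> {- 1, 1}. outputs (LEARN, EVAL) n ?v ?B S h \<and>
                     err D h \<le> smoothed_opt n \<sigma> D \<C> + \<epsilon>} \<ge> 1 - \<delta>)"
  proof (intro exI[of _ m] conjI mB allI impI; elim conjE)
    fix \<C> :: "(point \<Rightarrow> int) set" and D :: "example pmf"
    assume C: "\<C> \<noteq> {}" "\<C> \<subseteq> cube n \<rightarrow> {- 1, 1}" and D: "uniform_marginal n D"
    define F where "F S i = feat n d (fst (S ! i))" for S :: "example list" and i
    define y where "y S i = snd (S ! i)" for S :: "example list" and i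
    have sample: "length S = m" "\<And>i. i < m \<Longrightarrow> fst (S ! i) \<in> cube n \<and> snd (S ! i) \<in> {1, -1}"
      if "S \<in> set_pmf (replicate_pmf m D)" for S
    proof -
      show l: "length S = m" using that by (simp add: set_replicate_pmf)
      fix i assume "i < m"
      then have "S ! i \<in> set_pmf D" using that l by (auto simp: set_replicate_pmf in_lists_conv_set)
      then show "fst (S ! i) \<in> cube n \<and> snd (S ! i) \<in> {1, -1}"
        using D by (auto simp: uniform_marginal_def)
    qed
    \<comment> \<open>Termination, the time bound and the optimality on the sample hold for every
      possible sample; only the passage to the distribution is probabilistic.\<close>
    have out: "\<exists>W \<theta>. (\<forall>k<N. \<bar>W k\<bar> \<le> int (T * m)) \<and> \<bar>\<theta>\<bar> \<le> int K \<and>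
        (\<forall>t<T. \<forall>\<theta>'. - int K \<le> \<theta>' \<and> \<theta>' < int K \<longrightarrow>
          nerr m N (F S) (y S) W \<theta> \<le> nerr m N (F S) (y S) (descent m N (int K) (F S) (y S) t) \<theta>') \<and>
        outputs (LEARN, EVAL) n ?v ?B S (hyp n d W \<theta>)"
      if S: "S \<in> set_pmf (replicate_pmf m D)" for S
    proof -
      have "run n ?v LEARN (init_memory n) S (\<lambda>t M I. t \<le> 300000 * Z ^ 11 \<and>
        (\<exists>W \<theta>. (\<forall>k<N. \<bar>W k\<bar> \<le> int (T * m)) \<and> \<bar>\<theta>\<bar> \<le> int K \<and>
        (\<forall>s<T. \<forall>\<theta>'. - int K \<le> \<theta>' \<and> \<theta>' < int K \<longrightarrow>
           nerr m N (F S) (y S) W \<theta> \<le> nerr m N (F S) (y S) (descent m N (int K) (F S) (y S) s) \<theta>') \<and>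
        (\<forall>x. (\<forall>j<n. x j \<in> {1, -1}) \<longrightarrow> run n ?v EVAL M [(x, 1)] (\<lambda>t M' I'. t \<le> 300000 * Z ^ 11 \<and>
           M' 0 = sg (dot N W (feat n d x) - \<theta>)))))"
        unfolding defs F_def[abs_def] y_def[abs_def]
        by (rule run_LEARN[of ?v n S, unfolded params.simps])
          (use sample[OF S] cube_coord e s dl n in \<open>auto simp: defs\<close>)
      then obtain t M I W \<theta> where L: "exec n ?v LEARN (init_memory n, S) t (M, I)" "t \<le> 300000 * Z ^ 11"
        and W: "\<forall>k<N. \<bar>W k\<bar> \<le> int (T * m)" "\<bar>\<theta>\<bar> \<le> int K"
          "\<forall>s<T. \<forall>\<theta>'. - int K \<le> \<theta>' \<and> \<theta>' < int K \<longrightarrow>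
           nerr m N (F S) (y S) W \<theta> \<le> nerr m N (F S) (y S) (descent m N (int K) (F S) (y S) s) \<theta>'"
        and ev: "\<And>x. \<forall>j<n. x j \<in> {1, -1} \<Longrightarrow> run n ?v EVAL M [(x, 1)] (\<lambda>t M' I'. t \<le> 300000 * Z ^ 11 \<and>
           M' 0 = sg (dot N W (feat n d x) - \<theta>))"
        unfolding run_def by blast
      have time: "real t \<le> ?B" if "t \<le> 300000 * Z ^ 11" for t
        using of_nat_mono[OF that, where 'a = real] B by linarith
      have "outputs (LEARN, EVAL) n ?v ?B S (hyp n d W \<theta>)"
        unfolding outputs_def fst_conv snd_conv
      proof (rule exI[of _ t], rule exI[of _ M], rule exI[of _ I], intro conjI ballI)
        show "exec n ?v LEARN (init_memory n, S) t (M, I)" "real t \<le> ?B" using L time by auto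
        fix x assume "x \<in> cube n"
        then have "\<forall>j<n. x j \<in> {1, -1}" using cube_coord by blast
        from ev[OF this] obtain t' M' I' where "exec n ?v EVAL (M, [(x, 1)]) t' (M', I')" "t' \<le> 300000 * Z ^ 11"
            "M' 0 = sg (dot N W (feat n d x) - \<theta>)" unfolding run_def by blast
        then show "\<exists>t' M' I'. exec n ?v EVAL (M, [(x, 1)]) t' (M', I') \<and> real t' \<le> ?B \<and> M' 0 = hyp n d W \<theta> x"
          using time unfolding hyp_def N_def by blast
      qed
      then show ?thesis using W by blast
    qed
    have hyp_range: "hyp n d W \<theta> \<in> cube n \<rightarrow> {- 1, 1}" for W \<theta>
      by (auto simp: hyp_def sg_def)
    show "\<forall>S\<in>set_pmf (replicate_pmf m D). \<exists>h\<in>cube n \<rightarrow> {- 1, 1}. outputs (LEARN, EVAL) n ?v ?B S h"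
      using out hyp_range by blast
    obtain u where u: "(\<Sum>k<N. (u k)\<^sup>2) \<le> 1"
      "measure_pmf.expectation D (\<lambda>(x, y). \<bar>real_of_int y - (\<Sum>k<N. u k * real_of_int (feat n d x k))\<bar>) / 2 + 3 / (2 * real q)
        \<le> smoothed_opt n \<sigma> D \<C> + \<epsilon>"
      using good_comparator[OF e s C D] unfolding N_def d_def q_def by auto
    let ?l = "\<lambda>(x, y). \<bar>real_of_int y - (\<Sum>k<N. u k * real_of_int (feat n d x k))\<bar>"
    let ?G = "{S. sum_list (map ?l S) < real m * measure_pmf.expectation D ?l + real m * (1 / real q) \<and>
      (\<forall>W \<theta>. (\<forall>k<N. \<bar>W k\<bar> \<le> int (T * m)) \<and> \<bar>\<theta>\<bar> \<le> int K \<longrightarrow>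
        err D (hyp n d W \<theta>) < real (nerr m N (F S) (y S) W \<theta>) / real m + 1 / (2 * real q))}"
    have "1 - \<delta> \<le> 1 - (1 / 2) ^ r" using del_exp_facts(1)[OF dl] by (simp add: r_def)
    also have "\<dots> \<le> measure_pmf.prob (replicate_pmf m D) ?G"
      using uniform_convergence[OF q1 r1 D, of u d] u(1)
      unfolding F_def[abs_def] y_def[abs_def] N_def Z_def m_def K_def T_def by simp
    also have "\<dots> \<le> measure_pmf.prob (replicate_pmf m D) {S. \<exists>h\<in>cube n \<rightarrow> {- 1, 1}. outputs (LEARN, EVAL) n ?v ?B S h \<and>
                     err D h \<le> smoothed_opt n \<sigma> D \<C> + \<epsilon>}"
    proof (intro measure_pmf.finite_measure_mono_AE AE_pmfI impI)
      fix S assume S: "S \<in> set_pmf (replicate_pmf m D)" and G: "S \<in> ?G"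
      obtain W \<theta> where W: "\<forall>k<N. \<bar>W k\<bar> \<le> int (T * m)" "\<bar>\<theta>\<bar> \<le> int K"
        and best: "\<And>t \<theta>'. t < T \<Longrightarrow> - int K \<le> \<theta>' \<Longrightarrow> \<theta>' < int K \<Longrightarrow>
          nerr m N (F S) (y S) W \<theta> \<le> nerr m N (F S) (y S) (descent m N (int K) (F S) (y S) t) \<theta>'"
        and o: "outputs (LEARN, EVAL) n ?v ?B S (hyp n d W \<theta>)"
        using out[OF S] by blast
      have Fy: "F S i k \<in> {1, -1}" "y S i \<in> {1, -1}" if "i < m" "k < N" for i k
        using sample(2)[OF S that(1)] feat_sign[of n "fst (S ! i)" k d] cube_coord that(2)
        by (auto simp: F_def y_def N_def)
      obtain t \<theta>' where t: "t < T" "- int K \<le> \<theta>'" "\<theta>' < int K"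
        "2 * real (nerr m N (F S) (y S) (descent m N (int K) (F S) (y S) t) \<theta>') \<le>
          (\<Sum>i<m. \<bar>real_of_int (y S i) - (\<Sum>k<N. u k * real_of_int (F S i k))\<bar>) + real m / real q"
        using descent_threshold[of m N "F S" "y S" u q] Fy N1 q1 m0 u(1) unfolding K_def T_def by fastforce
      have "(\<Sum>i<m. \<bar>real_of_int (y S i) - (\<Sum>k<N. u k * real_of_int (F S i k))\<bar>) = sum_list (map ?l S)"
        unfolding sum_list_sum_nth using sample(1)[OF S]
        by (auto simp: F_def y_def case_prod_unfold lessThan_atLeast0)
      with t(4) have "2 * real (nerr m N (F S) (y S) (descent m N (int K) (F S) (y S) t) \<theta>') \<le>
          real m * measure_pmf.expectation D ?l + real m * (1 / real q) + real m * (1 / real q)"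
        using G by simp
      \<comment> \<open>The output makes at most as many errors as the pair obtained by averaging.
        Of the two terms \<open>1/q\<close>, one is the sampling error of the comparator and one the
        optimisation excess; halved, and with \<open>1/(2q)\<close> for generalisation, they give
        \<open>3/(2q)\<close>.\<close>
      then have "2 * real (nerr m N (F S) (y S) W \<theta>) \<le> real m * (measure_pmf.expectation D ?l + 2 / real q)"
        using best[OF t(1,2,3)] by (simp add: algebra_simps)
      then have "real (nerr m N (F S) (y S) W \<theta>) / real m \<le> measure_pmf.expectation D ?l / 2 + 1 / real q"
        using m0 by (simp add: field_simps)
      moreover have "err D (hyp n d W \<theta>) < real (nerr m N (F S) (y S) W \<theta>) / real m + 1 / (2 * real q)"
        using G W by blast
      moreover have "1 / real q + 1 / (2 * real q) = 3 / (2 * real q)" by simp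
      ultimately have "err D (hyp n d W \<theta>) \<le> smoothed_opt n \<sigma> D \<C> + \<epsilon>" using u(2) by linarith
      then show "S \<in> {S. \<exists>h\<in>cube n \<rightarrow> {- 1, 1}. outputs (LEARN, EVAL) n ?v ?B S h \<and>
                     err D h \<le> smoothed_opt n \<sigma> D \<C> + \<epsilon>}" using o hyp_range by blast
    qed auto
    finally show "measure_pmf.prob (replicate_pmf m D) {S. \<exists>h\<in>cube n \<rightarrow> {- 1, 1}. outputs (LEARN, EVAL) n ?v ?B S h \<and>
                     err D h \<le> smoothed_opt n \<sigma> D \<C> + \<epsilon>} \<ge> 1 - \<delta>" .
  qed
qed

end
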